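(* Let $L=K_1\cup K_2$ and $L'=K_1'\cup K_2'$ be oriented $2$-component virtual links with $\lambda(L)=\lambda(L')=1$. Then $L$ and $L'$ are related by a finite sequence of shell moves (that is, they are S-equivalent) if and only if (i) $J_n(K_1;L)=J_n(K_1';L')$ for any $n\ne 0,1,-1$, (ii) $J_n(K_2;L)=J_n(K_2';L')$ for any $n\ne 0,1,2$, and (iii) $F(L)=F(L')$.
   Context: Gauss diagrams. A Gauss diagram is a disjoint union of oriented circles $C_1,\dots,C_\mu$ together with finitely many chords. Each chord joins two points of the circles (its endpoints; all endpoints of all chords are distinct), is oriented from its initial to its terminal endpoint, and carries a sign $\varepsilon\in\{+1,-1\}$. For a chord of sign $\varepsilon$, the initial endpoint is given the sign $-\varepsilon$ and the terminal endpoint the sign $\varepsilon$. Only the cyclic order of the endpoints on each circle matters. A chord is a self-chord if both endpoints lie on the same circle, otherwise a nonself-chord; a nonself-chord is of type $(i,j)$ if it is oriented from $C_i$ to $C_j$. Endpoints are adjacent (consecutive) if they bound an arc of a circle containing no other endpoint in its interior. Reidemeister moves. R1: insert or delete a self-chord (of any sign and orientation) whose two endpoints are adjacent. R2: insert or delete two chords of opposite signs whose initial endpoints are adjacent and whose terminal endpoints are adjacent (in any order). R3: let $a,b,c$ be three chords of the same sign such that, along the orientation of the circles, the initial endpoint of $a$ is immediately followed by the initial endpoint of $b$, the terminal endpoint of $a$ is immediately followed by the initial endpoint of $c$, and the terminal endpoint of $b$ is immediately followed by the terminal endpoint of $c$; exchange the two endpoints in each of these three adjacent pairs (or the inverse).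 An oriented $\mu$-component virtual link is an equivalence class of Gauss diagrams with $\mu$ (ordered) circles under R1, R2, R3; $L=K_1\cup K_2$ means that $K_i$ corresponds to $C_i$. Shells. Shells for a chord $\gamma$ at an endpoint $p$ of $\gamma$ are self-chords surrounding $p$ in parallel: for shells $s_1,\dots,s_k$ the consecutive endpoints on the circle are: one endpoint of $s_k$, ..., one endpoint of $s_1$, then $p$, then the other endpoint of $s_1$, ..., the other endpoint of $s_k$. If $p$ has positive sign, each shell is oriented as the circle (its initial endpoint precedes $p$ and its terminal endpoint follows $p$); if $p$ has negative sign, each shell is oriented oppositely. The sign of a shell is arbitrary. Shell moves. S1: delete a shell immediately surrounding one endpoint of a chord $\gamma$, and insert a shell of the same sign immediately surrounding the other endpoint of $\gamma$. S2: let $p,q$ be endpoints of two distinct chords with $p$ immediately followed by $q$ along the circle, with signs $\varepsilon_p,\varepsilon_q$; exchange their positions, and add a shell of sign $\varepsilon_p\varepsilon_q$ immediately surrounding $p$ and a shell of sign $-\varepsilon_p\varepsilon_q$ immediately surrounding $q$. Inverses are also allowed. Two virtual links are S-equivalent (related by a finite sequence of shell moves) if their Gauss diagrams are related by a finite sequence of R1, R2, R3, S1, S2. Invariants. Let $G$ be a Gauss diagram of $L=K_1\cup K_2$. ${\rm Lk}(K_i,K_j)$ is the sum of signs of all nonself-chords of type $(i,j)$, and $\lambda=\lambda(L)={\rm Lk}(K_1,K_2)-{\rm Lk}(K_2,K_1)$. For a self-chord $\gamma$ on $C_i$, ${\rm Ind}'(\gamma)$ is the sum of the signs of endpoints of all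 (self- and nonself-) chords on the open arc of $C_i$ running along the orientation from the initial endpoint of $\gamma$ to its terminal endpoint. $J_n(K_1;L)$ for $n\ne 0,-\lambda$ (resp. $J_n(K_2;L)$ for $n\neq 0,\lambda$) is the sum of signs of the self-chords $\gamma$ on $C_1$ (resp. $C_2$) with ${\rm Ind}'(\gamma)=n$; these do not depend on the choice of $G$. Linking class. Take $G$ with at least one nonself-chord and fix a nonself-chord $\gamma_0$. For a nonself-chord $\gamma$ of type $(i,j)$, ${\rm Ind}'(\gamma;\gamma_0)$ is the sum of the signs of endpoints of all chords on $\alpha\cup\beta$, where $\alpha$ is the arc of $C_i$ running along the orientation from the initial endpoint of $\gamma$ to the endpoint of $\gamma_0$ on $C_i$, and $\beta$ is the arc of $C_j$ running along the orientation from the endpoint of $\gamma_0$ on $C_j$ to the terminal endpoint of $\gamma$ (endpoints of $\gamma$ and $\gamma_0$ themselves not counted; ${\rm Ind}'(\gamma_0;\gamma_0)=0$). Let $J_n^{ij}(G;\gamma_0)$ be the sum of signs of nonself-chords $\gamma$ of type $(i,j)$ with ${\rm Ind}'(\gamma;\gamma_0)=n$ and $F_{ij}(t;\gamma_0)=\sum_{n\in\mathbb{Z}}J_n^{ij}(G;\gamma_0)t^n$. For $s\ge 0$ let $\Lambda_s=\mathbb{Z}[t,t^{-1}]/(t^s-1)$ (so $\Lambda_0=\mathbb{Z}[t,t^{-1}]$, $\Lambda_1=\mathbb{Z}$), and let $\Gamma(s)$ be the quotient of $\Lambda_s\times\Lambda_s$ by $(f,g)\sim(t^kf,t^{-k}g)$,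 $k\in\mathbb{Z}$; classes are written $[f,g]$. The linking class $F(L)=[F_{12}(t;\gamma_0),F_{21}(t;\gamma_0)]\in\Gamma(\lambda)$ (for $\lambda\ge0$) does not depend on $\gamma_0$ or $G$. For $\lambda=1$, $\Gamma(1)=\mathbb{Z}\times\mathbb{Z}$ and $F(L)=({\rm Lk}(K_1,K_2),{\rm Lk}(K_2,K_1))$. *)

theory Defs
  imports "HOL-Library.Poly_Mapping"
begin

section \<open>Gauss diagrams\<close>

text \<open>
  The sign is part of the chord, so a Gauss diagram is given by the words of endpoints read along
  its circles. The words are recorded with a base point and the chords with a label; both choices
  are forgotten by \<open>same_diagram\<close> below.
\<close>

datatype chord = Chord (label: nat) (positive: bool)

datatype 'c endpoint = Ini (chord_of: 'c) | Ter (chord_of: 'c)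

type_synonym diagram = "chord endpoint list list"

definition chord_sign :: "chord \<Rightarrow> int" where
  "chord_sign c = (if positive c then 1 else -1)"

fun endpoint_sign :: "chord endpoint \<Rightarrow> int" where
  "endpoint_sign (Ini c) = - chord_sign c"
| "endpoint_sign (Ter c) = chord_sign c"

definition endpoints :: "diagram \<Rightarrow> chord endpoint set" where
  "endpoints G = set (concat G)"

definition chords :: "diagram \<Rightarrow> chord set" where
  "chords G = chord_of ` endpoints G"

definition gauss_diagram :: "nat \<Rightarrow> diagram \<Rightarrow> bool" where
  "gauss_diagram \<mu> G \<longleftrightarrow> length G = \<mu> \<and> distinct (concat G) \<and>
     (\<forall>c \<in> chords G. Ini c \<in> endpoints G \<and> Ter c \<in> endpoints G)"

definition same_diagram :: "diagram \<Rightarrow> diagram \<Rightarrow> bool" where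
  "same_diagram G H \<longleftrightarrow>
     (\<exists>f. inj_on f (chords G) \<and> (\<forall>c \<in> chords G. chord_sign (f c) = chord_sign c) \<and>
          list_all2 (\<lambda>v w. \<exists>k. w = rotate k (map (map_endpoint f) v)) G H)"

definition consecutive :: "diagram \<Rightarrow> chord endpoint list \<Rightarrow> bool" where
  "consecutive G ps \<longleftrightarrow> (\<exists>w \<in> set G. \<exists>k u. rotate k w = ps @ u)"

definition adjacent :: "diagram \<Rightarrow> chord endpoint \<Rightarrow> chord endpoint \<Rightarrow> bool" where
  "adjacent G p q \<longleftrightarrow> consecutive G [p, q] \<or> consecutive G [q, p]"

definition delete :: "chord set \<Rightarrow> diagram \<Rightarrow> diagram" where
  "delete A G = map (filter (\<lambda>p. chord_of p \<notin> A)) G"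

definition exchange :: "chord endpoint \<Rightarrow> chord endpoint \<Rightarrow> diagram \<Rightarrow> diagram" where
  "exchange p q G = map (map (id(p := q, q := p))) G"


section \<open>Reidemeister moves and virtual links\<close>

text \<open>
  Each move is given in one direction only, and inverses are supplied by the equivalence closure.
  Insertion of chords into \<open>G\<close> is expressed by saying that deleting them from the result gives
  back \<open>G\<close>.
\<close>

definition R1 :: "diagram \<Rightarrow> diagram \<Rightarrow> bool" where
  "R1 G H \<longleftrightarrow> (\<exists>c. adjacent G (Ini c) (Ter c) \<and> H = delete {c} G)"

definition R2 :: "diagram \<Rightarrow> diagram \<Rightarrow> bool" where
  "R2 G H \<longleftrightarrow> (\<exists>c d. chord_sign d = - chord_sign c \<and>
     adjacent G (Ini c) (Ini d) \<and> adjacent G (Ter c) (Ter d) \<and> H = delete {c, d} G)"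

definition R3 :: "diagram \<Rightarrow> diagram \<Rightarrow> bool" where
  "R3 G H \<longleftrightarrow> (\<exists>a b c. distinct [a, b, c] \<and>
     chord_sign a = chord_sign b \<and> chord_sign b = chord_sign c \<and>
     consecutive G [Ini a, Ini b] \<and> consecutive G [Ter a, Ini c] \<and> consecutive G [Ter b, Ter c] \<and>
     H = exchange (Ini a) (Ini b) (exchange (Ter a) (Ini c) (exchange (Ter b) (Ter c) G)))"

definition reidemeister_step :: "nat \<Rightarrow> diagram \<Rightarrow> diagram \<Rightarrow> bool" where
  "reidemeister_step \<mu> G H \<longleftrightarrow> gauss_diagram \<mu> G \<and> gauss_diagram \<mu> H \<and>
     (same_diagram G H \<or> R1 G H \<or> R2 G H \<or> R3 G H)"

definition reidemeister_equiv :: "nat \<Rightarrow> (diagram \<times> diagram) set" where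
  "reidemeister_equiv \<mu> =
     {(G, H). gauss_diagram \<mu> G \<and> gauss_diagram \<mu> H \<and> equivclp (reidemeister_step \<mu>) G H}"

definition virtual_links :: "nat \<Rightarrow> diagram set set" where
  "virtual_links \<mu> = {G. gauss_diagram \<mu> G} // reidemeister_equiv \<mu>"

lemma equiv_reidemeister_equiv: "equiv {G. gauss_diagram \<mu> G} (reidemeister_equiv \<mu>)"
  by (rule equivI)
    (auto simp: reidemeister_equiv_def refl_on_def intro!: symI transI
       intro: equivclp_sym equivclp_trans)


section \<open>Shell moves\<close>

definition shell :: "diagram \<Rightarrow> chord \<Rightarrow> chord endpoint \<Rightarrow> bool" where
  "shell G s p \<longleftrightarrow> s \<noteq> chord_of p \<and>
     (if endpoint_sign p = 1 then consecutive G [Ini s, p, Ter s]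
      else consecutive G [Ter s, p, Ini s])"

definition S1 :: "diagram \<Rightarrow> diagram \<Rightarrow> bool" where
  "S1 G H \<longleftrightarrow> (\<exists>\<gamma> p q s s'. {p, q} = {Ini \<gamma>, Ter \<gamma>} \<and> chord_sign s' = chord_sign s \<and>
     shell G s p \<and> shell H s' q \<and> delete {s} G = delete {s'} H)"

definition S2 :: "diagram \<Rightarrow> diagram \<Rightarrow> bool" where
  "S2 G H \<longleftrightarrow> (\<exists>p q s t. chord_of p \<noteq> chord_of q \<and> consecutive G [p, q] \<and> s \<noteq> t \<and>
     chord_sign s = endpoint_sign p * endpoint_sign q \<and>
     chord_sign t = - (endpoint_sign p * endpoint_sign q) \<and>
     shell H s p \<and> shell H t q \<and> delete {s, t} H = exchange p q G)"

definition shell_step :: "nat \<Rightarrow> diagram \<Rightarrow> diagram \<Rightarrow> bool" where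
  "shell_step \<mu> G H \<longleftrightarrow> gauss_diagram \<mu> G \<and> gauss_diagram \<mu> H \<and> (S1 G H \<or> S2 G H)"

definition S_equivalent :: "nat \<Rightarrow> diagram set \<Rightarrow> diagram set \<Rightarrow> bool" where
  "S_equivalent \<mu> L L' \<longleftrightarrow>
     (\<exists>G \<in> L. \<exists>G' \<in> L'. equivclp (\<lambda>D E. reidemeister_step \<mu> D E \<or> shell_step \<mu> D E) G G')"


section \<open>Invariants of Gauss diagrams\<close>

text \<open>Circles are numbered from 1.\<close>

definition circle :: "diagram \<Rightarrow> nat \<Rightarrow> chord endpoint list" where
  "circle G i = G ! (i - 1)"

definition self_chords :: "diagram \<Rightarrow> nat \<Rightarrow> chord set" where
  "self_chords G i = {c. Ini c \<in> set (circle G i) \<and> Ter c \<in> set (circle G i)}"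

definition nonself_chords :: "diagram \<Rightarrow> nat \<Rightarrow> nat \<Rightarrow> chord set" where
  "nonself_chords G i j = {c. i \<noteq> j \<and> Ini c \<in> set (circle G i) \<and> Ter c \<in> set (circle G j)}"

definition linking :: "diagram \<Rightarrow> nat \<Rightarrow> nat \<Rightarrow> int" where
  "linking G i j = (\<Sum>c \<in> nonself_chords G i j. chord_sign c)"

text \<open>
  \<open>open_arc w p q\<close> is the open arc from \<open>p\<close> to \<open>q\<close> of the cyclic word \<open>w\<close>; the word is doubled so
  that the arc may pass through the base point.
\<close>

definition open_arc :: "'a list \<Rightarrow> 'a \<Rightarrow> 'a \<Rightarrow> 'a list" where
  "open_arc w p q = takeWhile (\<lambda>x. x \<noteq> q) (tl (dropWhile (\<lambda>x. x \<noteq> p) (w @ w)))"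

lemma open_arc_unwrapped:
  assumes "distinct (x @ p # u @ q # y)"
  shows "open_arc (x @ p # u @ q # y) p q = u"
proof -
  have "dropWhile (\<lambda>z. z \<noteq> p) ((x @ p # u @ q # y) @ x @ p # u @ q # y)
      = p # u @ q # y @ x @ p # u @ q # y"
    using assms by (auto simp: dropWhile_append)
  moreover have "\<forall>z \<in> set u. z \<noteq> q"
    using assms by auto
  ultimately show ?thesis
    by (simp add: open_arc_def)
qed

lemma open_arc_wrapped:
  assumes "distinct (x @ q # u @ p # y)"
  shows "open_arc (x @ q # u @ p # y) p q = y @ x"
proof -
  have "dropWhile (\<lambda>z. z \<noteq> p) ((x @ q # u @ p # y) @ x @ q # u @ p # y)
      = p # y @ x @ q # u @ p # y"
    using assms by (auto simp: dropWhile_append)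
  moreover have "\<forall>z \<in> set (y @ x). z \<noteq> q"
    using assms by auto
  ultimately show ?thesis
    by (simp add: open_arc_def)
qed

definition arc_sum :: "chord endpoint list \<Rightarrow> chord endpoint \<Rightarrow> chord endpoint \<Rightarrow> int" where
  "arc_sum w p q = (\<Sum>x \<leftarrow> open_arc w p q. endpoint_sign x)"

definition self_index :: "diagram \<Rightarrow> nat \<Rightarrow> chord \<Rightarrow> int" where
  "self_index G i c = arc_sum (circle G i) (Ini c) (Ter c)"

definition self_writhe :: "diagram \<Rightarrow> nat \<Rightarrow> int \<Rightarrow> int" where
  "self_writhe G i n = (\<Sum>c | c \<in> self_chords G i \<and> self_index G i c = n. chord_sign c)"

definition endpoint_on :: "diagram \<Rightarrow> nat \<Rightarrow> chord \<Rightarrow> chord endpoint" where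
  "endpoint_on G i c = (if Ini c \<in> set (circle G i) then Ini c else Ter c)"

definition nonself_index :: "diagram \<Rightarrow> chord \<Rightarrow> nat \<Rightarrow> nat \<Rightarrow> chord \<Rightarrow> int" where
  "nonself_index G \<gamma>0 i j c =
     (if c = \<gamma>0 then 0
      else arc_sum (circle G i) (Ini c) (endpoint_on G i \<gamma>0) +
           arc_sum (circle G j) (endpoint_on G j \<gamma>0) (Ter c))"

definition nonself_writhe :: "diagram \<Rightarrow> chord \<Rightarrow> nat \<Rightarrow> nat \<Rightarrow> int \<Rightarrow> int" where
  "nonself_writhe G \<gamma>0 i j n =
     (\<Sum>c | c \<in> nonself_chords G i j \<and> nonself_index G \<gamma>0 i j c = n. chord_sign c)"


section \<open>The linking class\<close>

text \<open>
  With convolution as multiplication, finitely supported functions from the integers to the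
  integers form the ring of integral Laurent polynomials in one variable.
\<close>

type_synonym laurent = "int \<Rightarrow>\<^sub>0 int"

definition tpow :: "int \<Rightarrow> laurent" where
  "tpow k = Poly_Mapping.single k 1"

definition linking_poly :: "diagram \<Rightarrow> chord \<Rightarrow> nat \<Rightarrow> nat \<Rightarrow> laurent" where
  "linking_poly G \<gamma>0 i j = Abs_poly_mapping (nonself_writhe G \<gamma>0 i j)"

text \<open>
  Elements of the quotient ring modulo \<open>t ^ s - 1\<close> are cosets, and \<open>gamma_class s f g\<close> is the
  orbit of the pair of cosets of \<open>f\<close> and \<open>g\<close> under the action of the integers.
\<close>

definition lambda_coset :: "nat \<Rightarrow> laurent \<Rightarrow> laurent set" where
  "lambda_coset s f = {g. (tpow (int s) - 1) dvd (g - f)}"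

definition gamma_class :: "nat \<Rightarrow> laurent \<Rightarrow> laurent \<Rightarrow> (laurent set \<times> laurent set) set" where
  "gamma_class s f g =
     range (\<lambda>k. (lambda_coset s (tpow k * f), lambda_coset s (tpow (- k) * g)))"


section \<open>Invariants of virtual links\<close>

text \<open>
  The invariants of a link are read off from an arbitrary representative. \<open>J L i n\<close> is independent
  of it for \<open>n\<close> different from 0 and \<open>- lam L\<close> (if \<open>i = 1\<close>), from 0 and \<open>lam L\<close> (if \<open>i = 2\<close>), and is
  meaningful only for these \<open>n\<close>; the linking class is meaningful if \<open>lam L \<ge> 0\<close>.
\<close>

definition rep :: "diagram set \<Rightarrow> diagram" where
  "rep L = (SOME G. G \<in> L)"

definition Lk :: "diagram set \<Rightarrow> nat \<Rightarrow> nat \<Rightarrow> int" where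
  "Lk L i j = linking (rep L) i j"

definition lam :: "diagram set \<Rightarrow> int" where
  "lam L = Lk L 1 2 - Lk L 2 1"

definition J :: "diagram set \<Rightarrow> nat \<Rightarrow> int \<Rightarrow> int" where
  "J L i n = self_writhe (rep L) i n"

definition linking_class :: "diagram set \<Rightarrow> (laurent set \<times> laurent set) set" where
  "linking_class L =
     (SOME X. \<exists>G \<in> L. \<exists>\<gamma>0 \<in> nonself_chords G 1 2 \<union> nonself_chords G 2 1.
        X = gamma_class (nat (lam L)) (linking_poly G \<gamma>0 1 2) (linking_poly G \<gamma>0 2 1))"

end

theory Submission
  imports Defs "HOL-Library.Multiset" "HOL-Library.Nat_Bijection"
begin

text \<open>
  Write \<open>T\<close> for the sum of the signs of the endpoints on a circle. It equals \<open>- \<lambda>\<close> on the first circle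
  and \<open>\<lambda>\<close> on the second, so \<open>- 1\<close> and \<open>1\<close> in the theorem.

  The conditions are necessary because the shell moves preserve the index of every chord that they
  do not create or delete. Moving \<open>q\<close> across \<open>p\<close> changes the indices of the two chords by plus or
  minus the same number, and the two shells added by S2 compensate exactly this
  (\<open>self_index_exchange\<close>, \<open>self_index_delete_shell\<close>). A shell changes the index of its chord by an
  amount that does not depend on the endpoint that it surrounds, so S1 changes nothing. The chords
  that are created or deleted without a partner of opposite sign and equal index are kinks, of index
  \<open>0\<close> or \<open>T\<close>, and shells, of index \<open>1\<close> or \<open>T + 1\<close>; for \<open>\<lambda> = 1\<close> these are the values of \<open>n\<close> for
  which nothing is asserted about \<open>J\<close>. In the linking class \<open>t\<close> becomes \<open>1\<close>, and what remains of the two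
  Laurent polynomials are the two linking numbers, the sums of their coefficients
  (\<open>linking_class_1\<close>).

  They are sufficient because shells can be treated as integers. By S1 and R2 the shells around both
  endpoints of a chord \<open>c\<close> can be gathered into parallel shells of one sign around its initial
  endpoint, counted with sign by a weight \<open>w c\<close> (\<open>decorate_weighted\<close>). In terms of weights, S2 says that two
  consecutive endpoints of distinct chords may be exchanged at the price of adding the product of
  their signs to one weight and subtracting it from the other (\<open>weighted_exchange\<close>). Hence the
  endpoints may be rearranged at will, and every diagram is equivalent to a normal form in which each
  self-chord is isolated, its terminal endpoint following its initial one; its index is then
  minus its weight times its sign (\<open>weighted_nf_exists\<close>).

  Three observations simplify normal forms when \<open>\<lambda> = 1\<close>. The weight of a nonself-chord can be changed
  at will, by carrying its endpoint once around the first circle, where \<open>T = - 1\<close>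
  (\<open>weighted_nonself_free\<close>). An isolated self-chord of index \<open>0\<close>, \<open>1\<close>, \<open>T\<close> or \<open>T + 1\<close> can be turned into a
  kink, or into a shell around an endpoint of a new kink, and so be removed
  (\<open>weighted_remove_block\<close>). Finally, two chords of the same kind with opposite signs cancel,
  provided that their indices agree if they are self-chords (\<open>weighted_cancel_parallel\<close>,
  \<open>nf_cancel_nonself\<close>). When none of this is possible any more, the signs of all chords and the
  indices of the self-chords can be read off from the invariants, and two normal forms with the same
  invariants differ only by the order and the labels of their chords and by irrelevant weights
  (\<open>reduced_equiv\<close>).
\<close>

section \<open>Arc sums\<close>

definition rotation :: "'a list \<Rightarrow> 'a list \<Rightarrow> bool" where
  "rotation w v \<longleftrightarrow> (\<exists>x y. w = x @ y \<and> v = y @ x)"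

lemma rotation_iff_rotate: "rotation w v \<longleftrightarrow> (\<exists>k. v = rotate k w)"
proof
  assume "rotation w v"
  then obtain x y where "w = x @ y" "v = y @ x" by (auto simp: rotation_def)
  then have "v = rotate (length x) w" by (simp add: rotate_append)
  then show "\<exists>k. v = rotate k w" ..
next
  assume "\<exists>k. v = rotate k w"
  then obtain k where "v = rotate k w" ..
  then have "v = drop (k mod length w) w @ take (k mod length w) w"
    by (simp add: rotate_drop_take)
  then show "rotation w v"
    unfolding rotation_def by (metis append_take_drop_id)
qed

lemma rotation_refl [simp]: "rotation w w"
  by (auto simp: rotation_def)

lemma rotation_append: "rotation (x @ y) (y @ x)"
  by (auto simp: rotation_def)

lemma rotationE:
  assumes "rotation w v" obtains x y where "w = x @ y" "v = y @ x"
  using assms by (auto simp: rotation_def)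

lemma rotation_sym: "rotation w v \<Longrightarrow> rotation v w"
  by (auto simp: rotation_def)

lemma rotation_trans: "rotation u v \<Longrightarrow> rotation v w \<Longrightarrow> rotation u w"
  by (metis rotation_iff_rotate rotate_rotate)

lemma rotation_set: "rotation w v \<Longrightarrow> set v = set w"
  and rotation_distinct: "rotation w v \<Longrightarrow> distinct v = distinct w"
  by (auto simp: rotation_def)

lemma rotation_map: "rotation w v \<Longrightarrow> rotation (map f w) (map f v)"
  and rotation_filter: "rotation w v \<Longrightarrow> rotation (filter P w) (filter P v)"
  by (auto simp: rotation_append elim!: rotationE)

lemma consecutive_iff_rotation:
  "consecutive G ps \<longleftrightarrow> (\<exists>w \<in> set G. \<exists>u. rotation w (ps @ u))"
  unfolding consecutive_def rotation_iff_rotate by metis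

definition sign_sum :: "chord endpoint list \<Rightarrow> int" where
  "sign_sum w = (\<Sum>x\<leftarrow>w. endpoint_sign x)"

lemma sign_sum_simps [simp]:
  "sign_sum [] = 0" "sign_sum (x # w) = endpoint_sign x + sign_sum w" "sign_sum (u @ v) = sign_sum u + sign_sum v"
  by (simp_all add: sign_sum_def)

lemma rotation_sign_sum: "rotation w v \<Longrightarrow> sign_sum v = sign_sum w"
  by (auto simp: rotation_def)

lemma endpoint_sign_cases: "endpoint_sign p = 1 \<or> endpoint_sign p = -1"
  by (cases p) (auto simp: chord_sign_def)

lemma endpoint_sign_mult_self [simp]: "endpoint_sign p * endpoint_sign p = 1"
  using endpoint_sign_cases [of p] by auto

lemma chord_sign_cases: "chord_sign c = 1 \<or> chord_sign c = -1"
  by (simp add: chord_sign_def)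

lemma chord_sign_mult_self [simp]: "chord_sign c * chord_sign c = 1"
  by (simp add: chord_sign_def)

text \<open>
  The sum of the signs in front of \<open>p\<close>. Arc sums are differences of heights, up to the total of the
  word when the arc passes the base point; this turns every comparison of arcs below into arithmetic.
\<close>

definition height :: "chord endpoint list \<Rightarrow> chord endpoint \<Rightarrow> int" where
  "height w p = sign_sum (takeWhile (\<lambda>x. x \<noteq> p) w)"

lemma height_simps [simp]:
  "height [] p = 0"
  "height (x # w) p = (if x = p then 0 else endpoint_sign x + height w p)"
  by (auto simp: height_def)

lemma height_append: "height (u @ v) p = (if p \<in> set u then height u p else sign_sum u + height v p)"
  by (induction u) auto

lemma arc_sum_height:
  assumes "distinct w" "p \<in> set w" "q \<in> set w" "p \<noteq> q"
  shows "arc_sum w p q = height w q - height w p - endpoint_sign p +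
    (if q \<in> set (takeWhile (\<lambda>x. x \<noteq> p) w) then sign_sum w else 0)"
proof -
  obtain x y where w: "w = x @ p # y" using assms(2) by (meson split_list)
  consider "q \<in> set y" | "q \<in> set x" using w assms by auto
  then show ?thesis
  proof cases
    case 1
    then obtain u z where y: "y = u @ q # z" by (meson split_list)
    have "arc_sum w p q = sign_sum u"
      using assms(1) unfolding w y arc_sum_def sign_sum_def
      by (subst open_arc_unwrapped) auto
    then show ?thesis using assms(1,4) unfolding w y
      by (auto simp: height_append takeWhile_append)
  next
    case 2
    then obtain u z where x: "x = u @ q # z" by (meson split_list)
    have "arc_sum w p q = sign_sum (y @ u)"
      using assms(1) unfolding w x arc_sum_def sign_sum_def
      using open_arc_wrapped[of u q z p y] by auto
    then show ?thesis using assms(1,4) unfolding w x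
      by (auto simp: height_append takeWhile_append)
  qed
qed

text \<open>
  Moving the base point past \<open>z\<close> lowers all other heights by the sign of \<open>z\<close>; the height of \<open>z\<close> itself
  grows by the rest of the word, and this is compensated by the change in which arcs wrap.
\<close>

lemma arc_sum_rotate1:
  assumes "distinct (z # w)" "p \<in> set (z # w)" "q \<in> set (z # w)" "p \<noteq> q"
  shows "arc_sum (w @ [z]) p q = arc_sum (z # w) p q"
  using assms
  by (auto simp: arc_sum_height height_append takeWhile_append dest: set_takeWhileD)

lemma arc_sum_rotation:
  assumes "rotation w v" "distinct w" "p \<in> set w" "q \<in> set w" "p \<noteq> q"
  shows "arc_sum v p q = arc_sum w p q"
proof -
  obtain k where v: "v = rotate k w" using assms(1) rotation_iff_rotate by blast
  have "arc_sum (rotate k w) p q = arc_sum w p q"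
  proof (induction k)
    case (Suc k)
    obtain z u where zu: "rotate k w = z # u"
      using assms(3) by (metis empty_iff list.exhaust set_empty set_rotate)
    have "rotate (Suc k) w = u @ [z]" by (simp add: zu)
    moreover have "distinct (z # u)" "p \<in> set (z # u)" "q \<in> set (z # u)"
      using assms zu by (metis distinct_rotate, metis set_rotate, metis set_rotate)
    ultimately show ?case using Suc arc_sum_rotate1 assms(5) zu by metis
  qed simp
  then show ?thesis using v by simp
qed

text \<open>
  Only the heights of \<open>x\<close> and \<open>y\<close> change. The arc between \<open>x\<close> and \<open>y\<close> is excluded since the exchange
  also reverses their order and so makes this arc wrap around the whole circle.
\<close>

lemma arc_sum_exchange_head:
  assumes "distinct (x # y # u)" "p \<in> set (x # y # u)" "q \<in> set (x # y # u)" "p \<noteq> q"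
    and "{p, q} \<noteq> {x, y}"
  shows "arc_sum (y # x # u) p q = arc_sum (x # y # u) p q
    + (if p = y then endpoint_sign x else 0) - (if p = x then endpoint_sign y else 0)
    + (if q = x then endpoint_sign y else 0) - (if q = y then endpoint_sign x else 0)"
proof -
  have [simp]: "v \<notin> set (takeWhile P u)" if "v \<notin> set u" for v P
    using that by (meson set_takeWhileD)
  have n: "x \<noteq> y" "y \<noteq> x" "x \<notin> set u" "y \<notin> set u"
    and m: "p \<noteq> q" "q \<noteq> p" "p \<noteq> x \<or> q \<noteq> y" "p \<noteq> y \<or> q \<noteq> x"
    using assms by auto
  have 1: "arc_sum (y # x # u) p q = height (y # x # u) q - height (y # x # u) p - endpoint_sign p +
    (if q \<in> set (takeWhile (\<lambda>v. v \<noteq> p) (y # x # u)) then sign_sum (y # x # u) else 0)"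
    using assms by (intro arc_sum_height) auto
  have 2: "arc_sum (x # y # u) p q = height (x # y # u) q - height (x # y # u) p - endpoint_sign p +
    (if q \<in> set (takeWhile (\<lambda>v. v \<noteq> p) (x # y # u)) then sign_sum (x # y # u) else 0)"
    using assms by (intro arc_sum_height) auto
  show ?thesis
    unfolding 1 2 using n
    by ((cases "p = x"; cases "p = y"; cases "q = x"; cases "q = y"),
        simp_all (no_asm_simp) add: m, (use m in blast)+)
qed

lemma arc_sum_delete_pair_head:
  assumes "distinct (x # y # u)" "p \<in> set u" "q \<in> set u" "p \<noteq> q"
    and "endpoint_sign x + endpoint_sign y = 0"
  shows "arc_sum (x # y # u) p q = arc_sum u p q"
proof -
  have [simp]: "v \<notin> set (takeWhile P u)" if "v \<notin> set u" for v P
    using that by (meson set_takeWhileD)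
  have 1: "arc_sum (x # y # u) p q = height (x # y # u) q - height (x # y # u) p - endpoint_sign p +
    (if q \<in> set (takeWhile (\<lambda>v. v \<noteq> p) (x # y # u)) then sign_sum (x # y # u) else 0)"
    using assms by (intro arc_sum_height) auto
  have 2: "arc_sum (u) p q = height (u) q - height (u) p - endpoint_sign p +
    (if q \<in> set (takeWhile (\<lambda>v. v \<noteq> p) (u)) then sign_sum (u) else 0)"
    using assms by (intro arc_sum_height) auto
  show ?thesis
    using assms unfolding 1 2 by (cases "p = x"; cases "p = y"; cases "q = x"; cases "q = y"; simp)
qed

lemma arc_sum_delete_shell_head:
  assumes "distinct (x # z # y # u)" "p \<in> set (z # u)" "q \<in> set (z # u)" "p \<noteq> q"
    and "endpoint_sign x + endpoint_sign y = 0"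
  shows "arc_sum (x # z # y # u) p q = arc_sum (z # u) p q
    + (if p = z then endpoint_sign y else 0) + (if q = z then endpoint_sign x else 0)"
proof -
  have [simp]: "v \<notin> set (takeWhile P u)" if "v \<notin> set u" for v P
    using that by (meson set_takeWhileD)
  have n: "x \<noteq> z" "z \<noteq> x" "y \<noteq> z" "z \<noteq> y" "p \<noteq> x" "p \<noteq> y" "q \<noteq> x" "q \<noteq> y" "p \<noteq> q" "q \<noteq> p"
    "x \<notin> set u" "y \<notin> set u" "z \<notin> set u" "endpoint_sign y = - endpoint_sign x"
    using assms by auto
  have 1: "arc_sum (x # z # y # u) p q = height (x # z # y # u) q - height (x # z # y # u) p - endpoint_sign p +
    (if q \<in> set (takeWhile (\<lambda>v. v \<noteq> p) (x # z # y # u)) then sign_sum (x # z # y # u) else 0)"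
    using assms by (intro arc_sum_height) auto
  have 2: "arc_sum (z # u) p q = height (z # u) q - height (z # u) p - endpoint_sign p +
    (if q \<in> set (takeWhile (\<lambda>v. v \<noteq> p) (z # u)) then sign_sum (z # u) else 0)"
    using assms by (intro arc_sum_height) auto
  show ?thesis
    unfolding 1 2 using n by (cases "p = z"; cases "q = z") (simp_all (no_asm_simp))
qed

lemma arc_sum_exchange:
  assumes w: "distinct w" "p \<in> set w" "q \<in> set w" "p \<noteq> q" and pq: "{p, q} \<noteq> {x, y}"
    and xy: "{x, y} \<inter> set w = {} \<or> rotation w (x # y # u)"
  shows "arc_sum (map (id(x := y, y := x)) w) p q = arc_sum w p q
    + (if p = y then endpoint_sign x else 0) - (if p = x then endpoint_sign y else 0)
    + (if q = x then endpoint_sign y else 0) - (if q = y then endpoint_sign x else 0)"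
  using xy
proof
  assume d: "{x, y} \<inter> set w = {}"
  then have "map (id(x := y, y := x)) w = w"
    by (intro map_idI) auto
  then show ?thesis using d w by auto
next
  assume r: "rotation w (x # y # u)"
  then have d: "distinct (x # y # u)" and s: "set (x # y # u) = set w"
    using w rotation_distinct rotation_set by blast+
  have "map (id(x := y, y := x)) (x # y # u) = y # x # u"
    using d by (auto intro!: map_idI)
  then have "rotation (map (id(x := y, y := x)) w) (y # x # u)"
    using rotation_map [OF r] by metis
  from rotation_sym [OF this]
  have "arc_sum (map (id(x := y, y := x)) w) p q = arc_sum (y # x # u) p q"
    by (rule arc_sum_rotation) (use d s w in auto)
  moreover have "arc_sum (x # y # u) p q = arc_sum w p q"
    using r w by (rule arc_sum_rotation)
  moreover have "p \<in> set (x # y # u)" "q \<in> set (x # y # u)"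
    using s w by auto
  ultimately show ?thesis
    using arc_sum_exchange_head [OF d _ _ w(4) pq] by presburger
qed

lemma arc_sum_delete_pair:
  assumes w: "distinct w" "p \<in> set w" "q \<in> set w" "p \<noteq> q" and pq: "P p" "P q"
    and r: "rotation w (x # y # u)" and xy: "endpoint_sign x + endpoint_sign y = 0"
    and P: "\<And>z. z \<in> set w \<Longrightarrow> P z \<longleftrightarrow> z \<noteq> x \<and> z \<noteq> y"
  shows "arc_sum (filter P w) p q = arc_sum w p q"
proof -
  have d: "distinct (x # y # u)" and s: "set (x # y # u) = set w"
    using r w rotation_distinct rotation_set by blast+
  have pu: "p \<in> set u" "q \<in> set u"
    using P [OF w(2)] P [OF w(3)] pq w s by (metis set_ConsD)+
  have "P z" if "z \<in> set u" for z
    using P [of z] that d s by fastforce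
  moreover have "\<not> P x" "\<not> P y"
    using P [of x] P [of y] s by (metis list.set_intros)+
  ultimately have "filter P (x # y # u) = u"
    by (simp add: filter_id_conv)
  then have "rotation (filter P w) u"
    using rotation_filter [OF r, of P] by simp
  then have "arc_sum u p q = arc_sum (filter P w) p q"
    by (rule arc_sum_rotation) (simp_all add: w pq)
  moreover have "arc_sum (x # y # u) p q = arc_sum w p q"
    using r w by (rule arc_sum_rotation)
  moreover have "arc_sum (x # y # u) p q = arc_sum u p q"
    using d pu w(4) xy by (rule arc_sum_delete_pair_head)
  ultimately show ?thesis by simp
qed

lemma arc_sum_delete_shell:
  assumes w: "distinct w" "p \<in> set w" "q \<in> set w" "p \<noteq> q" and pq: "P p" "P q"
    and r: "rotation w (x # z # y # u)" and xy: "endpoint_sign x + endpoint_sign y = 0"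
    and P: "\<And>v. v \<in> set w \<Longrightarrow> P v \<longleftrightarrow> v \<noteq> x \<and> v \<noteq> y"
  shows "arc_sum w p q = arc_sum (filter P w) p q
    + (if p = z then endpoint_sign y else 0) + (if q = z then endpoint_sign x else 0)"
proof -
  have d: "distinct (x # z # y # u)" and s: "set (x # z # y # u) = set w"
    using r w rotation_distinct rotation_set by blast+
  have pu: "p \<in> set (z # u)" "q \<in> set (z # u)"
    using P [OF w(2)] P [OF w(3)] pq w s by (metis set_ConsD list.set_intros)+
  have "P v" if "v \<in> set (z # u)" for v
    using P [of v] that d s by fastforce
  moreover have "\<not> P x" "\<not> P y"
    using P [of x] P [of y] s by (metis list.set_intros)+
  ultimately have "filter P (x # z # y # u) = z # u"
    by (simp add: filter_id_conv)
  then have "rotation (filter P w) (z # u)"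
    using rotation_filter [OF r, of P] by simp
  then have "arc_sum (z # u) p q = arc_sum (filter P w) p q"
    by (rule arc_sum_rotation) (simp_all add: w pq)
  moreover have "arc_sum (x # z # y # u) p q = arc_sum w p q"
    using r w by (rule arc_sum_rotation)
  ultimately show ?thesis
    using arc_sum_delete_shell_head [OF d pu w(4) xy] by presburger
qed

section \<open>Circles of a Gauss diagram\<close>

lemma gauss_circle_unique:
  assumes "gauss_diagram \<mu> G" "i < \<mu>" "j < \<mu>" "x \<in> set (G ! i)" "x \<in> set (G ! j)"
  shows "i = j"
proof (rule ccontr)
  have one: False if "a < b" "b < length G" "x \<in> set (G ! a)" "x \<in> set (G ! b)" "distinct (concat G)" for a b
  proof -
    have "G = take b G @ G ! b # drop (Suc b) G"
      using that by (simp add: id_take_nth_drop)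
    then have c: "concat G = concat (take b G) @ G ! b @ concat (drop (Suc b) G)"
      by (metis concat.simps(2) concat_append)
    have "G ! a \<in> set (take b G)"
      using that by (metis in_set_conv_nth length_take min.absorb4 nth_take)
    then have "x \<in> set (concat (take b G))"
      using that(3) by auto
    moreover have "distinct (concat (take b G) @ G ! b @ concat (drop (Suc b) G))"
      using that(5) unfolding c .
    ultimately show False
      using that(4) by (metis Un_iff distinct_append disjoint_iff set_append)
  qed
  assume "i \<noteq> j"
  moreover have "length G = \<mu>" "distinct (concat G)"
    using assms(1) by (simp_all add: gauss_diagram_def)
  ultimately show False
    using one [of i j] one [of j i] assms(2-5) by (cases "i < j") auto
qed

lemma gauss_circle_distinct: "gauss_diagram \<mu> G \<Longrightarrow> w \<in> set G \<Longrightarrow> distinct w"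
  by (auto simp: gauss_diagram_def distinct_concat_iff)

lemma endpoints_circle:
  assumes "gauss_diagram \<mu> G" "x \<in> endpoints G"
  obtains i where "1 \<le> i" "i \<le> \<mu>" "x \<in> set (circle G i)" "circle G i \<in> set G"
proof -
  from assms obtain w where "w \<in> set G" "x \<in> set w"
    by (auto simp: endpoints_def)
  then obtain j where "j < \<mu>" "x \<in> set (G ! j)"
    using assms(1) by (metis gauss_diagram_def in_set_conv_nth)
  then show ?thesis using that [of "Suc j"] assms by (auto simp: circle_def gauss_diagram_def)
qed

lemma circle_in: "gauss_diagram \<mu> G \<Longrightarrow> 1 \<le> i \<Longrightarrow> i \<le> \<mu> \<Longrightarrow> circle G i \<in> set G"
  by (auto simp: circle_def gauss_diagram_def)

lemma circle_distinct: "gauss_diagram \<mu> G \<Longrightarrow> 1 \<le> i \<Longrightarrow> i \<le> \<mu> \<Longrightarrow> distinct (circle G i)"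
  by (meson circle_in gauss_circle_distinct)

lemma circle_endpoints:
  "gauss_diagram \<mu> G \<Longrightarrow> 1 \<le> i \<Longrightarrow> i \<le> \<mu> \<Longrightarrow> x \<in> set (circle G i) \<Longrightarrow> x \<in> endpoints G"
  using circle_in [of \<mu> G i] by (auto simp: endpoints_def)

lemma circle_unique:
  assumes "gauss_diagram \<mu> G" "1 \<le> i" "i \<le> \<mu>" "1 \<le> j" "j \<le> \<mu>"
    and "x \<in> set (circle G i)" "x \<in> set (circle G j)"
  shows "i = j"
  using gauss_circle_unique [of \<mu> G "i - 1" "j - 1" x] assms by (simp add: circle_def) linarith

lemma consecutive_circle:
  assumes G: "gauss_diagram \<mu> G" "1 \<le> i" "i \<le> \<mu>" and c: "consecutive G ps"
  shows "set ps \<inter> set (circle G i) = {} \<or> (\<exists>u. rotation (circle G i) (ps @ u))"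
proof -
  from c obtain w u where w: "w \<in> set G" "rotation w (ps @ u)"
    by (auto simp: consecutive_iff_rotation)
  then obtain j where j: "j < \<mu>" "w = G ! j"
    using G by (auto simp: gauss_diagram_def in_set_conv_nth)
  have ps: "set ps \<subseteq> set w"
    using rotation_set [OF w(2)] by auto
  show ?thesis
  proof (cases "j = i - 1")
    case True
    then show ?thesis using w j by (auto simp: circle_def)
  next
    case False
    then show ?thesis
      using gauss_circle_unique [OF G(1), of "i - 1" j] j ps G by (fastforce simp: circle_def)
  qed
qed

lemma consecutive_distinct:
  assumes "gauss_diagram \<mu> G" "consecutive G ps"
  shows "distinct ps" "set ps \<subseteq> endpoints G"
proof -
  from assms obtain w u where w: "w \<in> set G" "rotation w (ps @ u)"
    by (auto simp: consecutive_iff_rotation)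
  then show "distinct ps"
    using gauss_circle_distinct [OF assms(1) w(1)] rotation_distinct by fastforce
  show "set ps \<subseteq> endpoints G"
    using w rotation_set [OF w(2)] by (auto simp: endpoints_def)
qed

lemma circle_delete:
  "gauss_diagram \<mu> G \<Longrightarrow> 1 \<le> i \<Longrightarrow> i \<le> \<mu> \<Longrightarrow>
    circle (delete A G) i = filter (\<lambda>p. chord_of p \<notin> A) (circle G i)"
  by (auto simp: circle_def delete_def gauss_diagram_def)

lemma circle_exchange:
  "gauss_diagram \<mu> G \<Longrightarrow> 1 \<le> i \<Longrightarrow> i \<le> \<mu> \<Longrightarrow>
    circle (exchange p q G) i = map (id(p := q, q := p)) (circle G i)"
  by (auto simp: circle_def exchange_def gauss_diagram_def)

lemma consecutive_exchange:
  assumes "consecutive G ps" "p \<notin> set ps" "q \<notin> set ps"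
  shows "consecutive (exchange p q G) ps"
proof -
  from assms obtain w u where w: "w \<in> set G" "rotation w (ps @ u)"
    by (auto simp: consecutive_iff_rotation)
  have "map (id(p := q, q := p)) ps = ps"
    using assms by (intro map_idI) auto
  then have "rotation (map (id(p := q, q := p)) w) (ps @ map (id(p := q, q := p)) u)"
    using rotation_map [OF w(2), of "id(p := q, q := p)"] by simp
  then show ?thesis
    using w(1) unfolding consecutive_iff_rotation exchange_def by auto
qed

lemma consecutive_delete:
  assumes "consecutive G ps" "\<And>p. p \<in> set ps \<Longrightarrow> chord_of p \<notin> A"
  shows "consecutive (delete A G) ps"
proof -
  from assms obtain w u where w: "w \<in> set G" "rotation w (ps @ u)"
    by (auto simp: consecutive_iff_rotation)
  have "filter (\<lambda>p. chord_of p \<notin> A) ps = ps"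
    using assms by (simp add: filter_id_conv)
  then have "rotation (filter (\<lambda>p. chord_of p \<notin> A) w) (ps @ filter (\<lambda>p. chord_of p \<notin> A) u)"
    using rotation_filter [OF w(2), of "\<lambda>p. chord_of p \<notin> A"] by simp
  then show ?thesis
    using w(1) unfolding consecutive_iff_rotation delete_def by auto
qed

lemma endpoints_delete: "endpoints (delete A G) = {p \<in> endpoints G. chord_of p \<notin> A}"
  by (auto simp: endpoints_def delete_def)

lemma concat_delete: "concat (delete A G) = filter (\<lambda>p. chord_of p \<notin> A) (concat G)"
  by (simp add: delete_def filter_concat comp_def)

lemma gauss_diagram_delete: "gauss_diagram \<mu> G \<Longrightarrow> gauss_diagram \<mu> (delete A G)"
  unfolding gauss_diagram_def chords_def endpoints_delete concat_delete
  by (auto simp: delete_def)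

lemma delete_delete: "delete A (delete B G) = delete (A \<union> B) G"
  by (auto simp: delete_def intro: filter_cong)

text \<open>
  The rearrangements below permute the endpoints, so this is what makes them well-formed.
\<close>

lemma gauss_diagram_mset:
  assumes "length G = length H" "mset (concat G) = mset (concat H)"
  shows "gauss_diagram \<mu> G = gauss_diagram \<mu> H"
  using assms(1) mset_eq_imp_distinct_iff [OF assms(2)] mset_eq_setD [OF assms(2)]
  by (simp add: gauss_diagram_def chords_def endpoints_def)

lemma mset_exchange:
  assumes d: "distinct w" and "p \<in> set w \<longleftrightarrow> q \<in> set w"
  shows "mset (map (id(p := q, q := p)) w) = mset w"
proof -
  let ?f = "id(p := q, q := p)"
  have "inj_on ?f (set w)" by (auto simp: inj_on_def)
  then have "distinct (map ?f w)" using d by (simp add: distinct_map)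
  moreover have "set (map ?f w) = set w"
    using assms(2) by (auto simp: image_iff) (metis+)?
  ultimately show ?thesis
    using d set_eq_iff_mset_eq_distinct by blast
qed

lemma gauss_diagram_exchange:
  assumes G: "gauss_diagram \<mu> G" and pq: "consecutive G [p, q]"
  shows "gauss_diagram \<mu> (exchange p q G)"
proof -
  have "concat (exchange p q G) = map (id(p := q, q := p)) (concat G)"
    by (simp add: exchange_def map_concat)
  moreover have "p \<in> set (concat G)" "q \<in> set (concat G)"
    using consecutive_distinct(2) [OF G pq] by (auto simp: endpoints_def)
  moreover have "distinct (concat G)"
    using G by (simp add: gauss_diagram_def)
  ultimately have "mset (concat (exchange p q G)) = mset (concat G)"
    by (metis mset_exchange)
  then show ?thesis
    using G gauss_diagram_mset [of "exchange p q G" G \<mu>] by (simp add: exchange_def)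
qed

lemma set_circle_exchange:
  assumes "gauss_diagram \<mu> G" "1 \<le> i" "i \<le> \<mu>" "consecutive G [p, q]"
  shows "set (circle (exchange p q G) i) = set (circle G i)"
proof -
  have "p \<in> set (circle G i) \<longleftrightarrow> q \<in> set (circle G i)"
    using consecutive_circle [OF assms] rotation_set by fastforce
  then show ?thesis
    using mset_exchange circle_exchange [OF assms(1-3)] circle_distinct [OF assms(1-3)]
    by (metis mset_eq_setD)
qed

section \<open>Indices under exchanges and shells\<close>

text \<open>
  The offset \<open>\<phi>\<close> keeps account of index contributions of shells that have been deleted, so
  that diagrams with different sets of shells can be compared chord by chord.
\<close>

definition offset_writhe :: "(chord \<Rightarrow> int) \<Rightarrow> diagram \<Rightarrow> nat \<Rightarrow> int \<Rightarrow> int" where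
  "offset_writhe \<phi> G i n = (\<Sum>c | c \<in> self_chords G i \<and> self_index G i c + \<phi> c = n. chord_sign c)"

lemma self_writhe_offset: "self_writhe G i n = offset_writhe (\<lambda>_. 0) G i n"
  by (simp add: self_writhe_def offset_writhe_def)

lemma finite_self_chords [simp]: "finite (self_chords G i)"
  by (rule finite_subset [of _ "chord_of ` set (circle G i)"]) (force simp: self_chords_def)+

lemma finite_nonself_chords [simp]: "finite (nonself_chords G i j)"
  by (rule finite_subset [of _ "chord_of ` set (circle G i)"]) (force simp: nonself_chords_def)+

lemma offset_writhe_cong:
  assumes "self_chords G i = self_chords H i"
    and "\<And>c. c \<in> self_chords H i \<Longrightarrow> self_index G i c + \<phi> c = self_index H i c + \<psi> c"
  shows "offset_writhe \<phi> G i n = offset_writhe \<psi> H i n"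
  unfolding offset_writhe_def using assms by (intro sum.cong) auto

lemma chord_of_mem: "p = Ini (chord_of p) \<or> p = Ter (chord_of p)"
  by (cases p) auto

lemma self_chords_exchange:
  assumes "gauss_diagram \<mu> G" "1 \<le> i" "i \<le> \<mu>" "consecutive G [p, q]"
  shows "self_chords (exchange p q G) i = self_chords G i"
  using set_circle_exchange [OF assms] by (simp add: self_chords_def)

text \<open>
  An arc that starts or ends at \<open>p\<close> gains or loses \<open>q\<close>, and conversely. Since the sign of an endpoint
  is the sign of its chord, negated for initial endpoints, the four cases combine into one formula.
\<close>

lemma self_index_exchange:
  assumes G: "gauss_diagram \<mu> G" "1 \<le> i" "i \<le> \<mu>" and pq: "consecutive G [p, q]"
    and ne: "chord_of p \<noteq> chord_of q" and c: "c \<in> self_chords G i"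
  shows "self_index (exchange p q G) i c = self_index G i c +
    chord_sign c * (of_bool (c = chord_of p) - of_bool (c = chord_of q))
      * endpoint_sign p * endpoint_sign q"
proof -
  have "{Ini c, Ter c} \<noteq> {p, q}"
    using ne by (auto simp: doubleton_eq_iff)
  moreover obtain u where "{p, q} \<inter> set (circle G i) = {} \<or> rotation (circle G i) (p # q # u)"
    using consecutive_circle [OF G pq] by auto
  moreover have "Ini c \<in> set (circle G i)" "Ter c \<in> set (circle G i)"
    using c by (simp_all add: self_chords_def)
  ultimately have "self_index (exchange p q G) i c = self_index G i c
    + (if Ini c = q then endpoint_sign p else 0) - (if Ini c = p then endpoint_sign q else 0)
    + (if Ter c = p then endpoint_sign q else 0) - (if Ter c = q then endpoint_sign p else 0)"
    unfolding self_index_def circle_exchange [OF G]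
    by (intro arc_sum_exchange [OF circle_distinct [OF G]]) auto
  then show ?thesis
    using ne chord_sign_cases [of c] by (cases p; cases q) auto
qed

text \<open>
  Whether a shell begins with its initial or its terminal endpoint is dictated by the sign of the
  endpoint that it surrounds; naming its first and its last endpoint makes further case
  distinctions on this sign unnecessary.
\<close>

definition shell_opening :: "chord endpoint \<Rightarrow> chord \<Rightarrow> chord endpoint" where
  "shell_opening p s = (if endpoint_sign p = 1 then Ini s else Ter s)"

definition shell_closing :: "chord endpoint \<Rightarrow> chord \<Rightarrow> chord endpoint" where
  "shell_closing p s = (if endpoint_sign p = 1 then Ter s else Ini s)"

lemma shell_iff:
  "shell G s p \<longleftrightarrow> s \<noteq> chord_of p \<and> consecutive G [shell_opening p s, p, shell_closing p s]"
  by (simp add: shell_def shell_opening_def shell_closing_def)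

lemma chord_of_shell [simp]:
  "chord_of (shell_opening p s) = s" "chord_of (shell_closing p s) = s"
  by (simp_all add: shell_opening_def shell_closing_def)

lemma shell_sign:
  "endpoint_sign (shell_opening p s) = - endpoint_sign p * chord_sign s"
  "endpoint_sign (shell_closing p s) = endpoint_sign p * chord_sign s"
  using endpoint_sign_cases [of p] by (auto simp: shell_opening_def shell_closing_def)

lemma chord_of_iff_shell: "chord_of v = s \<longleftrightarrow> v = shell_opening p s \<or> v = shell_closing p s"
  by (cases v) (auto simp: shell_opening_def shell_closing_def)

lemma set_shell: "{Ini s, Ter s, p} = set [shell_opening p s, p, shell_closing p s]"
  by (auto simp: shell_opening_def shell_closing_def)

lemma shell_circle:
  assumes G: "gauss_diagram \<mu> G" "1 \<le> i" "i \<le> \<mu>" and s: "shell G s p"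
  shows "{Ini s, Ter s, p} \<inter> set (circle G i) = {} \<or>
    (\<exists>u. rotation (circle G i) (shell_opening p s # p # shell_closing p s # u))"
  using consecutive_circle [OF G, of "[shell_opening p s, p, shell_closing p s]"] s
  unfolding shell_iff set_shell by simp

lemma shell_on_circle:
  assumes "gauss_diagram \<mu> G" "1 \<le> i" "i \<le> \<mu>" "shell G s p"
  shows "Ini s \<in> set (circle G i) \<longleftrightarrow> p \<in> set (circle G i)"
    and "Ter s \<in> set (circle G i) \<longleftrightarrow> p \<in> set (circle G i)"
proof -
  have "{Ini s, Ter s, p} \<inter> set (circle G i) = {} \<or> {Ini s, Ter s, p} \<subseteq> set (circle G i)"
    using shell_circle [OF assms]
  proof
    assume "\<exists>u. rotation (circle G i) (shell_opening p s # p # shell_closing p s # u)"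
    then obtain u where "rotation (circle G i) (shell_opening p s # p # shell_closing p s # u)" ..
    from rotation_set [OF this] have "{Ini s, Ter s, p} \<subseteq> set (circle G i)"
      unfolding set_shell by auto
    then show ?thesis ..
  qed blast
  then show "Ini s \<in> set (circle G i) \<longleftrightarrow> p \<in> set (circle G i)"
    and "Ter s \<in> set (circle G i) \<longleftrightarrow> p \<in> set (circle G i)"
    by auto
qed

lemma self_chords_delete:
  assumes "gauss_diagram \<mu> G" "1 \<le> i" "i \<le> \<mu>"
  shows "self_chords (delete A G) i = self_chords G i - A"
  by (auto simp: self_chords_def circle_delete [OF assms])

lemma nonself_chords_delete:
  assumes "gauss_diagram \<mu> G" "1 \<le> i" "i \<le> \<mu>" "1 \<le> j" "j \<le> \<mu>"
  shows "nonself_chords (delete A G) i j = nonself_chords G i j - A"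
  using assms by (auto simp: nonself_chords_def circle_delete)

text \<open>
  The arcs of the chord of \<open>p\<close> contain exactly one endpoint of the shell, all other arcs contain both
  or none. By the choice of the orientation of a shell its contribution is the same at both
  endpoints of the chord, which is what makes S1 an index preserving move.
\<close>

lemma self_index_delete_shell:
  assumes G: "gauss_diagram \<mu> G" "1 \<le> i" "i \<le> \<mu>" and s: "shell G s p"
    and c: "c \<in> self_chords G i" "c \<noteq> s"
  shows "self_index G i c =
    self_index (delete {s} G) i c - of_bool (c = chord_of p) * chord_sign s * chord_sign c"
  using shell_circle [OF G s]
proof
  assume d: "{Ini s, Ter s, p} \<inter> set (circle G i) = {}"
  then have "filter (\<lambda>v. chord_of v \<notin> {s}) (circle G i) = circle G i"
    by (auto simp: filter_id_conv) (metis chord_of_mem)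
  moreover have "c \<noteq> chord_of p"
    using c d chord_of_mem [of p] by (auto simp: self_chords_def)
  ultimately show ?thesis
    by (simp add: self_index_def circle_delete [OF G])
next
  assume "\<exists>u. rotation (circle G i) (shell_opening p s # p # shell_closing p s # u)"
  then obtain u where u: "rotation (circle G i) (shell_opening p s # p # shell_closing p s # u)" ..
  have "self_index G i c = self_index (delete {s} G) i c
    + (if Ini c = p then endpoint_sign (shell_closing p s) else 0)
    + (if Ter c = p then endpoint_sign (shell_opening p s) else 0)"
    unfolding self_index_def circle_delete [OF G]
    using c u circle_distinct [OF G]
    by (intro arc_sum_delete_shell) (auto simp: self_chords_def shell_sign chord_of_iff_shell [of _ _ p])
  then show ?thesis
    using chord_sign_cases [of c] by (cases p) (auto simp: shell_sign)
qed

text \<open>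
  Around a positive endpoint the arc of the shell consists of this endpoint. Around a negative one
  it is the complementary arc, which misses \<open>p\<close> and both endpoints of the shell: they sum to \<open>- 1\<close>.
\<close>

lemma self_index_shell:
  assumes G: "gauss_diagram \<mu> G" "1 \<le> i" "i \<le> \<mu>" and s: "shell G s p"
    and i: "p \<in> set (circle G i)"
  shows "self_index G i s \<in> {1, sign_sum (circle G i) + 1}"
proof -
  obtain u where u: "rotation (circle G i) (shell_opening p s # p # shell_closing p s # u)"
    using shell_circle [OF G s] i by auto
  have d: "distinct (shell_opening p s # p # shell_closing p s # u)"
    using u circle_distinct [OF G] rotation_distinct by blast
  have "self_index G i s = arc_sum (shell_opening p s # p # shell_closing p s # u) (Ini s) (Ter s)"
    unfolding self_index_def
    by (rule arc_sum_rotation [symmetric, OF u circle_distinct [OF G]])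
      (use i shell_on_circle [OF G s] in auto)
  also have "\<dots> \<in> {1, sign_sum (shell_opening p s # p # shell_closing p s # u) + 1}"
  proof (cases "endpoint_sign p = 1")
    case True
    then show ?thesis
      using open_arc_unwrapped [of "[]" "Ini s" "[p]" "Ter s" u] d
      by (simp add: arc_sum_def shell_opening_def shell_closing_def)
  next
    case False
    then show ?thesis
      using open_arc_wrapped [of "[]" "Ter s" "[p]" "Ini s" u] d endpoint_sign_cases [of p]
      by (auto simp: arc_sum_def shell_opening_def shell_closing_def sign_sum_def)
  qed
  also have "sign_sum (shell_opening p s # p # shell_closing p s # u) = sign_sum (circle G i)"
    using u by (rule rotation_sign_sum)
  finally show ?thesis .
qed

lemma offset_writhe_delete_shell:
  assumes G: "gauss_diagram \<mu> G" "1 \<le> i" "i \<le> \<mu>" and s: "shell G s p"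
    and \<phi>: "\<phi> s = 0" and n: "n \<notin> {1, sign_sum (circle G i) + 1}"
  shows "offset_writhe \<phi> G i n =
    offset_writhe (\<lambda>c. \<phi> c - of_bool (c = chord_of p) * chord_sign s * chord_sign c) (delete {s} G) i n"
proof -
  have "s \<in> self_chords G i \<Longrightarrow> p \<in> set (circle G i)"
    using shell_on_circle [OF G s] by (simp add: self_chords_def)
  then have "\<not> (s \<in> self_chords G i \<and> self_index G i s + \<phi> s = n)"
    using self_index_shell [OF G s] n \<phi> by auto
  then have "(c \<in> self_chords G i \<and> self_index G i c + \<phi> c = n) \<longleftrightarrow>
    (c \<in> self_chords G i - {s} \<and> self_index (delete {s} G) i c
      + (\<phi> c - of_bool (c = chord_of p) * chord_sign s * chord_sign c) = n)" for c
    using self_index_delete_shell [OF G s, of c] by (cases "c = s") auto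
  then show ?thesis
    unfolding offset_writhe_def self_chords_delete [OF G] by presburger
qed

lemma linking_delete_shell:
  assumes G: "gauss_diagram \<mu> G" "1 \<le> i" "i \<le> \<mu>" "1 \<le> j" "j \<le> \<mu>" and s: "shell G s p"
  shows "linking (delete {s} G) i j = linking G i j"
proof -
  have "s \<notin> nonself_chords G i j"
    using shell_on_circle [OF G(1-3) s] shell_on_circle [OF G(1,4,5) s] circle_unique [OF G]
    by (auto simp: nonself_chords_def)
  then show ?thesis
    by (simp add: linking_def nonself_chords_delete [OF G])
qed

lemma linking_exchange:
  assumes G: "gauss_diagram \<mu> G" "1 \<le> i" "i \<le> \<mu>" "1 \<le> j" "j \<le> \<mu>" and "consecutive G [p, q]"
  shows "linking (exchange p q G) i j = linking G i j"
  using set_circle_exchange [of \<mu> G i p q] set_circle_exchange [of \<mu> G j p q] assms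
  by (simp add: linking_def nonself_chords_def)

text \<open>
  The two endpoints of a self-chord cancel, so the total sign on a circle counts the nonself-chords
  that end there minus those that begin there.
\<close>

lemma sign_sum_circle:
  assumes G: "gauss_diagram 2 G" and ij: "(i, j) = (1, 2) \<or> (i, j) = (2, 1)"
  shows "sign_sum (circle G i) = linking G j i - linking G i j"
proof -
  let ?w = "set (circle G i)"
  let ?I = "{c. Ini c \<in> ?w}" and ?T = "{c. Ter c \<in> ?w}"
  have ij': "1 \<le> i" "i \<le> 2" "1 \<le> j" "j \<le> 2" "i \<noteq> j" using ij by auto
  have fin: "finite ?I" "finite ?T"
    by (rule finite_subset [of _ "chord_of ` ?w"]; force)+
  have other: "x \<in> set (circle G i) \<or> x \<in> set (circle G j)" if x: "x \<in> endpoints G" for x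
  proof -
    obtain k where "1 \<le> k" "k \<le> 2" "x \<in> set (circle G k)"
      using endpoints_circle [OF G x] by metis
    moreover from this(1,2) have "k = i \<or> k = j" using ij by auto
    ultimately show ?thesis by blast
  qed
  have both: "Ini c \<in> endpoints G" "Ter c \<in> endpoints G" if "p \<in> endpoints G" "chord_of p = c" for p c
    using G that by (auto simp: gauss_diagram_def chords_def)
  have excl: "x \<notin> set (circle G j)" if "x \<in> set (circle G i)" for x
    using circle_unique [OF G ij'(1-4) that] ij' by blast
  have "Ter c \<in> set (circle G i) \<or> Ter c \<in> set (circle G j)" if "Ini c \<in> ?w" for c
    using other both(2) circle_endpoints [OF G ij'(1,2) that] by simp
  then have I: "?I = self_chords G i \<union> nonself_chords G i j" "self_chords G i \<inter> nonself_chords G i j = {}"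
    using excl ij' unfolding self_chords_def nonself_chords_def by blast+
  have "Ini c \<in> set (circle G i) \<or> Ini c \<in> set (circle G j)" if "Ter c \<in> ?w" for c
    using other both(1) circle_endpoints [OF G ij'(1,2) that] by simp
  then have T: "?T = self_chords G i \<union> nonself_chords G j i" "self_chords G i \<inter> nonself_chords G j i = {}"
    using excl ij' unfolding self_chords_def nonself_chords_def by blast+
  have w: "?w = Ini ` ?I \<union> Ter ` ?T" "Ini ` ?I \<inter> Ter ` ?T = {}"
  proof -
    have "x \<in> Ini ` ?I \<union> Ter ` ?T" if "x \<in> ?w" for x
    proof (cases x)
      case (Ini c)
      with that have "Ini c \<in> ?w" by simp
      with Ini show ?thesis by blast
    next
      case (Ter c)
      with that have "Ter c \<in> ?w" by simp
      with Ter show ?thesis by blast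
    qed
    then show "?w = Ini ` ?I \<union> Ter ` ?T" by blast
  qed auto
  have "sign_sum (circle G i) = (\<Sum>x \<in> ?w. endpoint_sign x)"
    using circle_distinct [OF G ij'(1,2)] by (simp add: sign_sum_def sum_list_distinct_conv_sum_set)
  also have "\<dots> = (\<Sum>x \<in> Ini ` ?I. endpoint_sign x) + (\<Sum>x \<in> Ter ` ?T. endpoint_sign x)"
    using fin w(2) by (subst w(1), subst sum.union_disjoint) auto
  also have "(\<Sum>x \<in> Ini ` ?I. endpoint_sign x) = - (\<Sum>c \<in> ?I. chord_sign c)"
    by (subst sum.reindex) (auto simp: inj_on_def sum_negf)
  also have "(\<Sum>x \<in> Ter ` ?T. endpoint_sign x) = (\<Sum>c \<in> ?T. chord_sign c)"
    by (subst sum.reindex) (auto simp: inj_on_def)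
  also have "(\<Sum>c \<in> ?I. chord_sign c) = (\<Sum>c \<in> self_chords G i. chord_sign c) + linking G i j"
    unfolding I(1) linking_def by (rule sum.union_disjoint) (use I(2) in auto)
  also have "(\<Sum>c \<in> ?T. chord_sign c) = (\<Sum>c \<in> self_chords G i. chord_sign c) + linking G j i"
    unfolding T(1) linking_def by (rule sum.union_disjoint) (use T(2) in auto)
  finally show ?thesis by simp
qed

section \<open>Invariance under the moves\<close>

text \<open>
  Adjacency in a cyclic word, made true for points that are not on the circle at all. With this
  convention the statements about R1 and R2 hold on every circle, whether or not the chords meet it.
\<close>

definition neighbours :: "chord endpoint list \<Rightarrow> chord endpoint \<Rightarrow> chord endpoint \<Rightarrow> bool" where
  "neighbours w p q \<longleftrightarrow> {p, q} \<inter> set w = {} \<or>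
    (\<exists>u. rotation w (p # q # u) \<or> rotation w (q # p # u))"

lemma neighbours_cases:
  assumes "neighbours w p q"
  obtains "p \<notin> set w" "q \<notin> set w"
  | x y u where "{x, y} = {p, q}" "rotation w (x # y # u)"
proof -
  from assms consider "{p, q} \<inter> set w = {}" | u where "rotation w (p # q # u)"
    | u where "rotation w (q # p # u)"
    unfolding neighbours_def by blast
  then show thesis
  proof cases
    case 1
    then show ?thesis using that(1) by blast
  next
    case (2 u)
    then show ?thesis using that(2) by blast
  next
    case (3 u)
    then show ?thesis using that(2) [of q p u] by blast
  qed
qed

lemma neighbours_mem: "neighbours w p q \<Longrightarrow> p \<in> set w \<longleftrightarrow> q \<in> set w"
proof (erule neighbours_cases)
  fix x y u assume "{x, y} = {p, q}" "rotation w (x # y # u)"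
  then have "{p, q} \<subseteq> set w" using rotation_set [of w "x # y # u"] by auto
  then show "p \<in> set w \<longleftrightarrow> q \<in> set w" by blast
qed simp

lemma adjacent_neighbours:
  assumes "gauss_diagram \<mu> G" "1 \<le> i" "i \<le> \<mu>" "adjacent G p q"
  shows "neighbours (circle G i) p q"
proof -
  consider "consecutive G [p, q]" | "consecutive G [q, p]"
    using assms(4) by (auto simp: adjacent_def)
  then show ?thesis
  proof cases
    case 1
    from consecutive_circle [OF assms(1-3) this] show ?thesis
      unfolding neighbours_def by auto
  next
    case 2
    from consecutive_circle [OF assms(1-3) this] show ?thesis
      unfolding neighbours_def by auto
  qed
qed

lemma neighbours_filter:
  assumes "neighbours w p q" "P p" "P q"
  shows "neighbours (filter P w) p q"
  using assms(1)
proof (cases rule: neighbours_cases)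
  case 1
  then show ?thesis by (simp add: neighbours_def)
next
  case (2 x y u)
  have "P x" "P y" using 2(1) assms(2,3) by (auto simp: doubleton_eq_iff)
  then have "rotation (filter P w) (x # y # filter P u)"
    using rotation_filter [OF 2(2), of P] by simp
  then show ?thesis
    using 2(1) unfolding neighbours_def doubleton_eq_iff by blast
qed

lemma arc_sum_delete_neighbours:
  assumes w: "distinct w" and n: "neighbours w p q" and pq: "endpoint_sign p + endpoint_sign q = 0"
    and v: "v \<in> set w" "v' \<in> set w" "v \<noteq> v'" "v \<notin> {p, q}" "v' \<notin> {p, q}"
  shows "arc_sum (filter (\<lambda>x. x \<notin> {p, q}) w) v v' = arc_sum w v v'"
  using n
proof (cases rule: neighbours_cases)
  case 1
  then have "filter (\<lambda>x. x \<notin> {p, q}) w = w"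
    by (auto simp: filter_id_conv)
  then show ?thesis by simp
next
  case (2 x y u)
  have "endpoint_sign x + endpoint_sign y = 0"
    using pq 2(1) by (auto simp: doubleton_eq_iff)
  then show ?thesis
    using v unfolding 2(1) [symmetric]
    by (intro arc_sum_delete_pair [OF w _ _ _ _ _ 2(2)]) auto
qed

lemma arc_sum_successor:
  assumes w: "distinct w" and r: "rotation w (x # y # u)" and v: "v \<in> set w" "v \<noteq> x" "v \<noteq> y"
  shows "arc_sum w x v = endpoint_sign y + arc_sum w y v"
    and "arc_sum w v y = arc_sum w v x + endpoint_sign x"
proof -
  have d: "distinct (x # y # u)" and s: "set (x # y # u) = set w"
    using r w rotation_distinct rotation_set by blast+
  have vu: "v \<in> set u" using s v by auto
  have *: "arc_sum w a b = arc_sum (x # y # u) a b"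
    if "a \<in> set (x # y # u)" "b \<in> set (x # y # u)" "a \<noteq> b" for a b
    using arc_sum_rotation [OF r w, of a b] that unfolding s by simp
  have n: "x \<noteq> y" "y \<noteq> x" "v \<noteq> x" "x \<noteq> v" "v \<noteq> y" "y \<noteq> v" "x \<notin> set u" "y \<notin> set u"
    using d v by auto
  have "arc_sum (x # y # u) x v = endpoint_sign y + arc_sum (x # y # u) y v"
    using n by (subst (1 2) arc_sum_height [OF d]) (simp_all (no_asm_simp) add: vu)
  then show "arc_sum w x v = endpoint_sign y + arc_sum w y v"
    by (simp only: * n vu list.set insert_iff simp_thms)
  have "arc_sum (x # y # u) v y = arc_sum (x # y # u) v x + endpoint_sign x"
    using n by (subst (1 2) arc_sum_height [OF d]) (simp_all (no_asm_simp) add: vu)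
  then show "arc_sum w v y = arc_sum w v x + endpoint_sign x"
    by (simp only: * n vu list.set insert_iff simp_thms)
qed

text \<open>
  Neighbours of opposite sign see the same difference of arcs whichever of them comes first; this
  lets R2 be treated without distinguishing the four relative orders.
\<close>

lemma arc_sum_neighbours:
  assumes w: "distinct w" and n: "neighbours w p q" and pq: "endpoint_sign p + endpoint_sign q = 0"
    and v: "v \<in> set w" "v \<notin> {p, q}" and p: "p \<in> set w"
  shows "arc_sum w p v = arc_sum w q v + endpoint_sign q"
    and "arc_sum w v q = arc_sum w v p + endpoint_sign p"
proof -
  from n obtain x y u where xy: "{x, y} = {p, q}" and r: "rotation w (x # y # u)"
    using p by (cases rule: neighbours_cases) auto
  consider "x = p" "y = q" | "x = q" "y = p" using xy by (auto simp: doubleton_eq_iff)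
  note c = this
  note a = arc_sum_successor [OF w r v(1)]
  show "arc_sum w p v = arc_sum w q v + endpoint_sign q"
    using c by cases (use a pq v in auto)
  show "arc_sum w v q = arc_sum w v p + endpoint_sign p"
    using c by cases (use a pq v in auto)
qed

lemma self_writhe_delete:
  assumes G: "gauss_diagram \<mu> G" "1 \<le> i" "i \<le> \<mu>"
    and idx: "\<And>e. e \<in> self_chords G i \<Longrightarrow> e \<notin> A \<Longrightarrow> self_index (delete A G) i e = self_index G i e"
    and A: "(\<Sum>e | e \<in> self_chords G i \<inter> A \<and> self_index G i e = n. chord_sign e) = 0"
  shows "self_writhe (delete A G) i n = self_writhe G i n"
proof -
  have "{e. e \<in> self_chords G i \<and> self_index G i e = n} =
    {e. e \<in> self_chords (delete A G) i \<and> self_index (delete A G) i e = n} \<union>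
    {e. e \<in> self_chords G i \<inter> A \<and> self_index G i e = n}"
    using idx unfolding self_chords_delete [OF G] by auto
  then show ?thesis
    unfolding self_writhe_def
    using A by (simp only:, subst sum.union_disjoint)
      (auto simp: self_chords_delete [OF G])
qed

text \<open>
  The arc of a kink is empty, or it is the whole circle except for the kink.
\<close>

lemma self_index_R1:
  assumes G: "gauss_diagram \<mu> G" "1 \<le> i" "i \<le> \<mu>" and c: "adjacent G (Ini c) (Ter c)"
    and s: "c \<in> self_chords G i"
  shows "self_index G i c \<in> {0, sign_sum (circle G i)}"
proof -
  note d = circle_distinct [OF G]
  have m: "Ini c \<in> set (circle G i)" "Ter c \<in> set (circle G i)"
    using s by (simp_all add: self_chords_def)
  from adjacent_neighbours [OF G c] m obtain u
    where "rotation (circle G i) (Ini c # Ter c # u) \<or> rotation (circle G i) (Ter c # Ini c # u)"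
    by (auto simp: neighbours_def)
  then show ?thesis
  proof
    assume r: "rotation (circle G i) (Ini c # Ter c # u)"
    then have "arc_sum (Ini c # Ter c # u) (Ini c) (Ter c) = self_index G i c"
      unfolding self_index_def by (rule arc_sum_rotation [OF _ d m]) simp
    then show ?thesis
      using open_arc_unwrapped [of "[]" "Ini c" "[]" "Ter c" u] rotation_distinct [OF r] d
      by (simp add: arc_sum_def)
  next
    assume r: "rotation (circle G i) (Ter c # Ini c # u)"
    then have "arc_sum (Ter c # Ini c # u) (Ini c) (Ter c) = self_index G i c"
      unfolding self_index_def by (rule arc_sum_rotation [OF _ d m]) simp
    moreover have "sign_sum (circle G i) = sign_sum u"
      using rotation_sign_sum [OF r] by simp
    ultimately show ?thesis
      using open_arc_wrapped [of "[]" "Ter c" "[]" "Ini c" u] rotation_distinct [OF r] d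
      by (simp add: arc_sum_def sign_sum_def)
  qed
qed

lemma self_writhe_R1:
  assumes G: "gauss_diagram \<mu> G" "1 \<le> i" "i \<le> \<mu>" and c: "adjacent G (Ini c) (Ter c)"
    and n: "n \<notin> {0, sign_sum (circle G i)}"
  shows "self_writhe (delete {c} G) i n = self_writhe G i n"
proof (rule self_writhe_delete [OF G])
  fix e assume e: "e \<in> self_chords G i" "e \<notin> {c}"
  have "(\<lambda>v. chord_of v \<notin> {c}) = (\<lambda>v. v \<notin> {Ini c, Ter c})"
    by (rule ext) (metis chord_of_mem empty_iff endpoint.sel insert_iff)
  then show "self_index (delete {c} G) i e = self_index G i e"
    unfolding self_index_def circle_delete [OF G]
    using arc_sum_delete_neighbours [OF circle_distinct [OF G] adjacent_neighbours [OF G c], of "Ini e" "Ter e"] e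
    by (simp add: self_chords_def)
next
  have "{e. e \<in> self_chords G i \<inter> {c} \<and> self_index G i e = n} = {}"
    using self_index_R1 [OF G c] n by auto
  then show "(\<Sum>e | e \<in> self_chords G i \<inter> {c} \<and> self_index G i e = n. chord_sign e) = 0"
    by (simp only: sum.empty)
qed

lemma linking_R1:
  assumes G: "gauss_diagram \<mu> G" "1 \<le> i" "i \<le> \<mu>" "1 \<le> j" "j \<le> \<mu>" and c: "adjacent G (Ini c) (Ter c)"
  shows "linking (delete {c} G) i j = linking G i j"
proof -
  have "c \<notin> nonself_chords G i j"
    using neighbours_mem [OF adjacent_neighbours [OF G(1-3) c]] circle_unique [OF G]
    by (auto simp: nonself_chords_def)
  then show ?thesis
    by (simp add: linking_def nonself_chords_delete [OF G])
qed

lemma self_writhe_R2: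
  assumes G: "gauss_diagram \<mu> G" "1 \<le> i" "i \<le> \<mu>" and cd: "chord_sign d = - chord_sign c"
    and adj: "adjacent G (Ini c) (Ini d)" "adjacent G (Ter c) (Ter d)"
  shows "self_writhe (delete {c, d} G) i n = self_writhe G i n"
proof (rule self_writhe_delete [OF G])
  let ?w = "circle G i"
  note w = circle_distinct [OF G]
  note nI = adjacent_neighbours [OF G adj(1)] and nT = adjacent_neighbours [OF G adj(2)]
  have ne: "c \<noteq> d" using cd chord_sign_cases [of c] by auto
  show "self_index (delete {c, d} G) i e = self_index G i e" if e: "e \<in> self_chords G i" "e \<notin> {c, d}" for e
  proof -
    let ?P = "\<lambda>v. v \<notin> {Ini c, Ini d}" and ?Q = "\<lambda>v. v \<notin> {Ter c, Ter d}"
    have "(\<lambda>v. chord_of v \<notin> {c, d}) = (\<lambda>v. ?P v \<and> ?Q v)"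
      by (rule ext) (metis chord_of_mem empty_iff endpoint.sel insert_iff)
    then have f: "filter (\<lambda>v. chord_of v \<notin> {c, d}) ?w = filter ?Q (filter ?P ?w)"
      by simp
    have "arc_sum (filter ?Q (filter ?P ?w)) (Ini e) (Ter e) = arc_sum (filter ?P ?w) (Ini e) (Ter e)"
      by (rule arc_sum_delete_neighbours)
        (use w e nT cd in \<open>auto simp: self_chords_def intro: neighbours_filter\<close>)
    also have "\<dots> = arc_sum ?w (Ini e) (Ter e)"
      by (rule arc_sum_delete_neighbours) (use w e nI cd in \<open>auto simp: self_chords_def\<close>)
    finally show ?thesis
      unfolding self_index_def circle_delete [OF G] f .
  qed
  have mem: "c \<in> self_chords G i \<longleftrightarrow> d \<in> self_chords G i"
    using neighbours_mem [OF nI] neighbours_mem [OF nT] by (simp add: self_chords_def)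
  have idx: "self_index G i c = self_index G i d" if s: "c \<in> self_chords G i"
  proof -
    have "arc_sum ?w (Ini c) (Ter c) = arc_sum ?w (Ini d) (Ter c) + chord_sign c"
      using arc_sum_neighbours(1) [OF w nI, of "Ter c"] s cd by (simp add: self_chords_def)
    moreover have "arc_sum ?w (Ini d) (Ter d) = arc_sum ?w (Ini d) (Ter c) + chord_sign c"
      using arc_sum_neighbours(2) [OF w nT, of "Ini d"] s mem cd by (simp add: self_chords_def)
    ultimately show ?thesis by (simp add: self_index_def)
  qed
  have "{e. e \<in> self_chords G i \<inter> {c, d} \<and> self_index G i e = n} =
    (if c \<in> self_chords G i \<and> self_index G i c = n then {c, d} else {})"
    using mem idx by auto
  then show "(\<Sum>e | e \<in> self_chords G i \<inter> {c, d} \<and> self_index G i e = n. chord_sign e) = 0"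
    using ne cd by simp
qed

lemma linking_R2:
  assumes G: "gauss_diagram \<mu> G" "1 \<le> i" "i \<le> \<mu>" "1 \<le> j" "j \<le> \<mu>"
    and cd: "chord_sign d = - chord_sign c"
    and adj: "adjacent G (Ini c) (Ini d)" "adjacent G (Ter c) (Ter d)"
  shows "linking (delete {c, d} G) i j = linking G i j"
proof -
  have ne: "c \<noteq> d" using cd chord_sign_cases [of c] by auto
  have mem: "c \<in> nonself_chords G i j \<longleftrightarrow> d \<in> nonself_chords G i j"
    using neighbours_mem [OF adjacent_neighbours [OF G(1-3) adj(1)]]
      neighbours_mem [OF adjacent_neighbours [OF G(1,4,5) adj(2)]]
    by (simp add: nonself_chords_def)
  show ?thesis
  proof (cases "c \<in> nonself_chords G i j")
    case True
    then have "(\<Sum>e \<in> nonself_chords G i j. chord_sign e) =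
      (\<Sum>e \<in> nonself_chords G i j - {c, d}. chord_sign e) + (\<Sum>e \<in> {c, d}. chord_sign e)"
      using mem by (intro sum.subset_diff) auto
    then show ?thesis
      using ne cd by (simp add: linking_def nonself_chords_delete [OF G])
  next
    case False
    then show ?thesis
      using mem by (simp add: linking_def nonself_chords_delete [OF G])
  qed
qed

text \<open>
  The three exchanges shift the indices of \<open>a\<close>, \<open>b\<close> and \<open>c\<close> twice each, with opposite signs.
\<close>

lemma R3_invariant:
  assumes G: "gauss_diagram \<mu> G" and R: "R3 G H" and i: "1 \<le> i" "i \<le> \<mu>"
  shows "self_writhe H i n = self_writhe G i n"
    and "1 \<le> j \<Longrightarrow> j \<le> \<mu> \<Longrightarrow> linking H i j = linking G i j"
proof -
  from R obtain a b c where dist: "distinct [a, b, c]"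
    and sgn: "chord_sign a = chord_sign b" "chord_sign b = chord_sign c"
    and con: "consecutive G [Ini a, Ini b]" "consecutive G [Ter a, Ini c]" "consecutive G [Ter b, Ter c]"
    and H: "H = exchange (Ini a) (Ini b) (exchange (Ter a) (Ini c) (exchange (Ter b) (Ter c) G))"
    unfolding R3_def by blast
  define G1 where "G1 = exchange (Ter b) (Ter c) G"
  define G2 where "G2 = exchange (Ter a) (Ini c) G1"
  have g1: "gauss_diagram \<mu> G1"
    unfolding G1_def using G con(3) by (rule gauss_diagram_exchange)
  have c1: "consecutive G1 [Ter a, Ini c]" "consecutive G1 [Ini a, Ini b]"
    unfolding G1_def using con dist by (auto intro!: consecutive_exchange)
  have g2: "gauss_diagram \<mu> G2"
    unfolding G2_def using g1 c1(1) by (rule gauss_diagram_exchange)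
  have c2: "consecutive G2 [Ini a, Ini b]"
    unfolding G2_def using c1 dist by (auto intro!: consecutive_exchange)
  have H': "H = exchange (Ini a) (Ini b) G2"
    by (simp add: H G1_def G2_def)
  have s1: "self_chords G1 i = self_chords G i"
    unfolding G1_def by (rule self_chords_exchange [OF G i con(3)])
  have s2: "self_chords G2 i = self_chords G1 i"
    unfolding G2_def by (rule self_chords_exchange [OF g1 i c1(1)])
  have s3: "self_chords H i = self_chords G2 i"
    unfolding H' by (rule self_chords_exchange [OF g2 i c2])
  have "self_index H i e = self_index G i e" if e: "e \<in> self_chords G i" for e
  proof -
    have "self_index H i e = self_index G2 i e + chord_sign e * (of_bool (e = a) - of_bool (e = b))"
      unfolding H' using self_index_exchange [OF g2 i c2, of e] dist e s1 s2 sgn by simp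
    moreover have "self_index G2 i e = self_index G1 i e - chord_sign e * (of_bool (e = a) - of_bool (e = c))"
      unfolding G2_def using self_index_exchange [OF g1 i c1(1), of e] dist e s1 s2 sgn by simp
    moreover have "self_index G1 i e = self_index G i e + chord_sign e * (of_bool (e = b) - of_bool (e = c))"
      unfolding G1_def using self_index_exchange [OF G i con(3), of e] dist e s1 s2 sgn by simp
    ultimately show ?thesis by (simp add: algebra_simps)
  qed
  then show "self_writhe H i n = self_writhe G i n"
    unfolding self_writhe_offset using s1 s2 s3 by (intro offset_writhe_cong) auto
  show "linking H i j = linking G i j" if "1 \<le> j" "j \<le> \<mu>"
    using linking_exchange [OF g2 i that c2] linking_exchange [OF g1 i that c1(1)]
      linking_exchange [OF G i that con(3)] unfolding H' G2_def G1_def by simp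
qed

lemma endpoint_sign_map [simp]:
  "chord_sign (f (chord_of p)) = chord_sign (chord_of p) \<Longrightarrow> endpoint_sign (map_endpoint f p) = endpoint_sign p"
  by (cases p) auto

lemma chord_of_map [simp]: "chord_of (map_endpoint f p) = f (chord_of p)"
  by (cases p) auto

lemma arc_sum_map:
  assumes d: "distinct w" "p \<in> set w" "q \<in> set w" "p \<noteq> q" and g: "inj_on g (set w)"
    and s: "\<And>x. x \<in> set w \<Longrightarrow> endpoint_sign (g x) = endpoint_sign x"
  shows "arc_sum (map g w) (g p) (g q) = arc_sum w p q"
proof -
  have dg: "distinct (map g w)" using d g by (simp add: distinct_map)
  obtain x y where w: "w = x @ p # y" using d(2) by (meson split_list)
  consider "q \<in> set y" | "q \<in> set x" using w d by auto
  then show ?thesis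
  proof cases
    case 1
    then obtain u z where y: "y = u @ q # z" by (meson split_list)
    have "open_arc w p q = u" "open_arc (map g w) (g p) (g q) = map g u"
      using d(1) dg open_arc_unwrapped [of x p u q z]
        open_arc_unwrapped [of "map g x" "g p" "map g u" "g q" "map g z"] unfolding w y by simp_all
    then show ?thesis using s unfolding arc_sum_def w y
      by (auto intro!: arg_cong [where f = sum_list])
  next
    case 2
    then obtain u z where x: "x = u @ q # z" by (meson split_list)
    have "open_arc w p q = y @ u" "open_arc (map g w) (g p) (g q) = map g (y @ u)"
      using d(1) dg open_arc_wrapped [of u q z p y]
        open_arc_wrapped [of "map g u" "g q" "map g z" "g p" "map g y"] unfolding w x by simp_all
    then show ?thesis using s unfolding arc_sum_def w x
      by (auto intro!: arg_cong2 [where f = "(+)"] arg_cong [where f = sum_list])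
  qed
qed

lemma same_diagram_circles:
  assumes G: "gauss_diagram \<mu> G" and sd: "same_diagram G H"
  obtains f where "inj_on f (chords G)" "\<And>c. c \<in> chords G \<Longrightarrow> chord_sign (f c) = chord_sign c"
    "\<And>i. 1 \<le> i \<Longrightarrow> i \<le> \<mu> \<Longrightarrow> rotation (map (map_endpoint f) (circle G i)) (circle H i)"
proof -
  from sd obtain f where f: "inj_on f (chords G)" "\<forall>c \<in> chords G. chord_sign (f c) = chord_sign c"
    and l: "list_all2 (\<lambda>v w. \<exists>k. w = rotate k (map (map_endpoint f) v)) G H"
    unfolding same_diagram_def by blast
  have r: "rotation (map (map_endpoint f) (circle G i)) (circle H i)" if "1 \<le> i" "i \<le> \<mu>" for i
  proof -
    have "i - 1 < length G" using that G by (auto simp: gauss_diagram_def)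
    from list_all2_nthD [OF l this] show ?thesis
      by (simp add: circle_def rotation_iff_rotate)
  qed
  show ?thesis
    by (rule that [OF f(1) _ r]) (use f(2) in simp_all)
qed

lemma inj_on_map_endpoint:
  assumes "inj_on f (chord_of ` A)"
  shows "inj_on (map_endpoint f) A"
proof (rule inj_onI)
  fix x y assume xy: "x \<in> A" "y \<in> A" "map_endpoint f x = map_endpoint f y"
  then have "f (chord_of x) = f (chord_of y)"
    by (metis chord_of_map)
  then have "chord_of x = chord_of y"
    using xy by (intro inj_onD [OF assms]) auto
  then show "x = y"
    using xy(3) by (cases x; cases y) auto
qed

text \<open>
  Arcs are transported by the relabelling and do not depend on the base point.
\<close>

lemma same_diagram_invariant:
  assumes G: "gauss_diagram \<mu> G" and sd: "same_diagram G H" and i: "1 \<le> i" "i \<le> \<mu>"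
  shows "self_writhe H i n = self_writhe G i n"
    and "1 \<le> j \<Longrightarrow> j \<le> \<mu> \<Longrightarrow> linking H i j = linking G i j"
proof -
  obtain f where f: "inj_on f (chords G)" "\<And>c. c \<in> chords G \<Longrightarrow> chord_sign (f c) = chord_sign c"
    and r: "\<And>i. 1 \<le> i \<Longrightarrow> i \<le> \<mu> \<Longrightarrow> rotation (map (map_endpoint f) (circle G i)) (circle H i)"
    using same_diagram_circles [OF G sd] by metis
  have ch: "chord_of x \<in> chords G" if "1 \<le> k" "k \<le> \<mu>" "x \<in> set (circle G k)" for k x
    using circle_endpoints [OF G that] by (simp add: chords_def)
  have ini: "Ini (f c) \<in> set (circle H k) \<longleftrightarrow> Ini c \<in> set (circle G k)"
    and ter: "Ter (f c) \<in> set (circle H k) \<longleftrightarrow> Ter c \<in> set (circle G k)"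
    if k: "1 \<le> k" "k \<le> \<mu>" and c: "c \<in> chords G" for c k
  proof -
    have H: "set (circle H k) = map_endpoint f ` set (circle G k)"
      using rotation_set [OF r [OF k]] by simp
    have "v = c" if "v \<in> chords G" "f v = f c" for v
      using inj_onD [OF f(1) that(2,1) c] .
    then have *: "map_endpoint f x = map_endpoint f y \<Longrightarrow> chord_of y = c \<Longrightarrow> x \<in> set (circle G k) \<Longrightarrow> x = y" for x y
      using ch [OF k, of x] by (cases x; cases y) auto
    show "Ini (f c) \<in> set (circle H k) \<longleftrightarrow> Ini c \<in> set (circle G k)"
    proof
      assume "Ini (f c) \<in> set (circle H k)"
      then obtain x where x: "x \<in> set (circle G k)" "map_endpoint f x = Ini (f c)"
        unfolding H by (metis imageE)
      then show "Ini c \<in> set (circle G k)" using * [of x "Ini c"] by simp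
    next
      assume "Ini c \<in> set (circle G k)"
      then have "map_endpoint f (Ini c) \<in> set (circle H k)" unfolding H by (rule imageI)
      then show "Ini (f c) \<in> set (circle H k)" by simp
    qed
    show "Ter (f c) \<in> set (circle H k) \<longleftrightarrow> Ter c \<in> set (circle G k)"
    proof
      assume "Ter (f c) \<in> set (circle H k)"
      then obtain x where x: "x \<in> set (circle G k)" "map_endpoint f x = Ter (f c)"
        unfolding H by (metis imageE)
      then show "Ter c \<in> set (circle G k)" using * [of x "Ter c"] by simp
    next
      assume "Ter c \<in> set (circle G k)"
      then have "map_endpoint f (Ter c) \<in> set (circle H k)" unfolding H by (rule imageI)
      then show "Ter (f c) \<in> set (circle H k)" by simp
    qed
  qed
  have pre: "\<exists>c \<in> chords G. chord_of x = f c" if k: "1 \<le> k" "k \<le> \<mu>" and "x \<in> set (circle H k)" for k x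
  proof -
    have "x \<in> map_endpoint f ` set (circle G k)"
      using that rotation_set [OF r [OF k]] by simp
    then show ?thesis using ch [OF k] by auto
  qed
  have selfH: "self_chords H i = f ` self_chords G i"
  proof (intro equalityI subsetI)
    fix x assume x: "x \<in> self_chords H i"
    then obtain c where "c \<in> chords G" "x = f c"
      using pre [OF i, of "Ini x"] by (auto simp: self_chords_def)
    then show "x \<in> f ` self_chords G i"
      using x ini [OF i] ter [OF i] by (auto simp: self_chords_def)
  next
    fix x assume "x \<in> f ` self_chords G i"
    then obtain c where c: "c \<in> self_chords G i" "x = f c" by blast
    then have "c \<in> chords G" using ch [OF i, of "Ini c"] by (simp add: self_chords_def)
    then show "x \<in> self_chords H i"
      using c ini [OF i] ter [OF i] by (simp add: self_chords_def)
  qed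
  have chs: "c \<in> chords G" if "c \<in> self_chords G i" for c
    using ch [OF i, of "Ini c"] that by (simp add: self_chords_def)
  have idx: "self_index H i (f c) = self_index G i c" if c: "c \<in> self_chords G i" for c
  proof -
    have inj: "inj_on (map_endpoint f) (set (circle G i))"
      by (rule inj_on_map_endpoint, rule inj_on_subset [OF f(1)]) (use ch [OF i] in auto)
    have d: "distinct (map (map_endpoint f) (circle G i))"
      using circle_distinct [OF G i] inj by (simp add: distinct_map)
    have "arc_sum (circle H i) (map_endpoint f (Ini c)) (map_endpoint f (Ter c)) =
      arc_sum (map (map_endpoint f) (circle G i)) (map_endpoint f (Ini c)) (map_endpoint f (Ter c))"
      by (rule arc_sum_rotation [OF r [OF i] d])
        (use c in \<open>simp_all add: self_chords_def image_iff Bex_def del: endpoint.map\<close>, blast, blast, simp)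
    also have "\<dots> = arc_sum (circle G i) (Ini c) (Ter c)"
      by (rule arc_sum_map [OF circle_distinct [OF G i] _ _ _ inj])
        (use c ch [OF i] f(2) in \<open>auto simp: self_chords_def\<close>)
    finally show ?thesis by (simp add: self_index_def)
  qed
  have inj: "inj_on f (self_chords G i)"
    using f(1) chs by (meson inj_on_subset subsetI)
  have "{e. e \<in> self_chords H i \<and> self_index H i e = n} =
    f ` {e. e \<in> self_chords G i \<and> self_index G i e = n}"
    using idx unfolding selfH by force
  then have "self_writhe H i n = (\<Sum>e \<in> f ` {e. e \<in> self_chords G i \<and> self_index G i e = n}. chord_sign e)"
    by (simp add: self_writhe_def)
  also have "\<dots> = self_writhe G i n"
    unfolding self_writhe_def
    by (subst sum.reindex) (use inj f(2) chs in \<open>auto intro: inj_on_subset intro!: sum.cong\<close>)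
  finally show "self_writhe H i n = self_writhe G i n" .
  assume j: "1 \<le> j" "j \<le> \<mu>"
  have chn: "c \<in> chords G" if "c \<in> nonself_chords G i j" for c
    using ch [OF i, of "Ini c"] that by (simp add: nonself_chords_def)
  have "nonself_chords H i j = f ` nonself_chords G i j"
  proof (intro equalityI subsetI)
    fix x assume x: "x \<in> nonself_chords H i j"
    then obtain c where "c \<in> chords G" "x = f c"
      using pre [OF i, of "Ini x"] by (auto simp: nonself_chords_def)
    then show "x \<in> f ` nonself_chords G i j"
      using x ini [OF i] ter [OF j] by (auto simp: nonself_chords_def)
  next
    fix x assume "x \<in> f ` nonself_chords G i j"
    then obtain c where c: "c \<in> nonself_chords G i j" "x = f c" by blast
    then show "x \<in> nonself_chords H i j"
      using chn [OF c(1)] ini [OF i] ter [OF j] by (simp add: nonself_chords_def)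
  qed
  moreover have "inj_on f (nonself_chords G i j)"
    using f(1) chn by (meson inj_on_subset subsetI)
  ultimately show "linking H i j = linking G i j"
    unfolding linking_def using f(2) chn by (simp add: sum.reindex)
qed

lemma S1_invariant:
  assumes G: "gauss_diagram \<mu> G" and H: "gauss_diagram \<mu> H" and S: "S1 G H" and i: "1 \<le> i" "i \<le> \<mu>"
  shows "n \<notin> {1, sign_sum (circle G i) + 1} \<Longrightarrow> n \<notin> {1, sign_sum (circle H i) + 1} \<Longrightarrow>
      self_writhe H i n = self_writhe G i n"
    and "1 \<le> j \<Longrightarrow> j \<le> \<mu> \<Longrightarrow> linking H i j = linking G i j"
proof -
  from S obtain \<gamma> p q s s' where pq: "{p, q} = {Ini \<gamma>, Ter \<gamma>}" and sgn: "chord_sign s' = chord_sign s"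
    and sh: "shell G s p" "shell H s' q" and del: "delete {s} G = delete {s'} H"
    unfolding S1_def by blast
  have "chord_of p = \<gamma>" "chord_of q = \<gamma>"
    using pq by (auto simp: doubleton_eq_iff)
  then show "self_writhe H i n = self_writhe G i n"
    if "n \<notin> {1, sign_sum (circle G i) + 1}" "n \<notin> {1, sign_sum (circle H i) + 1}"
    unfolding self_writhe_offset
    using offset_writhe_delete_shell [OF G i sh(1) refl that(1)]
      offset_writhe_delete_shell [OF H i sh(2) refl that(2)] del sgn by simp
  show "linking H i j = linking G i j" if "1 \<le> j" "j \<le> \<mu>"
    using linking_delete_shell [OF G i that sh(1)] linking_delete_shell [OF H i that sh(2)] del by simp
qed

text \<open>
  The two shells together contribute to the indices the negative of what the exchange contributes.
\<close>

lemma S2_invariant: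
  assumes G: "gauss_diagram \<mu> G" and H: "gauss_diagram \<mu> H" and S: "S2 G H" and i: "1 \<le> i" "i \<le> \<mu>"
  shows "n \<notin> {1, sign_sum (circle H i) + 1} \<Longrightarrow> self_writhe H i n = self_writhe G i n"
    and "1 \<le> j \<Longrightarrow> j \<le> \<mu> \<Longrightarrow> linking H i j = linking G i j"
proof -
  from S obtain p q s t where ne: "chord_of p \<noteq> chord_of q" and con: "consecutive G [p, q]" and st: "s \<noteq> t"
    and sgn: "chord_sign s = endpoint_sign p * endpoint_sign q" "chord_sign t = - (endpoint_sign p * endpoint_sign q)"
    and sh: "shell H s p" "shell H t q" and del: "delete {s, t} H = exchange p q G"
    unfolding S2_def by blast
  have H1: "gauss_diagram \<mu> (delete {s} H)" using H by (rule gauss_diagram_delete)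
  have pq: "p \<in> endpoints (delete {s, t} H)" "q \<in> endpoints (delete {s, t} H)"
    unfolding del using consecutive_distinct(2) [OF G con] by (auto simp: endpoints_def exchange_def)
  have tq: "shell (delete {s} H) t q"
    unfolding shell_iff
    using sh(2) st pq by (auto simp: shell_iff endpoints_delete intro!: consecutive_delete)
  have del': "delete {t} (delete {s} H) = exchange p q G"
    using del by (simp add: delete_delete insert_commute)
  have circ: "sign_sum (circle (delete {s} H) i) = sign_sum (circle H i)"
  proof -
    from shell_circle [OF H i sh(1)] show ?thesis
    proof
      assume "{Ini s, Ter s, p} \<inter> set (circle H i) = {}"
      then have "filter (\<lambda>v. chord_of v \<notin> {s}) (circle H i) = circle H i"
        by (auto simp: filter_id_conv) (metis chord_of_mem)
      then show ?thesis by (simp add: circle_delete [OF H i])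
    next
      assume "\<exists>u. rotation (circle H i) (shell_opening p s # p # shell_closing p s # u)"
      then obtain u where u: "rotation (circle H i) (shell_opening p s # p # shell_closing p s # u)" ..
      have "distinct (shell_opening p s # p # shell_closing p s # u)"
        using u circle_distinct [OF H i] rotation_distinct by blast
      then have "filter (\<lambda>v. chord_of v \<notin> {s}) u = u"
        by (auto simp: filter_id_conv chord_of_iff_shell [of _ s p])
      moreover have "chord_of p \<noteq> s" using sh(1) by (auto simp: shell_iff)
      ultimately have "rotation (circle (delete {s} H) i) (p # u)"
        unfolding circle_delete [OF H i] using rotation_filter [OF u, of "\<lambda>v. chord_of v \<notin> {s}"] by simp
      from rotation_sign_sum [OF this] rotation_sign_sum [OF u] show ?thesis
        by (simp add: shell_sign)
    qed
  qed
  show "self_writhe H i n = self_writhe G i n" if n: "n \<notin> {1, sign_sum (circle H i) + 1}"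
  proof -
    have "self_writhe H i n = offset_writhe
      (\<lambda>c. - (of_bool (c = chord_of p) * chord_sign s * chord_sign c)) (delete {s} H) i n"
      using offset_writhe_delete_shell [OF H i sh(1) refl n] by (simp add: self_writhe_offset)
    also have "\<dots> = offset_writhe
      (\<lambda>c. - (of_bool (c = chord_of p) * chord_sign s * chord_sign c)
        - of_bool (c = chord_of q) * chord_sign t * chord_sign c) (exchange p q G) i n"
      using offset_writhe_delete_shell [OF H1 i tq, where n = n and
          \<phi> = "\<lambda>c. - (of_bool (c = chord_of p) * chord_sign s * chord_sign c)"] n pq
      unfolding circ del' by (auto simp: endpoints_delete)
    also have "\<dots> = offset_writhe (\<lambda>_. 0) G i n"
      using self_chords_exchange [OF G i con] self_index_exchange [OF G i con ne] sgn
      by (intro offset_writhe_cong) (auto simp: algebra_simps)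
    finally show ?thesis by (simp add: self_writhe_offset)
  qed
  show "linking H i j = linking G i j" if "1 \<le> j" "j \<le> \<mu>"
    using linking_delete_shell [OF H i that sh(1)] linking_delete_shell [OF H1 i that tq]
      linking_exchange [OF G i that con] unfolding del' by simp
qed

text \<open>
  The values at the excluded indices are replaced by \<open>0\<close>, and all writhes are suppressed when
  \<open>\<lambda> \<noteq> 1\<close>, so that the whole tuple is preserved by each single move and no side condition has to be
  carried through sequences of moves.
\<close>

definition invariants :: "diagram \<Rightarrow> int \<times> int \<times> (int \<Rightarrow> int) \<times> (int \<Rightarrow> int)" where
  "invariants G =
    (if linking G 1 2 - linking G 2 1 = 1 then
      (linking G 1 2, linking G 2 1,
       \<lambda>n. if n \<in> {0, 1, -1} then 0 else self_writhe G 1 n,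
       \<lambda>n. if n \<in> {0, 1, 2} then 0 else self_writhe G 2 n)
     else (linking G 1 2, linking G 2 1, \<lambda>_. 0, \<lambda>_. 0))"

definition move :: "diagram \<Rightarrow> diagram \<Rightarrow> bool" where
  "move G H \<longleftrightarrow> reidemeister_step 2 G H \<or> shell_step 2 G H"

lemma move_gauss: "move G H \<Longrightarrow> gauss_diagram 2 G \<and> gauss_diagram 2 H"
  by (auto simp: move_def reidemeister_step_def shell_step_def)

lemma move_linking:
  assumes "move G H" "1 \<le> i" "i \<le> 2" "1 \<le> j" "j \<le> 2"
  shows "linking H i j = linking G i j"
  using assms(1) unfolding move_def reidemeister_step_def shell_step_def R1_def R2_def
  using linking_R1 [OF _ assms(2-5)] linking_R2 [OF _ assms(2-5)]
    same_diagram_invariant(2) [OF _ _ assms(2-5)] R3_invariant(2) [OF _ _ assms(2-5)]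
    S1_invariant(2) [OF _ _ _ assms(2-5)] S2_invariant(2) [OF _ _ _ assms(2-5)]
  by metis

lemma move_self_writhe:
  assumes m: "move G H" and ij: "(i, j) = (1, 2) \<or> (i, j) = (2, 1)"
    and n: "n \<notin> {0, 1, linking G j i - linking G i j, linking G j i - linking G i j + 1}"
  shows "self_writhe H i n = self_writhe G i n"
proof -
  have i: "1 \<le> i" "i \<le> 2" and j: "1 \<le> j" "j \<le> 2" using ij by auto
  note GH = move_gauss [OF m]
  have G: "sign_sum (circle G i) = linking G j i - linking G i j"
    using sign_sum_circle [OF _ ij] GH by blast
  have H: "sign_sum (circle H i) = linking G j i - linking G i j"
    using sign_sum_circle [OF _ ij] GH move_linking [OF m i j] move_linking [OF m j i] by simp
  have n': "n \<notin> {0, sign_sum (circle G i)}" "n \<notin> {1, sign_sum (circle G i) + 1}" "n \<notin> {1, sign_sum (circle H i) + 1}"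
    using n unfolding G H by auto
  from GH have gG: "gauss_diagram 2 G" and gH: "gauss_diagram 2 H" by blast+
  from m consider "same_diagram G H" | "R1 G H" | "R2 G H" | "R3 G H" | "S1 G H" | "S2 G H"
    unfolding move_def reidemeister_step_def shell_step_def by blast
  then show ?thesis
  proof cases
    case 1
    then show ?thesis using same_diagram_invariant(1) [OF gG _ i] by blast
  next
    case 2
    then show ?thesis using self_writhe_R1 [OF gG i _ n'(1)] unfolding R1_def by blast
  next
    case 3
    then show ?thesis using self_writhe_R2 [OF gG i] unfolding R2_def by blast
  next
    case 4
    then show ?thesis using R3_invariant(1) [OF gG _ i] by blast
  next
    case 5
    then show ?thesis using S1_invariant(1) [OF gG gH _ i n'(2,3)] by blast
  next
    case 6
    then show ?thesis using S2_invariant(1) [OF gG gH _ i n'(3)] by blast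
  qed
qed

lemma move_invariants:
  assumes "move G H"
  shows "invariants H = invariants G"
proof -
  note l = move_linking [OF assms, of 1 2, simplified] move_linking [OF assms, of 2 1, simplified]
  show ?thesis
  proof (cases "linking G 1 2 - linking G 2 1 = 1")
    case True
    have "self_writhe H 1 n = self_writhe G 1 n" if "n \<notin> {0, 1, -1}" for n
      by (rule move_self_writhe [OF assms, of 1 2]) (use True that in auto)
    moreover have "self_writhe H 2 n = self_writhe G 2 n" if "n \<notin> {0, 1, 2}" for n
      by (rule move_self_writhe [OF assms, of 2 1]) (use True that in auto)
    ultimately show ?thesis
      using l by (simp add: invariants_def fun_eq_iff)
  next
    case False
    then show ?thesis using l by (simp add: invariants_def)
  qed
qed

lemma equivclp_invariant:
  assumes "equivclp r x y" "\<And>x y. r x y \<Longrightarrow> f y = f x"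
  shows "f y = f x"
  using assms(1) by (induction rule: equivclp_induct) (auto dest: assms(2))

section \<open>The equivalence generated by the moves\<close>

abbreviation move_equiv :: "diagram \<Rightarrow> diagram \<Rightarrow> bool" (infix "\<simeq>" 50) where
  "G \<simeq> H \<equiv> equivclp move G H"

lemma move_equiv_sym: "G \<simeq> H \<Longrightarrow> H \<simeq> G"
  by (rule equivclp_sym)

lemma move_equiv_trans [trans]: "F \<simeq> G \<Longrightarrow> G \<simeq> H \<Longrightarrow> F \<simeq> H"
  by (rule equivclp_trans)

lemma move_equivI: "move G H \<Longrightarrow> G \<simeq> H"
  by (rule r_into_equivclp)

lemma same_diagram_rotation: "list_all2 rotation G H \<Longrightarrow> same_diagram G H"
  unfolding same_diagram_def
  by (rule exI [of _ id]) (auto simp: endpoint.map_id0 rotation_iff_rotate elim: list_all2_mono)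

lemma consecutive_infix:
  assumes "x @ ps @ y \<in> set G"
  shows "consecutive G ps"
proof -
  have "rotation (x @ ps @ y) (ps @ y @ x)"
    using rotation_append [of x "ps @ y"] by simp
  then show ?thesis using assms unfolding consecutive_iff_rotation by blast
qed

section \<open>Stacks of shells\<close>

text \<open>
  An injective numbering of endpoints, from which the labels of shells are made.
\<close>

fun endpoint_code :: "chord endpoint \<Rightarrow> nat" where
  "endpoint_code (Ini c) = 2 * (2 * label c + of_bool (positive c))"
| "endpoint_code (Ter c) = Suc (2 * (2 * label c + of_bool (positive c)))"

lemma endpoint_code_inject: "endpoint_code p = endpoint_code q \<longleftrightarrow> p = q"
proof
  have c: "c = d" if "2 * label c + of_bool (positive c) = 2 * label d + of_bool (positive d)" for c d
    using that by (cases c; cases d; cases "positive c"; cases "positive d"; simp; presburger)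
  assume "endpoint_code p = endpoint_code q"
  then show "p = q"
    by (cases p; cases q) (auto intro!: c, presburger+)
qed simp

text \<open>
  The \<open>j\<close>-th shell around \<open>p\<close>, counted from the outside, has a label that depends only on \<open>p\<close> and
  \<open>j\<close>. Therefore inserting or deleting the innermost shell leaves all other labels alone, and the
  shell moves hold literally, without relabelling. Labels of shells are odd, those of the
  underlying diagram are kept even (\<open>base_diagram\<close>).
\<close>

definition stack_shell :: "chord endpoint \<Rightarrow> nat \<Rightarrow> bool \<Rightarrow> chord" where
  "stack_shell p j b = Chord (Suc (2 * prod_encode (endpoint_code p, j))) b"

lemma stack_shell_inject [simp]:
  "stack_shell p j b = stack_shell q k b' \<longleftrightarrow> p = q \<and> j = k \<and> b = b'"
  by (auto simp: stack_shell_def endpoint_code_inject dest: arg_cong [where f = prod_decode])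

lemma odd_stack_shell [simp]: "odd (label (stack_shell p j b))"
  by (simp add: stack_shell_def)

lemma stack_shell_neq: "even (label c) \<Longrightarrow> stack_shell p j b \<noteq> c" "even (label c) \<Longrightarrow> c \<noteq> stack_shell p j b"
  using odd_stack_shell by metis+

lemma chord_sign_stack_shell [simp]: "chord_sign (stack_shell p j b) = (if b then 1 else -1)"
  by (simp add: stack_shell_def chord_sign_def)

definition openings :: "chord endpoint \<Rightarrow> bool list \<Rightarrow> chord endpoint list" where
  "openings p bs = map (\<lambda>j. shell_opening p (stack_shell p j (bs ! j))) [0..<length bs]"

definition closings :: "chord endpoint \<Rightarrow> bool list \<Rightarrow> chord endpoint list" where
  "closings p bs = rev (map (\<lambda>j. shell_closing p (stack_shell p j (bs ! j))) [0..<length bs])"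

text \<open>
  The list holds the signs of the shells around \<open>p\<close> from the outside to the inside.
\<close>

definition surround :: "chord endpoint \<Rightarrow> bool list \<Rightarrow> chord endpoint list" where
  "surround p bs = openings p bs @ p # closings p bs"

lemma stack_simps [simp]:
  "openings p [] = []" "closings p [] = []" "surround p [] = [p]"
  "openings p (bs @ [b]) = openings p bs @ [shell_opening p (stack_shell p (length bs) b)]"
  "closings p (bs @ [b]) = shell_closing p (stack_shell p (length bs) b) # closings p bs"
  by (auto simp: openings_def closings_def surround_def nth_append)

lemma surround_snoc: "surround p (bs @ [b]) = openings p bs @
    [shell_opening p (stack_shell p (length bs) b), p, shell_closing p (stack_shell p (length bs) b)]
    @ closings p bs"
  by (simp add: surround_def)

lemma set_surround:
  "x \<in> set (surround p bs) \<longleftrightarrow> x = p \<or> (\<exists>j<length bs. chord_of x = stack_shell p j (bs ! j))"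
  by (auto simp: surround_def openings_def closings_def chord_of_iff_shell [of _ _ p] image_iff)

lemma distinct_surround:
  assumes "even (label (chord_of p))"
  shows "distinct (surround p bs)"
proof (induction bs rule: rev_induct)
  case (snoc b bs)
  let ?s = "stack_shell p (length bs) b"
  have new: "x \<notin> set (surround p bs)" if "chord_of x = ?s" for x
    using that assms by (auto simp: set_surround)
  have "shell_opening p ?s \<notin> set (surround p bs)" "shell_closing p ?s \<notin> set (surround p bs)"
    by (rule new, simp)+
  moreover have "shell_opening p ?s \<noteq> shell_closing p ?s"
    by (simp add: shell_opening_def shell_closing_def)
  ultimately show ?case
    using snoc by (auto simp: surround_def)
qed simp

definition surround_word :: "(chord endpoint \<Rightarrow> bool list) \<Rightarrow> chord endpoint list \<Rightarrow> chord endpoint list" where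
  "surround_word a w = concat (map (\<lambda>p. surround p (a p)) w)"

definition decorate :: "(chord endpoint \<Rightarrow> bool list) \<Rightarrow> diagram \<Rightarrow> diagram" where
  "decorate a D = map (surround_word a) D"

definition base_diagram :: "diagram \<Rightarrow> bool" where
  "base_diagram D \<longleftrightarrow> gauss_diagram 2 D \<and> (\<forall>c \<in> chords D. even (label c))"

lemma surround_word_simps [simp]:
  "surround_word a [] = []"
  "surround_word a (p # w) = surround p (a p) @ surround_word a w"
  "surround_word a (v @ w) = surround_word a v @ surround_word a w"
  by (simp_all add: surround_word_def)

lemma surround_word_cong: "(\<And>p. p \<in> set w \<Longrightarrow> a p = b p) \<Longrightarrow> surround_word a w = surround_word b w"
  by (induction w) auto

lemma decorate_cong: "(\<And>p. p \<in> endpoints D \<Longrightarrow> a p = b p) \<Longrightarrow> decorate a D = decorate b D"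
  by (auto simp: decorate_def endpoints_def intro!: surround_word_cong)

lemma decorate_Nil:
  assumes "\<And>p. p \<in> endpoints D \<Longrightarrow> a p = []"
  shows "decorate a D = D"
proof -
  have "surround_word a w = w" if "\<And>p. p \<in> set w \<Longrightarrow> a p = []" for w
    using that by (induction w) auto
  then have "surround_word a w = w" if "w \<in> set D" for w
    using assms that by (metis UN_I endpoints_def set_concat)
  then show ?thesis
    unfolding decorate_def by (rule map_idI)
qed

lemma base_diagramD:
  assumes "base_diagram D"
  shows "gauss_diagram 2 D" "p \<in> endpoints D \<Longrightarrow> even (label (chord_of p))"
    "w \<in> set D \<Longrightarrow> p \<in> set w \<Longrightarrow> even (label (chord_of p))" "c \<in> chords D \<Longrightarrow> even (label c)"
    "c \<in> chords D \<Longrightarrow> Ini c \<in> endpoints D" "c \<in> chords D \<Longrightarrow> Ter c \<in> endpoints D"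
  using assms by (auto simp: base_diagram_def chords_def endpoints_def gauss_diagram_def)

lemma set_surround_word: "x \<in> set (surround_word a w) \<longleftrightarrow>
    (\<exists>p \<in> set w. x = p \<or> (\<exists>j<length (a p). chord_of x = stack_shell p j (a p ! j)))"
  by (induction w) (auto simp: set_surround)

lemma distinct_surround_word:
  assumes "distinct w" "\<And>p. p \<in> set w \<Longrightarrow> even (label (chord_of p))"
  shows "distinct (surround_word a w)"
  using assms
proof (induction w)
  case (Cons p w)
  have "set (surround p (a p)) \<inter> set (surround_word a w) = {}"
  proof (rule ccontr)
    assume "set (surround p (a p)) \<inter> set (surround_word a w) \<noteq> {}"
    then obtain x where "x \<in> set (surround p (a p))" "x \<in> set (surround_word a w)" by blast
    then obtain q where q: "q \<in> set w"
      and x: "x = p \<or> (\<exists>j<length (a p). chord_of x = stack_shell p j (a p ! j))"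
        "x = q \<or> (\<exists>j<length (a q). chord_of x = stack_shell q j (a q ! j))"
      unfolding set_surround set_surround_word by blast
    have "even (label (chord_of p))" "even (label (chord_of q))" "p \<noteq> q"
      using Cons.prems q by auto
    then show False
      using x by (elim disjE exE conjE) (auto simp: stack_shell_neq)
  qed
  then show ?case
    using Cons distinct_surround [of p "a p"] by simp
qed simp

lemma concat_decorate: "concat (decorate a D) = surround_word a (concat D)"
  unfolding decorate_def by (induction D) auto

lemma endpoints_decorate: "x \<in> endpoints (decorate a D) \<longleftrightarrow>
    (\<exists>p \<in> endpoints D. x = p \<or> (\<exists>j<length (a p). chord_of x = stack_shell p j (a p ! j)))"
  unfolding endpoints_def concat_decorate set_surround_word ..

lemma gauss_decorate:
  assumes D: "base_diagram D"
  shows "gauss_diagram 2 (decorate a D)"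
proof -
  have "distinct (concat (decorate a D))"
    unfolding concat_decorate using base_diagramD(1,2) [OF D]
    by (intro distinct_surround_word) (auto simp: gauss_diagram_def endpoints_def)
  moreover have "Ini c \<in> endpoints (decorate a D) \<and> Ter c \<in> endpoints (decorate a D)"
    if "c \<in> chords (decorate a D)" for c
  proof -
    from that obtain x where x: "x \<in> endpoints (decorate a D)" "chord_of x = c"
      by (auto simp: chords_def)
    then obtain p where p: "p \<in> endpoints D"
      and "x = p \<or> (\<exists>j<length (a p). chord_of x = stack_shell p j (a p ! j))"
      unfolding endpoints_decorate by blast
    from this(2) show ?thesis
    proof
      assume "x = p"
      then have "Ini c \<in> endpoints D" "Ter c \<in> endpoints D"
        using p x base_diagramD(5,6) [OF D, of c] by (auto simp: chords_def)
      then show ?thesis unfolding endpoints_decorate by blast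
    next
      assume "\<exists>j<length (a p). chord_of x = stack_shell p j (a p ! j)"
      then show ?thesis
        using p x(2) unfolding endpoints_decorate endpoint.sel by blast
    qed
  qed
  ultimately show ?thesis
    using base_diagramD(1) [OF D] by (auto simp: gauss_diagram_def decorate_def)
qed

lemma filter_surround_word:
  assumes "\<And>p. p \<in> set w \<Longrightarrow> filter P (surround p (a p)) = surround p (b p)"
  shows "filter P (surround_word a w) = surround_word b w"
  using assms by (induction w) auto

lemma delete_stack_shell:
  assumes D: "base_diagram D"
  shows "delete {stack_shell p (length bs) b} (decorate (a(p := bs @ [b])) D) = decorate (a(p := bs)) D"
proof -
  let ?s = "stack_shell p (length bs) b"
  have "filter (\<lambda>x. chord_of x \<notin> {?s}) (surround_word (a(p := bs @ [b])) w) = surround_word (a(p := bs)) w"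
    if w: "w \<in> set D" for w
  proof (rule filter_surround_word)
    fix q assume q: "q \<in> set w"
    then have e: "even (label (chord_of q))" using base_diagramD(3) [OF D w] by blast
    show "filter (\<lambda>x. chord_of x \<notin> {?s}) (surround q ((a(p := bs @ [b])) q)) = surround q ((a(p := bs)) q)"
    proof (cases "q = p")
      case True
      have "chord_of x \<noteq> ?s" if "x \<in> set (surround p bs)" for x
        using that e True by (auto simp: set_surround stack_shell_neq)
      then have "filter (\<lambda>x. chord_of x \<notin> {?s}) (surround p bs) = surround p bs"
        by (simp add: filter_id_conv)
      moreover have "filter (\<lambda>x. chord_of x \<notin> {?s}) (surround p (bs @ [b])) =
        filter (\<lambda>x. chord_of x \<notin> {?s}) (surround p bs)"
        by (simp add: surround_def)
      ultimately show ?thesis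
        using True by simp
    next
      case False
      have "chord_of x \<noteq> ?s" if "x \<in> set (surround q (a q))" for x
        using that e False by (auto simp: set_surround stack_shell_neq)
      then show ?thesis using False by (simp add: filter_id_conv)
    qed
  qed
  then show ?thesis
    by (simp add: delete_def decorate_def)
qed

lemma decorate_infix:
  assumes "p \<in> endpoints D"
  obtains x y where "x @ surround p (a p) @ y \<in> set (decorate a D)"
proof -
  from assms obtain w where w: "w \<in> set D" "p \<in> set w" by (auto simp: endpoints_def)
  then obtain u v where "w = u @ p # v" by (meson split_list)
  then have "surround_word a w = surround_word a u @ surround p (a p) @ surround_word a v" by simp
  then show ?thesis
    using that w(1) unfolding decorate_def by (metis image_eqI list.set_map)
qed

lemma consecutive_decorate_infix:
  assumes "p \<in> endpoints D" "surround p (a p) = x @ ps @ y"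
  shows "consecutive (decorate a D) ps"
proof -
  obtain u v where "u @ surround p (a p) @ v \<in> set (decorate a D)"
    using decorate_infix assms(1) by blast
  then show ?thesis
    using consecutive_infix [of "u @ x" ps "y @ v"] assms(2) by simp
qed

lemma shell_decorate:
  assumes D: "base_diagram D" "p \<in> endpoints D" and a: "a p = bs @ [b]"
  shows "shell (decorate a D) (stack_shell p (length bs) b) p"
  unfolding shell_iff
proof
  show "stack_shell p (length bs) b \<noteq> chord_of p"
    using base_diagramD(2) [OF D] by (rule stack_shell_neq)
  show "consecutive (decorate a D)
    [shell_opening p (stack_shell p (length bs) b), p, shell_closing p (stack_shell p (length bs) b)]"
    by (rule consecutive_decorate_infix [OF D(2)]) (simp only: a surround_snoc)
qed

text \<open>
  The stacks of shells at the two endpoints of a chord behave like the two halves of a zipper: S1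
  pops the innermost shell of one stack and pushes it onto the other.
\<close>

lemma decorate_S1:
  assumes D: "base_diagram D" and c: "c \<in> chords D"
  shows "decorate (a(Ini c := xs @ [b], Ter c := ys)) D \<simeq> decorate (a(Ini c := xs, Ter c := ys @ [b])) D"
proof -
  let ?G = "decorate (a(Ini c := xs @ [b], Ter c := ys)) D"
  let ?H = "decorate (a(Ini c := xs, Ter c := ys @ [b])) D"
  let ?s = "stack_shell (Ini c) (length xs) b" and ?t = "stack_shell (Ter c) (length ys) b"
  have "delete {?s} ?G = decorate (a(Ini c := xs, Ter c := ys)) D"
    using delete_stack_shell [OF D, of "Ini c" xs b "a(Ter c := ys)"] by (simp add: fun_upd_twist)
  moreover have "delete {?t} ?H = decorate (a(Ini c := xs, Ter c := ys)) D"
    using delete_stack_shell [OF D, of "Ter c" ys b "a(Ini c := xs)"] by simp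
  moreover have "shell ?G ?s (Ini c)" "shell ?H ?t (Ter c)"
    using base_diagramD(5,6) [OF D c] D by (auto intro!: shell_decorate)
  ultimately have "S1 ?G ?H"
    unfolding S1_def
    by (intro exI [of _ c] exI [of _ "Ini c"] exI [of _ "Ter c"] exI [of _ ?s] exI [of _ ?t]) simp
  then show ?thesis
    using gauss_decorate [OF D] by (intro move_equivI) (simp add: move_def shell_step_def)
qed

text \<open>
  Two innermost shells of opposite signs are parallel, so R2 removes them.
\<close>

lemma decorate_cancel:
  assumes D: "base_diagram D" and p: "p \<in> endpoints D"
  shows "decorate (a(p := bs @ [b, \<not> b])) D \<simeq> decorate (a(p := bs)) D"
proof -
  let ?G = "decorate (a(p := bs @ [b, \<not> b])) D"
  let ?s = "stack_shell p (length bs) b" and ?t = "stack_shell p (length (bs @ [b])) (\<not> b)"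
  have sur: "surround p (bs @ [b, \<not> b]) = openings p bs @
     [shell_opening p ?s, shell_opening p ?t, p, shell_closing p ?t, shell_closing p ?s] @ closings p bs"
    using surround_snoc [of p "bs @ [b]" "\<not> b"] by simp
  have "consecutive ?G [shell_opening p ?s, shell_opening p ?t]"
    by (rule consecutive_decorate_infix [OF p, where x = "openings p bs"]) (simp add: sur)
  moreover have "consecutive ?G [shell_closing p ?t, shell_closing p ?s]"
    by (rule consecutive_decorate_infix [OF p, where
          x = "openings p bs @ [shell_opening p ?s, shell_opening p ?t, p]"]) (simp add: sur)
  ultimately have "adjacent ?G (Ini ?s) (Ini ?t)" "adjacent ?G (Ter ?s) (Ter ?t)"
    by (auto simp: adjacent_def shell_opening_def shell_closing_def split: if_splits)
  moreover have "delete {?s, ?t} ?G = decorate (a(p := bs)) D"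
    using delete_stack_shell [OF D, of p "bs @ [b]" "\<not> b" a] delete_stack_shell [OF D, of p bs b a]
    by (metis append.assoc append_Cons append_Nil delete_delete insert_is_Un)
  ultimately have "R2 ?G (decorate (a(p := bs)) D)"
    unfolding R2_def by (intro exI [of _ ?s] exI [of _ ?t]) auto
  then show ?thesis
    using gauss_decorate [OF D] by (intro move_equivI) (simp add: move_def reidemeister_step_def)
qed

section \<open>Weights of chords\<close>

definition weight :: "bool list \<Rightarrow> int" where
  "weight bs = (\<Sum>b\<leftarrow>bs. if b then 1 else -1)"

lemma weight_simps [simp]:
  "weight [] = 0" "weight (b # bs) = (if b then 1 else -1) + weight bs"
  "weight (bs @ cs) = weight bs + weight cs" "weight (rev bs) = weight bs"
  by (simp_all add: weight_def rev_map [symmetric])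

text \<open>
  The canonical stack of a given weight, with all shells of the same sign.
\<close>

definition stack_of :: "int \<Rightarrow> bool list" where
  "stack_of k = replicate (nat \<bar>k\<bar>) (0 \<le> k)"

lemma stack_of_0 [simp]: "stack_of 0 = []"
  by (simp add: stack_of_def)

lemma weight_stack_of [simp]: "weight (stack_of k) = k"
  by (simp add: weight_def stack_of_def sum_list_replicate)

lemma stack_of_Cons: "(b \<longleftrightarrow> 0 \<le> k) \<or> k = 0 \<Longrightarrow> b # stack_of k = stack_of ((if b then 1 else -1) + k)"
proof -
  assume *: "(b \<longleftrightarrow> 0 \<le> k) \<or> k = 0"
  show ?thesis
  proof (cases b)
    case True
    then have "nat \<bar>1 + k\<bar> = Suc (nat \<bar>k\<bar>)" using * by auto
    then show ?thesis using True * by (auto simp: stack_of_def)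
  next
    case False
    then have "k = 0 \<or> k < 0" using * by auto
    then have "nat \<bar>- 1 + k\<bar> = Suc (nat \<bar>k\<bar>)" "\<not> 0 \<le> - 1 + k" by auto
    then show ?thesis using False \<open>k = 0 \<or> k < 0\<close> by (auto simp: stack_of_def)
  qed
qed

lemma stack_of_cancel:
  assumes "\<not> ((b \<longleftrightarrow> 0 \<le> k) \<or> k = 0)"
  shows "stack_of k = (\<not> b) # stack_of ((if b then 1 else -1) + k)"
  using stack_of_Cons [of "\<not> b" "(if b then 1 else -1) + k"] assms by (cases b) auto

context
  fixes D :: diagram and c :: chord
  assumes D: "base_diagram D" and c: "c \<in> chords D"
begin

lemma decorate_shift_stack:
  "decorate (a(Ini c := xs @ zs, Ter c := ys)) D \<simeq> decorate (a(Ini c := xs, Ter c := ys @ rev zs)) D"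
proof (induction zs arbitrary: ys rule: rev_induct)
  case (snoc z zs)
  have "decorate (a(Ini c := (xs @ zs) @ [z], Ter c := ys)) D \<simeq>
    decorate (a(Ini c := xs @ zs, Ter c := ys @ [z])) D"
    by (rule decorate_S1 [OF D c])
  also have "\<dots> \<simeq> decorate (a(Ini c := xs, Ter c := (ys @ [z]) @ rev zs)) D"
    by (rule snoc.IH)
  finally show ?case
    by (simp only: append.assoc append.simps rev_append rev.simps)
qed simp

text \<open>
  Shells are cancelled in the middle of a stack after the inner part has been moved to the
  other endpoint of the chord.
\<close>

lemma decorate_cancel_inside:
  "decorate (a(Ini c := xs @ [b, \<not> b] @ zs, Ter c := [])) D \<simeq> decorate (a(Ini c := xs @ zs, Ter c := [])) D"
proof -
  have "decorate (a(Ini c := (xs @ [b, \<not> b]) @ zs, Ter c := [])) D \<simeq>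
    decorate (a(Ini c := xs @ [b, \<not> b], Ter c := [] @ rev zs)) D"
    by (rule decorate_shift_stack)
  also have "\<dots> \<simeq> decorate (a(Ini c := xs, Ter c := [] @ rev zs)) D"
    using decorate_cancel [OF D, of "Ini c" "a(Ter c := rev zs)" xs b] base_diagramD(5) [OF D c]
    by (simp add: fun_upd_twist)
  also have "\<dots> \<simeq> decorate (a(Ini c := xs @ zs, Ter c := [])) D"
    by (rule move_equiv_sym [OF decorate_shift_stack])
  finally show ?thesis by simp
qed

lemma decorate_reduce:
  "decorate (a(Ini c := xs @ zs, Ter c := [])) D \<simeq>
    decorate (a(Ini c := xs @ stack_of (weight zs), Ter c := [])) D"
proof (induction zs arbitrary: xs)
  case (Cons b zs)
  have IH: "decorate (a(Ini c := (xs @ [b]) @ zs, Ter c := [])) D \<simeq>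
    decorate (a(Ini c := (xs @ [b]) @ stack_of (weight zs), Ter c := [])) D"
    by (rule Cons.IH)
  show ?case
  proof (cases "(b \<longleftrightarrow> 0 \<le> weight zs) \<or> weight zs = 0")
    case True
    then show ?thesis
      using IH by (simp only: append.assoc append.simps weight_simps stack_of_Cons [OF True])
  next
    case False
    have "decorate (a(Ini c := xs @ b # stack_of (weight zs), Ter c := [])) D =
      decorate (a(Ini c := xs @ [b, \<not> b] @ stack_of (weight (b # zs)), Ter c := [])) D"
      using stack_of_cancel [OF False] by simp
    also have "\<dots> \<simeq> decorate (a(Ini c := xs @ stack_of (weight (b # zs)), Ter c := [])) D"
      by (rule decorate_cancel_inside)
    finally have "decorate (a(Ini c := xs @ b # stack_of (weight zs), Ter c := [])) D \<simeq>
      decorate (a(Ini c := xs @ stack_of (weight (b # zs)), Ter c := [])) D" .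
    with IH [unfolded append.assoc append.simps] show ?thesis by (rule move_equiv_trans)
  qed
qed simp

lemma decorate_gather:
  "decorate a D \<simeq> decorate (a(Ini c := stack_of (weight (a (Ini c)) + weight (a (Ter c))), Ter c := [])) D"
proof -
  have "decorate (a(Ini c := a (Ini c) @ rev (a (Ter c)), Ter c := [])) D \<simeq>
    decorate (a(Ini c := a (Ini c), Ter c := [] @ rev (rev (a (Ter c))))) D"
    by (rule decorate_shift_stack)
  from move_equiv_sym [OF this]
  have "decorate a D \<simeq> decorate (a(Ini c := [] @ a (Ini c) @ rev (a (Ter c)), Ter c := [])) D"
    by simp
  also have "\<dots> \<simeq> decorate (a(Ini c := [] @ stack_of (weight (a (Ini c) @ rev (a (Ter c)))), Ter c := [])) D"
    by (rule decorate_reduce)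
  finally show ?thesis by simp
qed

end

lemma finite_endpoints [simp]: "finite (endpoints D)"
  and finite_chords [simp]: "finite (chords D)"
  by (auto simp: endpoints_def chords_def)

text \<open>
  Of all decorations with the same weights, the one with canonical stacks at the initial endpoints
  serves as the standard one.
\<close>

definition weighted :: "(chord \<Rightarrow> int) \<Rightarrow> diagram \<Rightarrow> diagram" where
  "weighted w D = decorate (\<lambda>p. case p of Ini c \<Rightarrow> stack_of (w c) | Ter c \<Rightarrow> []) D"

lemma in_chordsI: "Ini c \<in> endpoints D \<Longrightarrow> c \<in> chords D" "Ter c \<in> endpoints D \<Longrightarrow> c \<in> chords D"
  by (force simp: chords_def)+

text \<open>
  Up to the moves a decoration matters only through the total weight of each chord.
\<close>

lemma decorate_weighted:
  assumes D: "base_diagram D" and w: "\<And>c. c \<in> chords D \<Longrightarrow> weight (a (Ini c)) + weight (a (Ter c)) = w c"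
  shows "decorate a D \<simeq> weighted w D"
proof -
  define g where "g S p = (if chord_of p \<in> S then
    (case p of Ini c \<Rightarrow> stack_of (weight (a (Ini c)) + weight (a (Ter c))) | Ter c \<Rightarrow> []) else a p)" for S p
  have "decorate a D \<simeq> decorate (g S) D" if "finite S" "S \<subseteq> chords D" for S
    using that
  proof (induction S)
    case empty
    have "g {} = a" by (simp add: g_def fun_eq_iff)
    then show ?case by simp
  next
    case (insert c S)
    have "decorate (g S) D \<simeq> decorate ((g S)(Ini c :=
      stack_of (weight (g S (Ini c)) + weight (g S (Ter c))), Ter c := [])) D"
      using insert.prems by (intro decorate_gather [OF D]) simp
    also have "(g S)(Ini c := stack_of (weight (g S (Ini c)) + weight (g S (Ter c))), Ter c := []) = g (insert c S)"
      using insert.hyps(2) by (auto simp: g_def fun_eq_iff split: endpoint.splits)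
    finally show ?case
      using insert.IH insert.prems by (metis insert_subset move_equiv_trans)
  qed
  from this [of "chords D"] have "decorate a D \<simeq> decorate (g (chords D)) D" by simp
  also have "decorate (g (chords D)) D = weighted w D"
    unfolding weighted_def
    by (rule decorate_cong) (use w in \<open>auto simp: g_def in_chordsI split: endpoint.splits\<close>)
  finally show ?thesis .
qed

lemma weighted_cong: "(\<And>c. c \<in> chords D \<Longrightarrow> w c = v c) \<Longrightarrow> weighted w D = weighted v D"
  unfolding weighted_def by (rule decorate_cong) (auto simp: in_chordsI split: endpoint.splits)

lemma gauss_weighted: "base_diagram D \<Longrightarrow> gauss_diagram 2 (weighted w D)"
  unfolding weighted_def by (rule gauss_decorate)

lemma weighted_0: "(\<And>c. c \<in> chords D \<Longrightarrow> w c = 0) \<Longrightarrow> weighted w D = D"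
  unfolding weighted_def
  by (rule decorate_Nil) (auto simp: in_chordsI split: endpoint.splits)

lemma rotation_surround_word: "rotation v w \<Longrightarrow> rotation (surround_word a v) (surround_word a w)"
  by (auto simp: rotation_append elim!: rotationE)

lemma consecutive_decorate:
  assumes "consecutive D ps" "\<And>p. p \<in> set ps \<Longrightarrow> a p = []"
  shows "consecutive (decorate a D) ps"
proof -
  obtain w u where w: "w \<in> set D" "rotation w (ps @ u)"
    using assms(1) unfolding consecutive_iff_rotation by blast
  have "surround_word a ps = ps"
    using assms(2) by (induction ps) auto
  then have "rotation (surround_word a w) (ps @ surround_word a u)"
    using rotation_surround_word [OF w(2), of a] by simp
  then show ?thesis
    using w(1) unfolding consecutive_iff_rotation decorate_def by auto
qed

lemma decorate_exchange:
  assumes D: "base_diagram D" and pq: "p \<in> endpoints D" "q \<in> endpoints D" and a: "a p = []" "a q = []"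
  shows "exchange p q (decorate a D) = decorate a (exchange p q D)"
proof -
  let ?f = "id(p := q, q := p)"
  have "map ?f (surround_word a w) = surround_word a (map ?f w)" if w: "w \<in> set D" for w
  proof -
    have "map ?f (surround r (a r)) = surround (?f r) (a (?f r))" if r: "r \<in> set w" for r
    proof (cases "r \<in> {p, q}")
      case False
      have "?f x = x" if "x \<in> set (surround r (a r))" for x
      proof -
        have "even (label (chord_of p))" "even (label (chord_of q))"
          using base_diagramD(2) [OF D] pq by blast+
        then have "x \<noteq> p" "x \<noteq> q"
          using that False by (auto simp: set_surround stack_shell_neq)
        then show ?thesis by simp
      qed
      then have "map ?f (surround r (a r)) = surround r (a r)" by (rule map_idI)
      then show ?thesis using False by simp
    qed (use a in auto)
    then show ?thesis by (induction w) auto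
  qed
  then show ?thesis by (simp add: exchange_def decorate_def)
qed

lemma chords_exchange:
  assumes "base_diagram D" "consecutive D [p, q]"
  shows "chords (exchange p q D) = chords D"
proof -
  have "{p, q} \<subseteq> endpoints D"
    using consecutive_distinct(2) [OF base_diagramD(1) [OF assms(1)] assms(2)] by simp
  moreover have "endpoints (exchange p q D) = id(p := q, q := p) ` endpoints D"
    by (auto simp: endpoints_def exchange_def)
  ultimately have "endpoints (exchange p q D) = endpoints D"
    by (auto simp: image_iff)
  then show ?thesis by (simp add: chords_def)
qed

lemma base_diagram_exchange:
  assumes "base_diagram D" "consecutive D [p, q]"
  shows "base_diagram (exchange p q D)"
  using assms gauss_diagram_exchange chords_exchange [OF assms] by (simp add: base_diagram_def)

text \<open>
  The move requires bare endpoints; since shells can be parked at the opposite endpoints of the two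
  chords, this will be no restriction.
\<close>

lemma decorate_S2:
  assumes D: "base_diagram D" and con: "consecutive D [p, q]" and ne: "chord_of p \<noteq> chord_of q"
    and a: "a p = []" "a q = []"
  shows "decorate a D \<simeq> decorate (a(p := [endpoint_sign p = endpoint_sign q],
    q := [endpoint_sign p \<noteq> endpoint_sign q])) (exchange p q D)"
proof -
  let ?b = "endpoint_sign p = endpoint_sign q"
  let ?E = "exchange p q D"
  let ?H = "decorate (a(p := [?b], q := [\<not> ?b])) ?E"
  let ?s = "stack_shell p 0 ?b" and ?t = "stack_shell q 0 (\<not> ?b)"
  have E: "base_diagram ?E" using D con by (rule base_diagram_exchange)
  have pqD: "p \<in> endpoints D" "q \<in> endpoints D"
    using consecutive_distinct(2) [OF base_diagramD(1) [OF D] con] by auto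
  have pq: "p \<in> endpoints ?E" "q \<in> endpoints ?E"
    using pqD by (auto simp: endpoints_def exchange_def)
  have neq: "p \<noteq> q" using ne by auto
  have shp: "shell ?H ?s p"
    using shell_decorate [OF E pq(1), of _ "[]"] neq by simp
  have shq: "shell ?H ?t q"
    using shell_decorate [OF E pq(2), of _ "[]"] by simp
  have "delete {?t} ?H = decorate (a(p := [?b], q := [])) ?E"
    using delete_stack_shell [OF E, of q "[]" "\<not> ?b" "a(p := [?b])"] by simp
  also have "a(p := [?b], q := []) = (a(q := []))(p := [?b])"
    using neq by (simp add: fun_upd_twist)
  also have "delete {?s} (decorate \<dots> ?E) = decorate (a(q := [], p := [])) ?E"
    using delete_stack_shell [OF E, of p "[]" ?b "a(q := [])"] by simp
  also have "a(q := [], p := []) = a" using a by (simp add: fun_eq_iff)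
  finally have "delete {?s} (delete {?t} ?H) = decorate a ?E" .
  then have "delete {?s, ?t} ?H = exchange p q (decorate a D)"
    using decorate_exchange [of D p q a] D pqD a by (simp add: delete_delete insert_commute)
  moreover have "consecutive (decorate a D) [p, q]"
    using con a by (intro consecutive_decorate) auto
  moreover have "chord_sign ?s = endpoint_sign p * endpoint_sign q"
    "chord_sign ?t = - (endpoint_sign p * endpoint_sign q)"
    using endpoint_sign_cases [of p] endpoint_sign_cases [of q] by auto
  ultimately have "S2 (decorate a D) ?H"
    unfolding S2_def using ne shp shq neq
    by (intro exI [of _ p] exI [of _ q] exI [of _ ?s] exI [of _ ?t]) simp
  then show ?thesis
    using gauss_decorate [OF D] gauss_decorate [OF E]
    by (intro move_equivI) (simp add: move_def shell_step_def)
qed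

text \<open>
  This is S2 in terms of weights, and the main tool for all rearrangements.
\<close>

lemma weighted_exchange:
  assumes D: "base_diagram D" and con: "consecutive D [p, q]" and ne: "chord_of p \<noteq> chord_of q"
    and v: "\<And>c. c \<in> chords D \<Longrightarrow> v c = w c +
      (of_bool (c = chord_of p) - of_bool (c = chord_of q)) * endpoint_sign p * endpoint_sign q"
  shows "weighted w D \<simeq> weighted v (exchange p q D)"
proof -
  (* The shells of both chords are moved away from p and q to the other endpoints. *)
  define a where "a r = (if r \<in> {p, q} then []
    else if chord_of r \<in> {chord_of p, chord_of q} then stack_of (w (chord_of r))
    else case r of Ini c \<Rightarrow> stack_of (w c) | Ter c \<Rightarrow> [])" for r
  have apq: "a p = []" "a q = []" by (simp_all add: a_def)
  have aw: "weight (a (Ini c)) + weight (a (Ter c)) = w c" for c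
    using ne by (cases p; cases q) (auto simp: a_def)
  have "decorate a D \<simeq> weighted w D"
    using D aw by (rule decorate_weighted)
  from move_equiv_sym [OF this]
  have "weighted w D \<simeq> decorate a D" .
  also have "\<dots> \<simeq> decorate (a(p := [endpoint_sign p = endpoint_sign q],
    q := [endpoint_sign p \<noteq> endpoint_sign q])) (exchange p q D)"
    using D con ne apq by (rule decorate_S2)
  also have "\<dots> \<simeq> weighted v (exchange p q D)"
  proof (rule decorate_weighted [OF base_diagram_exchange [OF D con]])
    fix c assume "c \<in> chords (exchange p q D)"
    then have c: "c \<in> chords D" by (simp add: chords_exchange [OF D con])
    have pq: "p \<noteq> q" using ne by auto
    have "weight ((a(p := [endpoint_sign p = endpoint_sign q], q := [endpoint_sign p \<noteq> endpoint_sign q])) r)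
      = weight (a r) + (if r = p then endpoint_sign p * endpoint_sign q else 0)
        - (if r = q then endpoint_sign p * endpoint_sign q else 0)" for r
      using apq pq endpoint_sign_cases [of p] endpoint_sign_cases [of q] by auto
    then show "weight ((a(p := [endpoint_sign p = endpoint_sign q], q := [endpoint_sign p \<noteq> endpoint_sign q])) (Ini c))
      + weight ((a(p := [endpoint_sign p = endpoint_sign q], q := [endpoint_sign p \<noteq> endpoint_sign q])) (Ter c)) = v c"
      using aw [of c] v [OF c] ne by (simp only:) (cases p; cases q; auto)
  qed
  finally show ?thesis .
qed

lemma chords_delete: "base_diagram D \<Longrightarrow> chords (delete A D) = chords D - A"
  unfolding chords_def endpoints_delete by auto

lemma base_diagram_delete: "base_diagram D \<Longrightarrow> base_diagram (delete A D)"
  using chords_delete [of D A] gauss_diagram_delete by (auto simp: base_diagram_def)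

lemma decorate_delete:
  assumes D: "base_diagram D" and A: "\<And>c. c \<in> A \<Longrightarrow> even (label c) \<and> a (Ini c) = [] \<and> a (Ter c) = []"
  shows "delete A (decorate a D) = decorate a (delete A D)"
proof -
  have "filter (\<lambda>x. chord_of x \<notin> A) (surround_word a w) =
    surround_word a (filter (\<lambda>x. chord_of x \<notin> A) w)" if "w \<in> set D" for w
  proof -
    have "filter (\<lambda>x. chord_of x \<notin> A) (surround p (a p)) = (if chord_of p \<notin> A then surround p (a p) else [])"
      for p
    proof (cases "chord_of p \<in> A")
      case True
      then have "a p = []" using A [OF True] by (cases p) auto
      then show ?thesis using True by simp
    next
      case False
      have "chord_of x \<notin> A" if "x \<in> set (surround p (a p))" for x
        using that False A by (metis odd_stack_shell set_surround)
      then show ?thesis using False by (simp add: filter_id_conv)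
    qed
    then show ?thesis by (induction w) auto
  qed
  then show ?thesis by (simp add: delete_def decorate_def)
qed

lemma weighted_delete:
  assumes D: "base_diagram D" and A: "A \<subseteq> chords D" "\<And>c. c \<in> A \<Longrightarrow> w c = 0"
  shows "delete A (weighted w D) = weighted w (delete A D)"
  unfolding weighted_def using A base_diagramD(4) [OF D]
  by (intro decorate_delete [OF D]) auto

lemma adjacent_weighted:
  assumes "adjacent D p q" "w (chord_of p) = 0" "w (chord_of q) = 0"
  shows "adjacent (weighted w D) p q"
proof -
  have "(case p of Ini c \<Rightarrow> stack_of (w c) | Ter c \<Rightarrow> []) = []" "(case q of Ini c \<Rightarrow> stack_of (w c) | Ter c \<Rightarrow> []) = []"
    using assms(2,3) by (auto split: endpoint.splits)
  then show ?thesis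
    using assms(1) unfolding adjacent_def weighted_def by (auto intro!: consecutive_decorate)
qed

lemma weighted_R1:
  assumes D: "base_diagram D" and adj: "adjacent D (Ini c) (Ter c)" and w: "w c = 0"
  shows "weighted w D \<simeq> weighted w (delete {c} D)"
proof -
  have "Ini c \<in> endpoints D"
    using adj consecutive_distinct(2) [OF base_diagramD(1) [OF D]] by (fastforce simp: adjacent_def)
  then have "weighted w (delete {c} D) = delete {c} (weighted w D)"
    using w by (intro weighted_delete [symmetric] D) (auto intro: in_chordsI)
  moreover have "adjacent (weighted w D) (Ini c) (Ter c)"
    using adj w by (intro adjacent_weighted) auto
  ultimately have "R1 (weighted w D) (weighted w (delete {c} D))"
    unfolding R1_def by blast
  then show ?thesis
    using gauss_weighted [OF D] gauss_weighted [OF base_diagram_delete [OF D]]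
    by (intro move_equivI) (simp add: move_def reidemeister_step_def)
qed

lemma weighted_R2:
  assumes D: "base_diagram D" and adj: "adjacent D (Ini c) (Ini d)" "adjacent D (Ter c) (Ter d)"
    and s: "chord_sign d = - chord_sign c" and w: "w c = 0" "w d = 0"
  shows "weighted w D \<simeq> weighted w (delete {c, d} D)"
proof -
  have "Ini c \<in> endpoints D" "Ini d \<in> endpoints D"
    using adj(1) consecutive_distinct(2) [OF base_diagramD(1) [OF D]] by (fastforce simp: adjacent_def)+
  then have "weighted w (delete {c, d} D) = delete {c, d} (weighted w D)"
    using w by (intro weighted_delete [symmetric] D) (auto intro: in_chordsI)
  moreover have "adjacent (weighted w D) (Ini c) (Ini d)" "adjacent (weighted w D) (Ter c) (Ter d)"
    using adj w by (auto intro!: adjacent_weighted)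
  ultimately have "R2 (weighted w D) (weighted w (delete {c, d} D))"
    unfolding R2_def using s by blast
  then show ?thesis
    using gauss_weighted [OF D] gauss_weighted [OF base_diagram_delete [OF D]]
    by (intro move_equivI) (simp add: move_def reidemeister_step_def)
qed

lemma move_equiv_same_diagram:
  "gauss_diagram 2 G \<Longrightarrow> gauss_diagram 2 H \<Longrightarrow> same_diagram G H \<Longrightarrow> G \<simeq> H"
  by (intro move_equivI) (simp add: move_def reidemeister_step_def)

lemma weighted_rotation:
  assumes D: "base_diagram D" and r: "list_all2 rotation D E"
  shows "base_diagram E" "weighted w D \<simeq> weighted w E"
proof -
  have "mset v = mset w" if "rotation v w" for v w :: "chord endpoint list"
    using that by (auto simp: rotation_def)
  with r have "mset (concat D) = mset (concat E)"
    by (induction rule: list_all2_induct) auto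
  moreover have "length D = length E" using r by (rule list_all2_lengthD)
  ultimately show E: "base_diagram E"
    using D gauss_diagram_mset [of D E 2] mset_eq_setD [of "concat D" "concat E"]
    unfolding base_diagram_def chords_def endpoints_def by metis
  have "list_all2 rotation (weighted w D) (weighted w E)"
    unfolding weighted_def decorate_def list_all2_map1 list_all2_map2
    using r rotation_surround_word by (auto elim: list_all2_mono)
  then show "weighted w D \<simeq> weighted w E"
    using gauss_weighted D E by (blast intro: move_equiv_same_diagram same_diagram_rotation)
qed

text \<open>
  A chord that sits like a shell around a bare endpoint differs only by its label from a shell of
  the decoration.
\<close>

lemma decorate_shell:
  assumes D: "base_diagram D" and sh: "shell D s p" and a: "a p = []" "a (Ini s) = []" "a (Ter s) = []"
  shows "decorate a D \<simeq> decorate (a(p := [positive s])) (delete {s} D)"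
proof -
  let ?t = "stack_shell p 0 (positive s)"
  let ?f = "id(s := ?t)"
  let ?a = "a(p := [positive s])"
  have gD: "gauss_diagram 2 D" using D by (rule base_diagramD(1))
  have con: "consecutive D [shell_opening p s, p, shell_closing p s]" and ne: "s \<noteq> chord_of p"
    using sh by (auto simp: shell_iff)
  have "set [shell_opening p s, p, shell_closing p s] \<subseteq> endpoints D"
    using consecutive_distinct(2) [OF gD con] .
  then have "p \<in> endpoints D" "Ini s \<in> endpoints D"
    unfolding set_shell [symmetric] by auto
  then have p: "even (label (chord_of p))" and s: "even (label s)"
    using base_diagramD(2) [OF D] by fastforce+
  have tnot: "?t \<notin> chords (decorate a D)"
  proof
    assume "?t \<in> chords (decorate a D)"
    then obtain x where x: "x \<in> endpoints (decorate a D)" "chord_of x = ?t"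
      by (auto simp: chords_def)
    then obtain q where q: "q \<in> endpoints D" "x = q \<or> (\<exists>j<length (a q). chord_of x = stack_shell q j (a q ! j))"
      unfolding endpoints_decorate by blast
    then show False
      using x(2) a(1) base_diagramD(2) [OF D q(1)] by (auto simp: stack_shell_neq)
  qed
  have f1: "map_endpoint ?f x = x" if "chord_of x \<noteq> s" for x
    using that by (cases x) auto
  have f2: "map (map_endpoint ?f) (surround_word a w) = surround_word a w"
    if "\<And>x. x \<in> set w \<Longrightarrow> chord_of x \<noteq> s" for w
    using that s by (intro map_idI f1) (auto simp: set_surround_word stack_shell_neq)
  have f3: "map_endpoint ?f (shell_opening p s) = shell_opening p ?t"
    "map_endpoint ?f (shell_closing p s) = shell_closing p ?t"
    by (auto simp: shell_opening_def shell_closing_def)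
  have circ: "rotation (map (map_endpoint ?f) (surround_word a w))
      (surround_word ?a (filter (\<lambda>x. chord_of x \<notin> {s}) w))" if w: "w \<in> set D" for w
  proof -
    obtain i where i: "1 \<le> i" "i \<le> 2" "w = circle D i"
    proof -
      from w obtain j where j: "j < 2" "w = D ! j"
        using gD by (metis gauss_diagram_def in_set_conv_nth)
      show ?thesis by (rule that [of "Suc j"]) (use j in \<open>auto simp: circle_def\<close>)
    qed
    have dw: "distinct w" using gD w by (rule gauss_circle_distinct)
    from shell_circle [OF gD i(1,2) sh] show ?thesis
    proof
      assume e: "{Ini s, Ter s, p} \<inter> set (circle D i) = {}"
      have no: "chord_of x \<noteq> s" if "x \<in> set w" for x
        using e that i(3) by (cases x) auto
      then have "filter (\<lambda>x. chord_of x \<notin> {s}) w = w"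
        by (simp add: filter_id_conv)
      moreover have "surround_word ?a w = surround_word a w"
        using e i(3) by (intro surround_word_cong) auto
      ultimately show ?thesis using f2 [OF no] by simp
    next
      assume "\<exists>u. rotation (circle D i) (shell_opening p s # p # shell_closing p s # u)"
      then obtain u where u: "rotation w (shell_opening p s # p # shell_closing p s # u)"
        using i(3) by blast
      have d: "distinct (shell_opening p s # p # shell_closing p s # u)"
        using u dw rotation_distinct by blast
      have no: "chord_of x \<noteq> s" if "x \<in> set u" for x
        using that d by (auto simp: chord_of_iff_shell [of _ s p])
      have "rotation (map (map_endpoint ?f) (surround_word a w))
        (map (map_endpoint ?f) (surround_word a (shell_opening p s # p # shell_closing p s # u)))"
        by (intro rotation_map rotation_surround_word u)
      also have "a (shell_opening p s) = []" "a (shell_closing p s) = []"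
        using a by (auto simp: shell_opening_def shell_closing_def)
      then have "map (map_endpoint ?f) (surround_word a (shell_opening p s # p # shell_closing p s # u)) =
        shell_opening p ?t # p # shell_closing p ?t # surround_word a u"
        using a(1) f1 [of p] ne by (simp add: f2 [OF no] f3)
      also have "\<dots> = surround_word ?a (filter (\<lambda>x. chord_of x \<notin> {s}) (shell_opening p s # p # shell_closing p s # u))"
      proof -
        have "filter (\<lambda>x. chord_of x \<notin> {s}) u = u"
          using no by (simp add: filter_id_conv)
        moreover have "surround_word ?a u = surround_word a u"
          using d by (intro surround_word_cong) auto
        moreover have "surround p [positive s] = [shell_opening p ?t, p, shell_closing p ?t]"
          using surround_snoc [of p "[]" "positive s"] by simp
        ultimately show ?thesis using ne by simp
      qed
      finally have 1: "rotation (map (map_endpoint ?f) (surround_word a w))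
        (surround_word ?a (filter (\<lambda>x. chord_of x \<notin> {s}) (shell_opening p s # p # shell_closing p s # u)))" .
      have 2: "rotation (surround_word ?a (filter (\<lambda>x. chord_of x \<notin> {s}) w))
        (surround_word ?a (filter (\<lambda>x. chord_of x \<notin> {s}) (shell_opening p s # p # shell_closing p s # u)))"
        by (intro rotation_surround_word rotation_filter u)
      show ?thesis using 1 rotation_sym [OF 2] by (rule rotation_trans)
    qed
  qed
  have "same_diagram (decorate a D) (decorate ?a (delete {s} D))"
    unfolding same_diagram_def
  proof (intro exI conjI ballI)
    show "inj_on ?f (chords (decorate a D))"
      using tnot by (auto simp: inj_on_def)
    show "chord_sign (?f c) = chord_sign c" for c
      by (cases c) (auto simp: chord_sign_def stack_shell_def)
    show "list_all2 (\<lambda>v w. \<exists>k. w = rotate k (map (map_endpoint ?f) v)) (decorate a D) (decorate ?a (delete {s} D))"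
      using circ unfolding decorate_def delete_def map_map list_all2_map1 list_all2_map2 rotation_iff_rotate comp_def
      by (simp add: list.rel_refl_strong)
  qed
  then show ?thesis
    using gauss_decorate [OF D] gauss_decorate [OF base_diagram_delete [OF D]]
    by (intro move_equiv_same_diagram)
qed

text \<open>
  Hence a chord of weight \<open>0\<close> that surrounds an endpoint can be traded for one unit of weight of the
  chord of this endpoint.
\<close>

lemma weighted_shell:
  assumes D: "base_diagram D" and sh: "shell D s p" and w: "w s = 0"
    and v: "\<And>c. c \<in> chords D \<Longrightarrow> c \<noteq> s \<Longrightarrow> v c = w c + of_bool (c = chord_of p) * chord_sign s"
  shows "weighted w D \<simeq> weighted v (delete {s} D)"
proof -
  define a where "a r = (if r = p then [] else if chord_of r = chord_of p then stack_of (w (chord_of r))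
    else case r of Ini c \<Rightarrow> stack_of (w c) | Ter c \<Rightarrow> [])" for r
  have ne: "s \<noteq> chord_of p" using sh by (simp add: shell_iff)
  have aw: "weight (a (Ini c)) + weight (a (Ter c)) = w c" for c
    by (cases p) (auto simp: a_def)
  have "decorate a D \<simeq> weighted w D"
    using D aw by (rule decorate_weighted)
  from move_equiv_sym [OF this]
  have "weighted w D \<simeq> decorate a D" .
  also have "\<dots> \<simeq> decorate (a(p := [positive s])) (delete {s} D)"
    by (rule decorate_shell [OF D sh]) (use ne w in \<open>auto simp: a_def\<close>)
  also have "\<dots> \<simeq> weighted v (delete {s} D)"
  proof (rule decorate_weighted [OF base_diagram_delete [OF D]])
    fix c assume "c \<in> chords (delete {s} D)"
    then have c: "c \<in> chords D" "c \<noteq> s" by (auto simp: chords_delete [OF D])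
    have "weight ((a(p := [positive s])) r) = weight (a r) + (if r = p then chord_sign s else 0)" for r
      by (auto simp: a_def chord_sign_def)
    then show "weight ((a(p := [positive s])) (Ini c)) + weight ((a(p := [positive s])) (Ter c)) = v c"
      using aw [of c] v [OF c] by (simp only:) (cases p; auto)
  qed
  finally show ?thesis .
qed

lemma base_diagram_relabel:
  assumes D: "gauss_diagram 2 D" and f: "inj_on f (chords D)" "\<And>c. c \<in> chords D \<Longrightarrow> even (label (f c))"
  shows "base_diagram (map (map (map_endpoint f)) D)"
proof -
  let ?E = "map (map (map_endpoint f)) D"
  have inj: "inj_on (map_endpoint f) (endpoints D)"
    using f(1) unfolding chords_def by (rule inj_on_map_endpoint)
  have c: "concat ?E = map (map_endpoint f) (concat D)"
    by (simp add: map_concat)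
  then have e: "endpoints ?E = map_endpoint f ` endpoints D"
    unfolding endpoints_def by (simp only: set_map)
  have "distinct (concat ?E)"
    using D inj unfolding c distinct_map by (auto simp: gauss_diagram_def endpoints_def)
  moreover have ch: "chords ?E = f ` chords D"
    unfolding chords_def e by (auto simp: image_image)
  have "Ini c \<in> endpoints ?E \<and> Ter c \<in> endpoints ?E" if c: "c \<in> chords ?E" for c
  proof -
    from c obtain b where b: "b \<in> chords D" "c = f b" unfolding ch by blast
    then have "map_endpoint f (Ini b) \<in> endpoints ?E" "map_endpoint f (Ter b) \<in> endpoints ?E"
      unfolding e using D by (auto simp: gauss_diagram_def intro!: imageI simp del: endpoint.map)
    then show ?thesis using b by simp
  qed
  ultimately show ?thesis
    using D f(2) by (auto simp: base_diagram_def gauss_diagram_def ch)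
qed

lemma endpoint_decode: "inv endpoint_code (endpoint_code p) = p"
  by (rule inv_f_f) (simp add: inj_def endpoint_code_inject)

text \<open>
  A relabelling of the underlying diagram induces one of the shells: their labels encode the
  endpoint that they surround, and this endpoint is relabelled inside the code.
\<close>

lemma weighted_relabel:
  assumes D: "base_diagram D" and f: "inj_on f (chords D)"
    and lab: "\<And>c. c \<in> chords D \<Longrightarrow> even (label (f c))"
    and sgn: "\<And>c. c \<in> chords D \<Longrightarrow> chord_sign (f c) = chord_sign c"
    and w: "\<And>c. c \<in> chords D \<Longrightarrow> v (f c) = w c"
  shows "weighted w D \<simeq> weighted v (map (map (map_endpoint f)) D)"
proof -
  let ?E = "map (map (map_endpoint f)) D"
  define a where "a = (\<lambda>p. case p of Ini c \<Rightarrow> stack_of (w c) | Ter c \<Rightarrow> [])"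
  define b where "b = (\<lambda>p. case p of Ini c \<Rightarrow> stack_of (v c) | Ter c \<Rightarrow> [])"
  define F where "F x = (if even (label x) then f x else
    stack_shell (map_endpoint f (inv endpoint_code (fst (prod_decode (label x div 2)))))
      (snd (prod_decode (label x div 2))) (positive x))" for x
  have Fs: "F (stack_shell p j q) = stack_shell (map_endpoint f p) j q" for p j q
    by (simp add: F_def stack_shell_def endpoint_decode)
  have E: "base_diagram ?E"
    using base_diagramD(1) [OF D] f lab by (rule base_diagram_relabel)
  have ep: "map_endpoint F p = map_endpoint f p" "endpoint_sign (map_endpoint f p) = endpoint_sign p"
    "b (map_endpoint f p) = a p" if "p \<in> endpoints D" for p
  proof -
    have c: "chord_of p \<in> chords D" using that by (simp add: chords_def)
    then show "map_endpoint F p = map_endpoint f p"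
      using base_diagramD(4) [OF D] by (cases p) (auto simp: F_def)
    show "endpoint_sign (map_endpoint f p) = endpoint_sign p" using sgn [OF c] by simp
    show "b (map_endpoint f p) = a p" using w [OF c] by (cases p) (auto simp: a_def b_def)
  qed
  have sur: "map (map_endpoint F) (surround p bs) = surround (map_endpoint f p) bs"
    if p: "p \<in> endpoints D" for p bs
  proof -
    have "map_endpoint F (shell_opening p s) = shell_opening (map_endpoint f p) (F s)"
      "map_endpoint F (shell_closing p s) = shell_closing (map_endpoint f p) (F s)" for s
      using ep(2) [OF p] by (auto simp: shell_opening_def shell_closing_def)
    then have "map (map_endpoint F) (openings p bs) = openings (map_endpoint f p) bs"
      "map (map_endpoint F) (closings p bs) = closings (map_endpoint f p) bs"
      by (auto simp: openings_def closings_def Fs rev_map [symmetric])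
    then show ?thesis using ep(1) [OF p] by (simp add: surround_def)
  qed
  have "map (map_endpoint F) (surround_word a u) = surround_word b (map (map_endpoint f) u)"
    if "set u \<subseteq> endpoints D" for u
    using that by (induction u) (auto simp: sur ep(3))
  moreover have "set u \<subseteq> endpoints D" if "u \<in> set D" for u
    using that by (auto simp: endpoints_def)
  ultimately have dec: "decorate b ?E = map (map (map_endpoint F)) (decorate a D)"
    by (simp add: decorate_def)
  have chords_dec: "x \<in> chords D \<or> (\<exists>p \<in> endpoints D. \<exists>j q. x = stack_shell p j q)"
    if "x \<in> chords (decorate a D)" for x
  proof -
    from that obtain y where y: "y \<in> endpoints (decorate a D)" "x = chord_of y"
      by (auto simp: chords_def)
    then show ?thesis unfolding endpoints_decorate by (auto simp: chords_def)
  qed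
  have injm: "inj_on (map_endpoint f) (endpoints D)"
    using f unfolding chords_def by (rule inj_on_map_endpoint)
  have "same_diagram (decorate a D) (decorate b ?E)"
    unfolding same_diagram_def
  proof (intro exI conjI ballI)
    show "inj_on F (chords (decorate a D))"
    proof (rule inj_onI)
      fix x y assume x: "x \<in> chords (decorate a D)" and y: "y \<in> chords (decorate a D)" and eq: "F x = F y"
      have main: "even (label z)" "F z = f z" "even (label (F z))" if "z \<in> chords D" for z
        using base_diagramD(4) [OF D that] lab [OF that] by (simp_all add: F_def)
      from chords_dec [OF x] chords_dec [OF y] show "x = y"
      proof (elim disjE bexE exE)
        assume "x \<in> chords D" "y \<in> chords D"
        then show ?thesis using eq main(2) inj_onD [OF f] by metis
      next
        fix p j q assume "y \<in> chords D" "x = stack_shell p j q"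
        then show ?thesis using eq main(3) Fs odd_stack_shell by metis
      next
        fix p j q assume "x \<in> chords D" "y = stack_shell p j q"
        then show ?thesis using eq main(3) Fs odd_stack_shell by metis
      next
        fix p p' j j' q q'
        assume "p \<in> endpoints D" "x = stack_shell p j q" "p' \<in> endpoints D" "y = stack_shell p' j' q'"
        then show ?thesis using eq inj_onD [OF injm] by (simp add: Fs)
      qed
    qed
    show "chord_sign (F c) = chord_sign c" if "c \<in> chords (decorate a D)" for c
      using chords_dec [OF that] sgn base_diagramD(4) [OF D]
      by (auto simp: Fs) (simp add: F_def)
    show "list_all2 (\<lambda>v w. \<exists>k. w = rotate k (map (map_endpoint F) v)) (decorate a D) (decorate b ?E)"
      unfolding dec list_all2_map2 by (rule list.rel_refl_strong) (rule exI [of _ 0], simp)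
  qed
  then show ?thesis
    using gauss_decorate [OF D] gauss_decorate [OF E] unfolding weighted_def a_def b_def
    by (intro move_equiv_same_diagram)
qed

section \<open>Moving endpoints\<close>

text \<open>
  From here on one circle is singled out by writing the diagram as \<open>P @ w # Q\<close>.
\<close>

lemma base_diagram_mset:
  assumes "mset v = mset w"
  shows "base_diagram (P @ v # Q) \<longleftrightarrow> base_diagram (P @ w # Q)"
proof -
  have "mset (concat (P @ v # Q)) = mset (concat (P @ w # Q))" using assms by simp
  moreover from this have "chords (P @ v # Q) = chords (P @ w # Q)"
    unfolding chords_def endpoints_def by (metis mset_eq_setD)
  ultimately show ?thesis
    using gauss_diagram_mset [of "P @ v # Q" "P @ w # Q" 2] by (simp add: base_diagram_def)
qed

lemma chords_mset: "mset v = mset w \<Longrightarrow> chords (P @ v # Q) = chords (P @ w # Q)"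
  unfolding chords_def endpoints_def by (auto dest: mset_eq_setD)

lemma base_diagram_word:
  assumes "base_diagram (P @ w # Q)"
  shows "distinct w" "x \<in> set w \<Longrightarrow> u \<in> set P \<or> u \<in> set Q \<Longrightarrow> x \<notin> set u"
    "x \<in> set w \<Longrightarrow> even (label (chord_of x))" "x \<in> set w \<Longrightarrow> chord_of x \<in> chords (P @ w # Q)"
  using assms by (auto simp: base_diagram_def gauss_diagram_def chords_def endpoints_def)

lemma weighted_rotate:
  assumes D: "base_diagram (P @ (x @ y) # Q)"
  shows "weighted w (P @ (x @ y) # Q) \<simeq> weighted w (P @ (y @ x) # Q)"
  by (rule weighted_rotation(2) [OF D])
    (auto intro!: list_all2_appendI simp: rotation_append list.rel_refl)

lemma weighted_swap:
  assumes D: "base_diagram (P @ (y @ p # q # z) # Q)" and ne: "chord_of p \<noteq> chord_of q"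
    and v: "\<And>c. v c = w c + (of_bool (c = chord_of p) - of_bool (c = chord_of q)) * endpoint_sign p * endpoint_sign q"
  shows "weighted w (P @ (y @ p # q # z) # Q) \<simeq> weighted v (P @ (y @ q # p # z) # Q)"
proof -
  have con: "consecutive (P @ (y @ p # q # z) # Q) [p, q]"
    using consecutive_infix [of y "[p, q]" z] by simp
  have id: "map (id(p := q, q := p)) u = u" if "u \<in> set P \<or> u \<in> set Q" for u
    using base_diagram_word(2) [OF D _ that, of p] base_diagram_word(2) [OF D _ that, of q]
    by (intro map_idI) auto
  have "map (map (id(p := q, q := p))) P = P" "map (map (id(p := q, q := p))) Q = Q"
    by (rule map_idI, rule id, simp)+
  moreover have "map (id(p := q, q := p)) y = y" "map (id(p := q, q := p)) z = z"
    using base_diagram_word(1) [OF D] by (auto intro!: map_idI)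
  ultimately have "exchange p q (P @ (y @ p # q # z) # Q) = P @ (y @ q # p # z) # Q"
    by (simp add: exchange_def)
  then show ?thesis
    using weighted_exchange [OF D con ne v] by simp
qed

definition chord_sum :: "chord endpoint list \<Rightarrow> chord \<Rightarrow> int" where
  "chord_sum r c = sign_sum (filter (\<lambda>q. chord_of q = c) r)"

lemma chord_sum_simps [simp]:
  "chord_sum [] c = 0" "chord_sum (q # r) c = (if chord_of q = c then endpoint_sign q else 0) + chord_sum r c"
  "chord_sum (r @ s) c = chord_sum r c + chord_sum s c"
  by (simp_all add: chord_sum_def)

lemma chord_sum_0: "c \<notin> chord_of ` set r \<Longrightarrow> chord_sum r c = 0"
  by (induction r) auto

lemma chord_sum_distinct:
  "distinct r \<Longrightarrow> chord_sum r c =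
    (if Ter c \<in> set r then chord_sign c else 0) - (if Ini c \<in> set r then chord_sign c else 0)"
proof (induction r)
  case (Cons q r)
  then show ?case by (cases q) auto
qed simp

text \<open>
  The change of the weight of \<open>c\<close> when \<open>x\<close> moves forward across the word \<open>r\<close>, which contains no
  endpoint of the chord of \<open>x\<close>. A chord with both endpoints in \<open>r\<close> is not affected.
\<close>

definition slide_shift :: "chord endpoint \<Rightarrow> chord endpoint list \<Rightarrow> chord \<Rightarrow> int" where
  "slide_shift x r c = (if c = chord_of x then endpoint_sign x * sign_sum r else 0) - endpoint_sign x * chord_sum r c"

lemma weighted_slide:
  assumes "base_diagram (P @ (y @ x # r @ z) # Q)" and "chord_of x \<notin> chord_of ` set r"
  shows "weighted w (P @ (y @ x # r @ z) # Q) \<simeq>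
    weighted (\<lambda>c. w c + slide_shift x r c) (P @ (y @ r @ x # z) # Q)"
  using assms
proof (induction r arbitrary: y w)
  case Nil
  have "(\<lambda>c. w c + slide_shift x [] c) = w" by (simp add: slide_shift_def fun_eq_iff)
  then show ?case by simp
next
  case (Cons q r)
  let ?v = "\<lambda>c. w c + (of_bool (c = chord_of x) - of_bool (c = chord_of q)) * endpoint_sign x * endpoint_sign q"
  have D: "base_diagram (P @ (y @ x # q # (r @ z)) # Q)" using Cons.prems by simp
  have "weighted w (P @ (y @ x # q # (r @ z)) # Q) \<simeq> weighted ?v (P @ (y @ q # x # (r @ z)) # Q)"
    using Cons.prems(2) by (intro weighted_swap [OF D]) auto
  also have "P @ (y @ q # x # (r @ z)) # Q = P @ ((y @ [q]) @ x # r @ z) # Q" by simp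
  also have "weighted ?v \<dots> \<simeq> weighted (\<lambda>c. ?v c + slide_shift x r c) (P @ ((y @ [q]) @ r @ x # z) # Q)"
  proof (rule Cons.IH)
    show "base_diagram (P @ ((y @ [q]) @ x # r @ z) # Q)"
      using Cons.prems(1) base_diagram_mset [of "y @ x # (q # r) @ z" "(y @ [q]) @ x # r @ z" P Q] by simp
  qed (use Cons.prems in auto)
  also have "(\<lambda>c. ?v c + slide_shift x r c) = (\<lambda>c. w c + slide_shift x (q # r) c)"
    using Cons.prems(2) by (auto simp: slide_shift_def fun_eq_iff algebra_simps)
  finally show ?case by simp
qed

lemma weighted_slide_back:
  assumes "base_diagram (P @ (y @ r @ x # z) # Q)" and "chord_of x \<notin> chord_of ` set r"
  shows "weighted w (P @ (y @ r @ x # z) # Q) \<simeq>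
    weighted (\<lambda>c. w c - slide_shift x r c) (P @ (y @ x # r @ z) # Q)"
proof -
  have "base_diagram (P @ (y @ x # r @ z) # Q)"
    using assms(1) base_diagram_mset [of "y @ x # r @ z" "y @ r @ x # z" P Q] by simp
  from weighted_slide [OF this assms(2), of "\<lambda>c. w c - slide_shift x r c"]
  show ?thesis by - (rule move_equiv_sym, simp)
qed

section \<open>Kinks\<close>

lemma fresh_chord:
  obtains d where "d \<notin> chords D" "even (label d)" "positive d \<longleftrightarrow> b"
proof -
  let ?l = "2 * Suc (\<Sum>c \<in> chords D. label c)"
  have "label c < ?l" if "c \<in> chords D" for c
    using member_le_sum [OF that, of label] by simp
  then have "Chord ?l b \<notin> chords D" by fastforce
  then show ?thesis using that [of "Chord ?l b"] by simp
qed

lemma chord_sign_positive: "positive c \<Longrightarrow> chord_sign c = 1" "\<not> positive c \<Longrightarrow> chord_sign c = -1"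
  by (simp_all add: chord_sign_def)

lemma base_diagram_insert:
  assumes D: "base_diagram (P @ (y @ z) # Q)" and d: "d \<notin> chords (P @ (y @ z) # Q)" "even (label d)"
    and pq: "{p, q} = {Ini d, Ter d}"
  shows "base_diagram (P @ (y @ p # q # z) # Q)"
proof -
  let ?D = "P @ (y @ z) # Q" and ?E = "P @ (y @ p # q # z) # Q"
  have e: "set (concat ?E) = insert (Ini d) (insert (Ter d) (set (concat ?D)))"
    using pq by auto
  have "Ini d \<notin> set (concat ?D)" "Ter d \<notin> set (concat ?D)"
    using d(1) in_chordsI [of d ?D] unfolding endpoints_def by blast+
  moreover have "p \<noteq> q" using pq by (auto simp: doubleton_eq_iff)
  moreover have "distinct (concat ?D)" using D by (simp add: base_diagram_def gauss_diagram_def)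
  ultimately have "distinct (concat ?E)" using pq by (auto simp: doubleton_eq_iff)
  moreover have "length ?E = 2" using D by (simp add: base_diagram_def gauss_diagram_def)
  moreover have c: "chords ?E = insert d (chords ?D)"
    unfolding chords_def endpoints_def e by simp
  have "\<forall>c \<in> chords ?D. Ini c \<in> set (concat ?D) \<and> Ter c \<in> set (concat ?D)"
    using D by (simp add: base_diagram_def gauss_diagram_def endpoints_def)
  then have "\<forall>c \<in> chords ?E. Ini c \<in> set (concat ?E) \<and> Ter c \<in> set (concat ?E)"
    unfolding c e by blast
  moreover have "\<forall>c \<in> chords ?E. even (label c)"
    using D d(2) unfolding c base_diagram_def by blast
  ultimately show ?thesis
    unfolding base_diagram_def gauss_diagram_def endpoints_def by blast
qed

lemma delete_self_chord:
  assumes E: "base_diagram (P @ w # Q)" and c: "Ini c \<in> set w" "Ter c \<in> set w"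
  shows "delete {c} (P @ w # Q) = P @ filter (\<lambda>x. chord_of x \<noteq> c) w # Q"
proof -
  have "filter (\<lambda>x. chord_of x \<noteq> c) u = u" if "u \<in> set P \<or> u \<in> set Q" for u
  proof -
    have "Ini c \<notin> set u" "Ter c \<notin> set u"
      using base_diagram_word(2) [OF E c(1) that] base_diagram_word(2) [OF E c(2) that] .
    then show ?thesis unfolding filter_id_conv by (metis chord_of_mem)
  qed
  then show ?thesis by (simp add: delete_def map_idI)
qed

text \<open>
  Read backwards, this inserts a kink anywhere.
\<close>

lemma weighted_kink:
  assumes E: "base_diagram (P @ (y @ p # q # z) # Q)" and pq: "{p, q} = {Ini d, Ter d}" and w: "w d = 0"
  shows "weighted w (P @ (y @ p # q # z) # Q) \<simeq> weighted w (P @ (y @ z) # Q)"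
    and "base_diagram (P @ (y @ z) # Q)" and "d \<notin> chords (P @ (y @ z) # Q)"
proof -
  let ?E = "P @ (y @ p # q # z) # Q"
  have "consecutive ?E [p, q]"
    using consecutive_infix [of y "[p, q]" z] by simp
  then have adj: "adjacent ?E (Ini d) (Ter d)"
    using pq by (auto simp: adjacent_def doubleton_eq_iff)
  have d: "Ini d \<in> set (y @ p # q # z)" "Ter d \<in> set (y @ p # q # z)" "chord_of p = d" "chord_of q = d"
    using pq by (auto simp: doubleton_eq_iff)
  have "filter (\<lambda>x. chord_of x \<noteq> d) u = u" if "p \<notin> set u" "q \<notin> set u" for u
  proof -
    have "Ini d \<notin> set u" "Ter d \<notin> set u" using that pq by (auto simp: doubleton_eq_iff)
    then show ?thesis unfolding filter_id_conv by (metis chord_of_mem)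
  qed
  then have del: "delete {d} ?E = P @ (y @ z) # Q"
    unfolding delete_self_chord [OF E d(1,2)] using d(3,4) base_diagram_word(1) [OF E] by simp
  then show "weighted w ?E \<simeq> weighted w (P @ (y @ z) # Q)"
    using weighted_R1 [OF E adj, where w = w] w by simp
  show "base_diagram (P @ (y @ z) # Q)"
    using base_diagram_delete [OF E, of "{d}"] del by simp
  show "d \<notin> chords (P @ (y @ z) # Q)"
    using chords_delete [OF E, of "{d}"] del by simp
qed

section \<open>Weights of nonself-chords\<close>

text \<open>
  By \<open>sign_sum_circle\<close> the second condition says that \<open>\<lambda> = 1\<close>.
\<close>

definition unit_diagram :: "diagram \<Rightarrow> bool" where
  "unit_diagram D \<longleftrightarrow> base_diagram D \<and> sign_sum (hd D) = -1"

text \<open>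
  A new kink \<open>s\<close> is placed in front of a negative endpoint \<open>p\<close>, and its initial endpoint is carried
  backwards around the circle until it has \<open>p\<close> between itself and its other endpoint. Since the remaining
  endpoints have total sign \<open>0\<close>, the weight of \<open>s\<close> is \<open>0\<close> again, and \<open>s\<close> has become a shell of \<open>p\<close>.
  On the way every chord with one endpoint on the circle, that is every nonself-chord, had its
  weight shifted; the shell extends this uniform rule to the chord of \<open>p\<close>.
\<close>

lemma weighted_shift_all:
  assumes D: "base_diagram [u, v]" and u: "sign_sum u = -1" and e: "e = 1 \<or> e = -1"
  shows "weighted w [u, v] \<simeq> weighted (\<lambda>c. w c - e * chord_sum u c) [u, v]"
proof -
  have "\<exists>p \<in> set u. endpoint_sign p = -1"
  proof (rule ccontr)
    assume "\<not> ?thesis"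
    then have "\<forall>p \<in> set u. endpoint_sign p = 1" using endpoint_sign_cases by blast
    then have "sign_sum u \<ge> 0" by (induction u) auto
    then show False using u by simp
  qed
  then obtain p x y where p: "endpoint_sign p = -1" and xy: "u = x @ p # y"
    by (metis split_list)
  define r where "r = y @ x"
  have rot: "weighted w' [u, v] \<simeq> weighted w' [p # r, v]" and Dr: "base_diagram [p # r, v]" for w'
    using weighted_rotate [of "[]" x "p # y" "[v]"] D base_diagram_mset [of "p # r" u "[]" "[v]"]
    by (simp_all add: xy r_def)
  have cu: "chord_sum u c = chord_sum (p # r) c" for c
    by (simp add: xy r_def)
  have sr: "sign_sum r = 0" using u p by (simp add: xy r_def)
  obtain s where s: "s \<notin> chords [p # r, v]" "even (label s)" "positive s \<longleftrightarrow> e = 1"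
    using fresh_chord [of "[p # r, v]" "e = 1"] by metis
  have ss: "chord_sign s = e" using s(3) e by (auto simp: chord_sign_def)
  let ?w0 = "w(s := 0)"
  have E: "base_diagram [Ini s # Ter s # p # r, v]"
    using base_diagram_insert [of "[]" "[]" "p # r" "[v]" s "Ini s" "Ter s"] Dr s by simp
  have F: "base_diagram [Ter s # p # r @ [Ini s], v]"
    using E base_diagram_mset [of "Ter s # p # r @ [Ini s]" "Ini s # Ter s # p # r" "[]" "[v]"] by simp
  have C: "base_diagram [Ter s # p # Ini s # r, v]"
    using E base_diagram_mset [of "Ter s # p # Ini s # r" "Ini s # Ter s # p # r" "[]" "[v]"] by simp
  have sn: "s \<notin> chord_of ` set r" "chord_of p \<noteq> s"
    using s(1) by (auto simp: chords_def endpoints_def)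
  have "weighted w [u, v] \<simeq> weighted w [p # r, v]" by (rule rot)
  also have "weighted w [p # r, v] = weighted ?w0 [p # r, v]"
    using s(1) by (intro weighted_cong) auto
  also have "\<dots> \<simeq> weighted ?w0 [Ini s # Ter s # p # r, v]"
    using weighted_kink(1) [of "[]" "[]" "Ini s" "Ter s" "p # r" "[v]" s ?w0] E
    by - (rule move_equiv_sym, simp)
  also have "\<dots> \<simeq> weighted ?w0 [Ter s # p # r @ [Ini s], v]"
    using weighted_rotate [of "[]" "[Ini s]" "Ter s # p # r" "[v]" ?w0] E by simp
  also have "\<dots> \<simeq> weighted (\<lambda>c. ?w0 c - slide_shift (Ini s) r c) [Ter s # p # Ini s # r, v]"
    using weighted_slide_back [of "[]" "[Ter s, p]" r "Ini s" "[]" "[v]" ?w0] F sn(1) by simp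
  also have "\<dots> \<simeq> weighted (\<lambda>c. w c - e * chord_sum u c) (delete {s} [Ter s # p # Ini s # r, v])"
  proof (rule weighted_shell [OF C])
    have "consecutive [Ter s # p # Ini s # r, v] [Ter s, p, Ini s]"
      using consecutive_infix [of "[]" "[Ter s, p, Ini s]" r] by simp
    then show "shell [Ter s # p # Ini s # r, v] s p"
      using p sn(2) by (auto simp: shell_def)
    show "?w0 s - slide_shift (Ini s) r s = 0"
      using sr chord_sum_0 [OF sn(1)] by (simp add: slide_shift_def)
    show "w c - e * chord_sum u c = ?w0 c - slide_shift (Ini s) r c + of_bool (c = chord_of p) * chord_sign s"
      if "c \<noteq> s" for c
      using that p ss by (simp add: cu slide_shift_def algebra_simps)
  qed
  also have "delete {s} [Ter s # p # Ini s # r, v] = [p # r, v]"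
  proof -
    have "chord_of x \<noteq> s" if "x \<in> set r \<or> x \<in> set v" for x
      using that s(1) by (auto simp: chords_def endpoints_def)
    then have "filter (\<lambda>x. chord_of x \<noteq> s) r = r" "filter (\<lambda>x. chord_of x \<noteq> s) v = v"
      by (auto simp: filter_id_conv)
    then show ?thesis using sn(2) by (simp add: delete_def)
  qed
  also have "weighted (\<lambda>c. w c - e * chord_sum u c) [p # r, v] \<simeq> weighted (\<lambda>c. w c - e * chord_sum u c) [u, v]"
    by (rule move_equiv_sym [OF rot])
  finally show ?thesis .
qed

text \<open>
  Carrying the endpoint \<open>p\<close> of a nonself-chord once around the circle shifts the weights of the others as in
  \<open>weighted_shift_all\<close>. Undoing this shift leaves a change by one unit of the weight of a single chord.
\<close>

lemma weighted_nonself_step: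
  assumes D: "base_diagram [u, v]" and u: "sign_sum u = -1"
    and p: "u = x @ p # y" "chord_of p \<notin> chord_of ` set (y @ x)"
  shows "weighted w [u, v] \<simeq> weighted (w(chord_of p := w (chord_of p) - endpoint_sign p)) [u, v]"
proof -
  define r where "r = y @ x"
  let ?g = "chord_of p"
  have rot: "weighted w' [u, v] \<simeq> weighted w' [p # r, v]"
    and rot': "weighted w' [u, v] \<simeq> weighted w' [r @ [p], v]"
    and Dr: "base_diagram [p # r, v]" for w'
    using weighted_rotate [of "[]" x "p # y" "[v]" w'] weighted_rotate [of "[]" "x @ [p]" "y" "[v]" w']
      weighted_rotate [of "[]" "p # y" "x" "[v]" w'] 
      D base_diagram_mset [of "p # r" u "[]" "[v]"] weighted_rotate [of "[]" "[p]" r "[v]" w']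
    by (auto simp: p(1) r_def intro: move_equiv_trans)
  let ?w1 = "\<lambda>c. w c + slide_shift p r c"
  have "weighted w [u, v] \<simeq> weighted w [p # r, v]" by (rule rot)
  also have "\<dots> \<simeq> weighted ?w1 [r @ [p], v]"
    using weighted_slide [of "[]" "[]" p r "[]" "[v]" w] Dr p(2) by (simp add: r_def)
  also have "\<dots> \<simeq> weighted ?w1 [u, v]" by (rule move_equiv_sym [OF rot'])
  also have "\<dots> \<simeq> weighted (\<lambda>c. ?w1 c - (- endpoint_sign p) * chord_sum u c) [u, v]"
    by (rule weighted_shift_all [OF D u]) (use endpoint_sign_cases [of p] in auto)
  also have "(\<lambda>c. ?w1 c - (- endpoint_sign p) * chord_sum u c) = w(?g := w ?g - endpoint_sign p)"
  proof
    fix c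
    have "sign_sum r = -1 - endpoint_sign p" using u by (simp add: p(1) r_def)
    moreover have "chord_sum u c = (if ?g = c then endpoint_sign p else 0) + chord_sum r c"
      by (simp add: p(1) r_def)
    moreover have "chord_sum r ?g = 0" using p(2) by (intro chord_sum_0) (simp add: r_def)
    ultimately show "?w1 c - (- endpoint_sign p) * chord_sum u c = (w(?g := w ?g - endpoint_sign p)) c"
      using endpoint_sign_cases [of p] by (auto simp: slide_shift_def)
  qed
  finally show ?thesis .
qed

lemma weighted_nonself:
  assumes D: "base_diagram [u, v]" and u: "sign_sum u = -1"
    and p: "p \<in> set u" "(Ini (chord_of p) \<in> set u) \<noteq> (Ter (chord_of p) \<in> set u)"
  shows "weighted w [u, v] \<simeq> weighted (w(chord_of p := k)) [u, v]"
proof -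
  let ?g = "chord_of p"
  obtain x y where xy: "u = x @ p # y" using p(1) by (meson split_list)
  have "q = p" if "q \<in> set u" "chord_of q = ?g" for q
  proof -
    have "q = Ini ?g \<or> q = Ter ?g" "p = Ini ?g \<or> p = Ter ?g"
      using chord_of_mem [of q] chord_of_mem [of p] that(2) by simp_all
    then show ?thesis using that(1) p by metis
  qed
  moreover have "p \<notin> set (y @ x)" using base_diagram_word(1) [of "[]" u "[v]"] D xy by auto
  ultimately have n: "?g \<notin> chord_of ` set (y @ x)" using xy by fastforce
  note step = weighted_nonself_step [OF D u xy n]
  have down: "weighted w [u, v] \<simeq> weighted (w(?g := w ?g - 1)) [u, v]" for w
  proof (cases "endpoint_sign p = 1")
    case True
    then show ?thesis using step [of w] by simp
  next
    case False
    then have "endpoint_sign p = -1" using endpoint_sign_cases [of p] by blast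
    then show ?thesis using step [of "w(?g := w ?g - 1)"] by - (rule move_equiv_sym, simp)
  qed
  have n: "weighted w [u, v] \<simeq> weighted (w(?g := w ?g - int n)) [u, v]" for n w
  proof (induction n)
    case (Suc n)
    have "(w(?g := w ?g - int n))(?g := (w(?g := w ?g - int n)) ?g - 1) = w(?g := w ?g - int (Suc n))"
      by (simp add: fun_eq_iff)
    then show ?case
      using move_equiv_trans [OF Suc.IH down [of "w(?g := w ?g - int n)"]] by (simp only:)
  qed simp
  show ?thesis
  proof (cases "k \<le> w ?g")
    case True
    then show ?thesis using n [of w "nat (w ?g - k)"] by simp
  next
    case False
    then show ?thesis using n [of "w(?g := k)" "nat (k - w ?g)"] by - (rule move_equiv_sym, simp)
  qed
qed

text \<open>
  Consequently only the weights of the self-chords matter.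
\<close>

lemma weighted_nonself_free:
  assumes D: "unit_diagram D"
    and eq: "\<And>c. c \<in> chords D \<Longrightarrow> (Ini c \<in> set (hd D)) = (Ter c \<in> set (hd D)) \<Longrightarrow> w c = w' c"
  shows "weighted w D \<simeq> weighted w' D"
proof -
  have B: "base_diagram D" and uu: "sign_sum (hd D) = -1" using D by (simp_all add: unit_diagram_def)
  then have "length D = 2" by (simp add: base_diagram_def gauss_diagram_def)
  then obtain u v where uv: "D = [u, v]"
    by (metis (no_types) Suc_length_conv length_0_conv numeral_2_eq_2)
  have "weighted w D \<simeq> weighted (\<lambda>c. if c \<in> S then w' c else w c) D" if "finite S" "S \<subseteq> chords D" for S
    using that
  proof (induction S)
    case (insert c S)
    let ?w = "\<lambda>c. if c \<in> S then w' c else w c"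
    have "weighted ?w D \<simeq> weighted (?w(c := w' c)) D"
    proof (cases "(Ini c \<in> set u) = (Ter c \<in> set u)")
      case True
      then have "?w(c := w' c) = ?w" using eq [of c] insert.prems uv by (auto simp: fun_eq_iff)
      then show ?thesis by simp
    next
      case False
      then obtain p where p: "p \<in> set u" "chord_of p = c" by (metis endpoint.sel)
      show ?thesis
        using weighted_nonself [of u v p ?w "w' c"] B uu p False unfolding uv by simp
    qed
    moreover have "?w(c := w' c) = (\<lambda>b. if b \<in> insert c S then w' b else w b)"
      by (auto simp: fun_eq_iff)
    ultimately show ?case using insert by (metis insert_subset move_equiv_trans)
  qed simp
  from this [of "chords D"] have "weighted w D \<simeq> weighted (\<lambda>c. if c \<in> chords D then w' c else w c) D" by simp
  also have "\<dots> = weighted w' D" by (rule weighted_cong) simp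
  finally show ?thesis .
qed

section \<open>Isolated self-chords\<close>

lemma self_both:
  assumes D: "base_diagram D" and b: "b \<in> chords D" "(Ini b \<in> set (hd D)) = (Ter b \<in> set (hd D))" and w: "w \<in> set D"
  shows "(Ini b \<in> set w) = (Ter b \<in> set w)"
proof -
  have "length D = 2" using D by (simp add: base_diagram_def gauss_diagram_def)
  then obtain u v where uv: "D = [u, v]"
    by (metis (no_types) Suc_length_conv length_0_conv numeral_2_eq_2)
  have "Ini b \<in> set u \<union> set v" "Ter b \<in> set u \<union> set v" "set u \<inter> set v = {}"
    using base_diagramD(5,6) [OF D b(1)] D
    by (auto simp: uv endpoints_def base_diagram_def gauss_diagram_def)
  then show ?thesis using b(2) w uv by auto
qed

text \<open>
  A chord whose endpoints lie in the order of a shell around \<open>p\<close>, but with nothing in between, and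
  whose weight is minus its sign: one exchange with the endpoint \<open>p\<close> of a new kink makes it a shell
  around \<open>p\<close> of weight \<open>0\<close>. The weight that the kink receives from the exchange is cancelled by the
  removal of this shell, so the kink can be removed as well.
\<close>

lemma weighted_remove_shell_block:
  assumes D: "base_diagram (P @ (shell_opening p c # shell_closing p c # r) # Q)"
    and w: "w c = - chord_sign c"
    and p: "p \<in> {Ini d, Ter d}" "d \<notin> chords (P @ (shell_opening p c # shell_closing p c # r) # Q)"
      "even (label d)" "positive d"
  shows "weighted w (P @ (shell_opening p c # shell_closing p c # r) # Q) \<simeq> weighted w (P @ r # Q)"
proof -
  let ?o = "shell_opening p c" and ?k = "shell_closing p c"
  define q where "q = (if p = Ini d then Ter d else Ini d)"
  have pq: "{p, q} = {Ini d, Ter d}" "p \<noteq> q" "chord_of p = d" "chord_of q = d"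
    using p(1) by (auto simp: q_def)
  have cd: "c \<noteq> d" using p(2) by (auto simp: chords_def endpoints_def)
  let ?w0 = "w(d := 0)" and ?w1 = "w(d := - chord_sign c, c := 0)" and ?w2 = "w(d := 0, c := 0)"
  have E: "base_diagram (P @ ([?o, ?k] @ p # q # r) # Q)"
    using D p pq(1) by (intro base_diagram_insert) auto
  have F: "base_diagram (P @ (?o # p # ?k # q # r) # Q)"
    using E base_diagram_mset [of "?o # p # ?k # q # r" "[?o, ?k] @ p # q # r" P Q] by simp
  have "weighted w (P @ (?o # ?k # r) # Q) = weighted ?w0 (P @ (?o # ?k # r) # Q)"
    using p(2) by (intro weighted_cong) auto
  also have "\<dots> \<simeq> weighted ?w0 (P @ ([?o, ?k] @ p # q # r) # Q)"
    using weighted_kink(1) [OF E pq(1), of ?w0] by - (rule move_equiv_sym, simp)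
  also have "P @ ([?o, ?k] @ p # q # r) # Q = P @ ([?o] @ ?k # p # q # r) # Q" by simp
  also have "weighted ?w0 \<dots> \<simeq> weighted ?w1 (P @ ([?o] @ p # ?k # q # r) # Q)"
    using E cd pq(3) w
    by (intro weighted_swap) (auto simp: shell_sign algebra_simps)
  also have "P @ ([?o] @ p # ?k # q # r) # Q = P @ (?o # p # ?k # q # r) # Q" by simp
  also have "weighted ?w1 \<dots> \<simeq> weighted ?w2 (delete {c} (P @ (?o # p # ?k # q # r) # Q))"
  proof (rule weighted_shell [OF F])
    show "shell (P @ (?o # p # ?k # q # r) # Q) c p"
      using cd pq(3) consecutive_infix [of "[]" "[?o, p, ?k]" "q # r" "P @ (?o # p # ?k # q # r) # Q"]
      by (auto simp: shell_iff)
  qed (use cd pq(3) in auto)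
  also have "delete {c} (P @ (?o # p # ?k # q # r) # Q) = P @ ([] @ p # q # r) # Q"
  proof -
    have "{Ini c, Ter c} = {?o, ?k}"
      by (auto simp: shell_opening_def shell_closing_def)
    then have "Ini c \<in> set (?o # p # ?k # q # r)" "Ter c \<in> set (?o # p # ?k # q # r)"
      by (auto simp: doubleton_eq_iff)
    note del = delete_self_chord [OF F this]
    have "filter (\<lambda>x. chord_of x \<noteq> c) r = r"
      using base_diagram_word(1) [OF D] by (auto simp: filter_id_conv chord_of_iff_shell [of _ c p])
    then show ?thesis unfolding del using cd pq by simp
  qed
  also have "weighted ?w2 \<dots> \<simeq> weighted ?w2 (P @ r # Q)"
  proof -
    have "delete {c} (P @ (?o # p # ?k # q # r) # Q) = P @ ([] @ p # q # r) # Q" by fact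
    then have "base_diagram (P @ ([] @ p # q # r) # Q)"
      using base_diagram_delete [OF F, of "{c}"] by simp
    from weighted_kink(1) [OF this pq(1), of ?w2] show ?thesis using cd by simp
  qed
  also have "\<dots> = weighted w (P @ r # Q)"
  proof (rule weighted_cong)
    fix b assume b: "b \<in> chords (P @ r # Q)"
    have "d \<noteq> b" using b p(2) by (auto simp: chords_def endpoints_def)
    moreover have "{?o, ?k} = {Ini c, Ter c}"
      by (auto simp: shell_opening_def shell_closing_def)
    then have "b \<noteq> c"
      using b weighted_kink(3) [of P "[]" ?o ?k r Q c "w(c := 0)"] D by auto
    ultimately show "?w2 b = w b" by simp
  qed
  finally show ?thesis .
qed

text \<open>
  The initial endpoint of an isolated chord is carried around the circle. The chord meets total
  sign \<open>T\<close>, the other self-chords do not change, and the weights of nonself-chords are irrelevant.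
\<close>

lemma weighted_flip:
  assumes D: "unit_diagram (P @ (Ini c # Ter c # r) # Q)"
  shows "weighted w (P @ (Ini c # Ter c # r) # Q) \<simeq>
    weighted (w(c := w c + chord_sign c * sign_sum r)) (P @ (Ter c # Ini c # r) # Q)"
proof -
  have B: "base_diagram (P @ (Ini c # Ter c # r) # Q)" using D by (simp add: unit_diagram_def)
  have E: "base_diagram (P @ ([Ter c] @ Ini c # r @ []) # Q)"
    using B base_diagram_mset [of "[Ter c] @ Ini c # r @ []" "Ini c # Ter c # r" P Q] by simp
  let ?v = "w(c := w c + chord_sign c * sign_sum r)"
  have dist: "distinct (Ini c # Ter c # r)" using base_diagram_word(1) [OF B] .
  have cr: "c \<notin> chord_of ` set r"
    using dist by (auto simp: image_iff) (metis chord_of_mem)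
  have "weighted ?v (P @ (Ter c # Ini c # r) # Q) \<simeq>
    weighted (\<lambda>b. ?v b + slide_shift (Ini c) r b) (P @ ([Ter c] @ r @ Ini c # []) # Q)"
    using weighted_slide [OF E, of ?v] cr by simp
  also have "\<dots> \<simeq> weighted (\<lambda>b. ?v b + slide_shift (Ini c) r b) (P @ (Ini c # Ter c # r) # Q)"
    using weighted_rotate [of P "Ter c # r" "[Ini c]" Q]
      B base_diagram_mset [of "Ter c # r @ [Ini c]" "Ini c # Ter c # r" P Q] by simp
  also have "\<dots> \<simeq> weighted w (P @ (Ini c # Ter c # r) # Q)"
  proof (rule weighted_nonself_free [OF D])
    fix b assume b: "b \<in> chords (P @ (Ini c # Ter c # r) # Q)"
      "(Ini b \<in> set (hd (P @ (Ini c # Ter c # r) # Q))) = (Ter b \<in> set (hd (P @ (Ini c # Ter c # r) # Q)))"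
    show "?v b + slide_shift (Ini c) r b = w b"
    proof (cases "b = c")
      case True
      then show ?thesis using cr by (simp add: slide_shift_def chord_sum_0)
    next
      case False
      have "(Ini b \<in> set (Ini c # Ter c # r)) = (Ter b \<in> set (Ini c # Ter c # r))"
        by (rule self_both [OF B b]) simp
      then have "(Ini b \<in> set r) = (Ter b \<in> set r)" using False by simp
      then have "chord_sum r b = 0" using dist by (simp add: chord_sum_distinct)
      then show ?thesis using False by (simp add: slide_shift_def)
    qed
  qed
  finally show ?thesis by (rule move_equiv_sym)
qed

text \<open>
  Index \<open>0\<close> means weight \<open>0\<close>, a kink; index \<open>1\<close> means weight minus the sign, a shell of a positive
  endpoint. Indices \<open>T\<close> and \<open>T + 1\<close> become these two cases, the latter with a negative endpoint, after a flip.
\<close>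

lemma weighted_remove_block:
  assumes D: "unit_diagram (P @ (Ini c # Ter c # r) # Q)"
    and w: "- chord_sign c * w c \<in> {0, 1, sign_sum r, sign_sum r + 1}"
  shows "weighted w (P @ (Ini c # Ter c # r) # Q) \<simeq> weighted w (P @ r # Q)"
proof -
  let ?D = "P @ (Ini c # Ter c # r) # Q" and ?E = "P @ (Ter c # Ini c # r) # Q"
  let ?v = "w(c := w c + chord_sign c * sign_sum r)"
  have B: "base_diagram ?D" using D by (simp add: unit_diagram_def)
  have E: "base_diagram ?E" using B base_diagram_mset [of "Ter c # Ini c # r" "Ini c # Ter c # r" P Q] by simp
  have ch: "chords ?E = chords ?D" by (rule chords_mset) simp
  obtain d where d: "d \<notin> chords ?D" "even (label d)" "positive d"
    using fresh_chord [of ?D True] by metis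
  have cD: "c \<notin> chords (P @ r # Q)"
    using weighted_kink(3) [of P "[]" "Ini c" "Ter c" r Q c "w(c := 0)"] B by simp
  have v: "weighted ?v (P @ r # Q) = weighted w (P @ r # Q)"
    using cD by (intro weighted_cong) auto
  consider "w c = 0" | "w c = - chord_sign c" | "?v c = 0" | "?v c = - chord_sign c"
    using w chord_sign_cases [of c] by auto
  then show ?thesis
  proof cases
    case 1
    then show ?thesis
      using weighted_kink(1) [of P "[]" "Ini c" "Ter c" r Q c w] B by simp
  next
    case 2
    then show ?thesis
      using weighted_remove_shell_block [of P "Ter d" c r Q w d] d B
      by (simp add: shell_opening_def shell_closing_def chord_sign_positive)
  next
    case 3
    have "weighted ?v ?E \<simeq> weighted ?v (P @ r # Q)"
      using weighted_kink(1) [of P "[]" "Ter c" "Ini c" r Q c ?v] E 3 by (simp add: insert_commute)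
    with weighted_flip [OF D, of w] show ?thesis unfolding v by (rule move_equiv_trans)
  next
    case 4
    have "weighted ?v ?E \<simeq> weighted ?v (P @ r # Q)"
      using weighted_remove_shell_block [of P "Ini d" c r Q ?v d] d E 4 ch
      by (simp add: shell_opening_def shell_closing_def chord_sign_positive)
    with weighted_flip [OF D, of w] show ?thesis unfolding v by (rule move_equiv_trans)
  qed
qed

lemma delete_parallel:
  assumes D: "base_diagram (P @ ([Ini c, Ini d] @ y @ [Ter c, Ter d] @ z) # Q)" and cd: "c \<noteq> d"
  shows "delete {c, d} (P @ ([Ini c, Ini d] @ y @ [Ter c, Ter d] @ z) # Q) = P @ (y @ z) # Q"
proof -
  let ?u = "[Ini c, Ini d] @ y @ [Ter c, Ter d] @ z"
  have id: "filter (\<lambda>x. chord_of x \<noteq> b) u = u" if "Ini b \<notin> set u" "Ter b \<notin> set u" for b u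
    unfolding filter_id_conv using that by (metis chord_of_mem)
  have dist: "distinct ?u" using D by (rule base_diagram_word(1))
  have 1: "delete {c} (P @ ?u # Q) = P @ ([Ini d] @ y @ [Ter d] @ z) # Q"
    by (subst delete_self_chord [OF D]) (use dist cd in \<open>simp_all add: id\<close>)
  then have "base_diagram (P @ ([Ini d] @ y @ [Ter d] @ z) # Q)"
    using base_diagram_delete [OF D, of "{c}"] by simp
  note this' = delete_self_chord [OF this, of d]
  have "delete {d} (P @ ([Ini d] @ y @ [Ter d] @ z) # Q) = P @ (y @ z) # Q"
    by (subst this') (use dist in \<open>simp_all add: id\<close>)
  then show ?thesis
    using 1 delete_delete [of "{d}" "{c}" "P @ ?u # Q"] by (simp add: insert_commute)
qed

text \<open>
  The two chords together form a band of total sign \<open>0\<close>. When the band passes an endpoint, the chord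
  of this endpoint is not affected, but the weights of the band change by one, in opposite directions.
  So the weights are brought to \<open>0\<close> by letting the band enclose endpoints of new kinks, and then R2
  removes the band.
\<close>

lemma weighted_cancel_parallel:
  assumes "base_diagram (P @ ([Ini c, Ini d] @ y @ [Ter c, Ter d] @ z) # Q)"
    and "chord_sign d = - chord_sign c" "w d = - w c"
  shows "weighted w (P @ ([Ini c, Ini d] @ y @ [Ter c, Ter d] @ z) # Q) \<simeq> weighted w (P @ (y @ z) # Q)"
  using assms
proof (induction "nat \<bar>w c\<bar>" arbitrary: w y z)
  case 0
  let ?u = "[Ini c, Ini d] @ y @ [Ter c, Ter d] @ z"
  let ?D = "P @ ?u # Q"
  note D = \<open>base_diagram ?D\<close>
  have w: "w c = 0" "w d = 0" using 0 by auto
  have "consecutive ?D [Ini c, Ini d]" "consecutive ?D [Ter c, Ter d]"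
    using consecutive_infix [of "[]" "[Ini c, Ini d]" "y @ [Ter c, Ter d] @ z" ?D]
      consecutive_infix [of "[Ini c, Ini d] @ y" "[Ter c, Ter d]" z ?D] by simp_all
  then have adj: "adjacent ?D (Ini c) (Ini d)" "adjacent ?D (Ter c) (Ter d)"
    by (simp_all add: adjacent_def)
  have "c \<noteq> d" using 0(3) chord_sign_cases [of c] by auto
  then show ?case
    using weighted_R2 [OF D adj, where w = w] delete_parallel [OF D] 0 w by simp
next
  case (Suc n)
  let ?u = "[Ini c, Ini d] @ y @ [Ter c, Ter d] @ z"
  let ?D = "P @ ?u # Q"
  note D = \<open>base_diagram ?D\<close> and sd = \<open>chord_sign d = - chord_sign c\<close> and wd = \<open>w d = - w c\<close>
  have cd: "c \<noteq> d" using sd chord_sign_cases [of c] by auto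
  obtain e where e: "e \<notin> chords ?D" "even (label e)" "positive e"
    using fresh_chord [of ?D True] by metis
  have ecd: "e \<noteq> c" "e \<noteq> d" using e(1) by (auto simp: chords_def endpoints_def)
  (* The kink is oriented such that its endpoint enclosed by the band has the sign s that brings the
     weight of c closer to 0. *)
  define s where "s = - sgn (w c) * chord_sign c"
  have wc: "w c \<noteq> 0" using Suc.hyps(2) by auto
  then have s: "s = 1 \<or> s = -1"
    using chord_sign_cases [of c] by (auto simp: s_def sgn_if)
  define p where "p = (if s = 1 then Ter e else Ini e)"
  define q where "q = (if s = 1 then Ini e else Ter e)"
  have pq: "{p, q} = {Ini e, Ter e}" "chord_of p = e" "chord_of q = e" "endpoint_sign p = s"
    using s e(3) by (auto simp: p_def q_def chord_sign_positive)
  let ?y = "[Ini c, Ini d] @ y"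
  let ?w0 = "w(e := 0)"
  let ?w1 = "?w0(d := w d - chord_sign c * s, e := chord_sign c * s)"
  let ?w2 = "?w0(d := w d - chord_sign c * s, c := w c + chord_sign c * s)"
  have E: "base_diagram (P @ ((?y @ [Ter c, Ter d]) @ p # q # z) # Q)"
    using D e pq(1) by (intro base_diagram_insert) auto
  have F: "base_diagram (P @ ((?y @ [Ter c]) @ p # Ter d # q # z) # Q)"
    using E base_diagram_mset [of "(?y @ [Ter c]) @ p # Ter d # q # z" "(?y @ [Ter c, Ter d]) @ p # q # z" P Q]
    by simp
  have H: "base_diagram (P @ ([Ini c, Ini d] @ (y @ [p]) @ [Ter c, Ter d] @ (q # z)) # Q)"
    using E base_diagram_mset [of "[Ini c, Ini d] @ (y @ [p]) @ [Ter c, Ter d] @ (q # z)"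
        "(?y @ [Ter c, Ter d]) @ p # q # z" P Q] by simp
  have "weighted w ?D = weighted ?w0 ?D"
    using e(1) by (intro weighted_cong) auto
  also have "?D = P @ ((?y @ [Ter c, Ter d]) @ z) # Q" by simp
  also have "weighted ?w0 \<dots> \<simeq> weighted ?w0 (P @ ((?y @ [Ter c, Ter d]) @ p # q # z) # Q)"
    using weighted_kink(1) [OF E pq(1), of ?w0] by - (rule move_equiv_sym, simp)
  also have "P @ ((?y @ [Ter c, Ter d]) @ p # q # z) # Q = P @ ((?y @ [Ter c]) @ Ter d # p # q # z) # Q"
    by simp
  also have "weighted ?w0 \<dots> \<simeq> weighted ?w1 (P @ ((?y @ [Ter c]) @ p # Ter d # q # z) # Q)"
    using E ecd pq(2,4) sd cd by (intro weighted_swap) auto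
  also have "P @ ((?y @ [Ter c]) @ p # Ter d # q # z) # Q = P @ (?y @ Ter c # p # Ter d # q # z) # Q" by simp
  also have "weighted ?w1 \<dots> \<simeq> weighted ?w2 (P @ (?y @ p # Ter c # Ter d # q # z) # Q)"
    using F ecd pq(2,4) sd cd by (intro weighted_swap) auto
  also have "P @ (?y @ p # Ter c # Ter d # q # z) # Q =
    P @ ([Ini c, Ini d] @ (y @ [p]) @ [Ter c, Ter d] @ (q # z)) # Q" by simp
  also have "weighted ?w2 \<dots> \<simeq> weighted ?w2 (P @ ((y @ [p]) @ (q # z)) # Q)"
  proof (rule Suc.hyps(1) [OF _ H sd])
    have "chord_sign c * s = - sgn (w c)"
      by (simp add: s_def mult.left_commute)
    then have "\<bar>w c + chord_sign c * s\<bar> = \<bar>w c\<bar> - 1"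
      using wc by (auto simp: sgn_if)
    then show "n = nat \<bar>?w2 c\<bar>"
      using Suc.hyps(2) cd by simp
    show "?w2 d = - ?w2 c" using cd wd by simp
  qed
  also have "P @ ((y @ [p]) @ (q # z)) # Q = P @ (y @ p # q # z) # Q" by simp
  also have "weighted ?w2 \<dots> \<simeq> weighted ?w2 (P @ (y @ z) # Q)"
  proof -
    have G: "base_diagram (P @ (y @ p # q # z) # Q)"
      using base_diagram_delete [OF H, of "{c, d}"] delete_parallel [OF H cd] by simp
    show ?thesis
      by (rule weighted_kink(1) [OF G pq(1)]) (use ecd in auto)
  qed
  also have "\<dots> = weighted w (P @ (y @ z) # Q)"
  proof (rule weighted_cong)
    fix b assume b: "b \<in> chords (P @ (y @ z) # Q)"
    have "b \<noteq> e" using b e(1) by (auto simp: chords_def endpoints_def)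
    moreover have "b \<noteq> c" "b \<noteq> d"
      using b chords_delete [OF D, of "{c, d}"] delete_parallel [OF D cd] by auto
    ultimately show "?w2 b = w b" by simp
  qed
  finally show ?case by simp
qed

section \<open>Normal form\<close>

definition blocks :: "chord list \<Rightarrow> chord endpoint list" where
  "blocks cs = concat (map (\<lambda>c. [Ini c, Ter c]) cs)"

lemma blocks_simps [simp]:
  "blocks [] = []" "blocks (c # cs) = Ini c # Ter c # blocks cs" "blocks (cs @ ds) = blocks cs @ blocks ds"
  by (simp_all add: blocks_def)

lemma set_blocks: "set (blocks cs) = Ini ` set cs \<union> Ter ` set cs"
  by (induction cs) auto

lemma mset_blocks: "mset (blocks cs) = image_mset Ini (mset cs) + image_mset Ter (mset cs)"
  by (induction cs) auto

lemma sign_sum_blocks [simp]: "sign_sum (blocks cs) = 0"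
  and chord_sum_blocks [simp]: "chord_sum (blocks cs) c = 0"
  by (induction cs) auto

text \<open>
  The isolated self-chords \<open>cs\<close> and \<open>ds\<close> of the two circles, the nonself-chords \<open>as\<close> from the first to
  the second circle, and the nonself-chords \<open>bs\<close> in the other direction.
\<close>

definition nf :: "chord list \<Rightarrow> chord list \<Rightarrow> chord list \<Rightarrow> chord list \<Rightarrow> diagram" where
  "nf cs ds as bs = [blocks cs @ map Ini as @ map Ter bs, blocks ds @ map Ter as @ map Ini bs]"

lemma mset_nf: "mset (concat (nf cs ds as bs)) =
    image_mset Ini (mset (cs @ ds @ as @ bs)) + image_mset Ter (mset (cs @ ds @ as @ bs))"
  by (simp add: nf_def mset_blocks)

lemma endpoints_nf: "endpoints (nf cs ds as bs) =
    Ini ` set (cs @ ds @ as @ bs) \<union> Ter ` set (cs @ ds @ as @ bs)"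
  by (auto simp: nf_def endpoints_def set_blocks)

lemma chords_nf: "chords (nf cs ds as bs) = set (cs @ ds @ as @ bs)"
  unfolding chords_def endpoints_nf by (auto simp: image_Un image_image)

lemma distinct_nf: "distinct (concat (nf cs ds as bs)) \<longleftrightarrow> distinct (cs @ ds @ as @ bs)"
proof -
  let ?l = "cs @ ds @ as @ bs"
  have "mset (concat (nf cs ds as bs)) = mset (map Ini ?l @ map Ter ?l)"
    unfolding mset_nf mset_append mset_map ..
  then have "distinct (concat (nf cs ds as bs)) \<longleftrightarrow> distinct (map Ini ?l @ map Ter ?l)"
    by (rule mset_eq_imp_distinct_iff)
  also have "\<dots> \<longleftrightarrow> distinct ?l"
    unfolding distinct_append [of "map Ini ?l"] distinct_map by (auto simp: inj_on_def)
  finally show ?thesis .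
qed

lemma base_diagram_nf: "base_diagram (nf cs ds as bs) \<longleftrightarrow>
    distinct (cs @ ds @ as @ bs) \<and> (\<forall>c \<in> set (cs @ ds @ as @ bs). even (label c))"
proof -
  have "length (nf cs ds as bs) = 2" by (simp add: nf_def)
  moreover have "\<forall>c \<in> chords (nf cs ds as bs). Ini c \<in> endpoints (nf cs ds as bs) \<and> Ter c \<in> endpoints (nf cs ds as bs)"
    unfolding chords_nf endpoints_nf by blast
  ultimately show ?thesis
    unfolding base_diagram_def gauss_diagram_def distinct_nf unfolding chords_nf by blast
qed

abbreviation sign_total :: "chord list \<Rightarrow> int" where
  "sign_total cs \<equiv> (\<Sum>c\<leftarrow>cs. chord_sign c)"

lemma sign_sum_map [simp]:
  "sign_sum (map Ini cs) = - sign_total cs" "sign_sum (map Ter cs) = sign_total cs"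
  by (induction cs) auto

lemma unit_diagram_nf: "unit_diagram (nf cs ds as bs) \<longleftrightarrow>
    base_diagram (nf cs ds as bs) \<and> sign_total as - sign_total bs = 1"
  by (auto simp: unit_diagram_def nf_def)

text \<open>
  Both endpoints of a self-chord are moved to the base point. They never meet on the way: if the terminal
  endpoint comes first, the initial one goes the other way round and arrives in front of it.
\<close>

lemma weighted_extract:
  assumes D: "base_diagram (P @ (b @ r) # Q)" and c: "Ini c \<in> set r" "Ter c \<in> set r"
  obtains r' v where "weighted w (P @ (b @ r) # Q) \<simeq> weighted v (P @ (Ini c # Ter c # b @ r') # Q)"
    "base_diagram (P @ (Ini c # Ter c # b @ r') # Q)" "length r = Suc (Suc (length r'))"
proof -
  have dist: "distinct (b @ r)" using D by (rule base_diagram_word(1))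
  obtain x r1 where r1: "r = x @ Ini c # r1" using c(1) by (meson split_list)
  have no: "c \<notin> chord_of ` set u" if "Ini c \<notin> set u" "Ter c \<notin> set u" for u
    using that by (metis chord_of_mem imageE)
  consider "Ter c \<in> set r1" | "Ter c \<in> set x" using c(2) r1 by auto
  then show ?thesis
  proof cases
    case 1
    then obtain y z where y: "r1 = y @ Ter c # z" by (meson split_list)
    have r: "b @ r = b @ x @ Ini c # y @ Ter c # z" by (simp add: r1 y)
    have n: "c \<notin> chord_of ` set (b @ x)" "c \<notin> chord_of ` set (b @ x @ y)"
      by (rule no; use dist r in auto)+
    have E: "base_diagram (P @ ([] @ (b @ x) @ Ini c # y @ Ter c # z) # Q)"
      using D r by simp
    have F: "base_diagram (P @ ([Ini c] @ (b @ x @ y) @ Ter c # z) # Q)"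
      using E base_diagram_mset [of "[Ini c] @ (b @ x @ y) @ Ter c # z" "[] @ (b @ x) @ Ini c # y @ Ter c # z" P Q]
      by simp
    have "weighted w (P @ ([] @ (b @ x) @ Ini c # y @ Ter c # z) # Q) \<simeq>
      weighted (\<lambda>e. w e - slide_shift (Ini c) (b @ x) e) (P @ ([] @ Ini c # (b @ x) @ y @ Ter c # z) # Q)"
      using n by (intro weighted_slide_back E) simp
    also have "P @ ([] @ Ini c # (b @ x) @ y @ Ter c # z) # Q = P @ ([Ini c] @ (b @ x @ y) @ Ter c # z) # Q"
      by simp
    also obtain v where "weighted (\<lambda>e. w e - slide_shift (Ini c) (b @ x) e) \<dots> \<simeq>
      weighted v (P @ ([Ini c] @ Ter c # (b @ x @ y) @ z) # Q)"
      using weighted_slide_back [OF F, of "\<lambda>e. w e - slide_shift (Ini c) (b @ x) e"] n by auto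
    finally have "weighted w (P @ (b @ r) # Q) \<simeq> weighted v (P @ (Ini c # Ter c # b @ (x @ y @ z)) # Q)"
      using r by simp
    moreover have "base_diagram (P @ (Ini c # Ter c # b @ (x @ y @ z)) # Q)"
      using E base_diagram_mset [of "Ini c # Ter c # b @ (x @ y @ z)" "[] @ (b @ x) @ Ini c # y @ Ter c # z" P Q]
      by simp
    ultimately show ?thesis using that [of v "x @ y @ z"] r1 y by simp
  next
    case 2
    then obtain x1 y where y: "x = x1 @ Ter c # y" by (meson split_list)
    have r: "b @ r = b @ x1 @ Ter c # y @ Ini c # r1" by (simp add: r1 y)
    have n: "c \<notin> chord_of ` set (b @ x1)" "c \<notin> chord_of ` set r1"
      by (rule no; use dist r in auto)+
    have E: "base_diagram (P @ ([] @ (b @ x1) @ Ter c # y @ Ini c # r1) # Q)"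
      using D r by simp
    have F: "base_diagram (P @ ((Ter c # b @ x1 @ y) @ Ini c # r1 @ []) # Q)"
      using E base_diagram_mset [of "(Ter c # b @ x1 @ y) @ Ini c # r1 @ []" "[] @ (b @ x1) @ Ter c # y @ Ini c # r1" P Q]
      by simp
    have H: "base_diagram (P @ ((Ter c # b @ x1 @ y @ r1) @ [Ini c]) # Q)"
      using E base_diagram_mset [of "(Ter c # b @ x1 @ y @ r1) @ [Ini c]" "[] @ (b @ x1) @ Ter c # y @ Ini c # r1" P Q]
      by simp
    have "weighted w (P @ ([] @ (b @ x1) @ Ter c # y @ Ini c # r1) # Q) \<simeq>
      weighted (\<lambda>e. w e - slide_shift (Ter c) (b @ x1) e) (P @ ([] @ Ter c # (b @ x1) @ y @ Ini c # r1) # Q)"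
      using n by (intro weighted_slide_back E) simp
    also have "P @ ([] @ Ter c # (b @ x1) @ y @ Ini c # r1) # Q = P @ ((Ter c # b @ x1 @ y) @ Ini c # r1 @ []) # Q"
      by simp
    also obtain v where "weighted (\<lambda>e. w e - slide_shift (Ter c) (b @ x1) e) \<dots> \<simeq>
      weighted v (P @ ((Ter c # b @ x1 @ y) @ r1 @ Ini c # []) # Q)"
      using weighted_slide [OF F, of "\<lambda>e. w e - slide_shift (Ter c) (b @ x1) e"] n by auto
    also have "P @ ((Ter c # b @ x1 @ y) @ r1 @ Ini c # []) # Q = P @ ((Ter c # b @ x1 @ y @ r1) @ [Ini c]) # Q"
      by simp
    also have "weighted v \<dots> \<simeq> weighted v (P @ ([Ini c] @ (Ter c # b @ x1 @ y @ r1)) # Q)"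
      by (rule weighted_rotate [OF H])
    finally have "weighted w (P @ (b @ r) # Q) \<simeq> weighted v (P @ (Ini c # Ter c # b @ (x1 @ y @ r1)) # Q)"
      using r by simp
    moreover have "base_diagram (P @ (Ini c # Ter c # b @ (x1 @ y @ r1)) # Q)"
      using E base_diagram_mset [of "Ini c # Ter c # b @ (x1 @ y @ r1)" "[] @ (b @ x1) @ Ter c # y @ Ini c # r1" P Q]
      by simp
    ultimately show ?thesis using that [of v "x1 @ y @ r1"] r1 y by simp
  qed
qed

lemma weighted_isolate:
  assumes "base_diagram (P @ (blocks cs @ r) # Q)"
  shows "\<exists>cs' r' v. weighted w (P @ (blocks cs @ r) # Q) \<simeq> weighted v (P @ (blocks cs' @ r') # Q) \<and>
    base_diagram (P @ (blocks cs' @ r') # Q) \<and> (\<forall>c. \<not> (Ini c \<in> set r' \<and> Ter c \<in> set r'))"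
  using assms
proof (induction "length r" arbitrary: cs r w rule: less_induct)
  case less
  show ?case
  proof (cases "\<exists>c. Ini c \<in> set r \<and> Ter c \<in> set r")
    case True
    then obtain c where c: "Ini c \<in> set r" "Ter c \<in> set r" by blast
    obtain r' v where 1: "weighted w (P @ (blocks cs @ r) # Q) \<simeq> weighted v (P @ (Ini c # Ter c # blocks cs @ r') # Q)"
      and 2: "base_diagram (P @ (Ini c # Ter c # blocks cs @ r') # Q)" and 3: "length r = Suc (Suc (length r'))"
      using weighted_extract [OF less.prems c] by metis
    from less.hyps [of r' "c # cs" v] 2 3 obtain cs' r'' v'
      where 4: "weighted v (P @ (Ini c # Ter c # blocks cs @ r') # Q) \<simeq> weighted v' (P @ (blocks cs' @ r'') # Q)"
      and 5: "base_diagram (P @ (blocks cs' @ r'') # Q)" "\<forall>c. \<not> (Ini c \<in> set r'' \<and> Ter c \<in> set r'')"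
      by auto
    from move_equiv_trans [OF 1 4] 5 show ?thesis by blast
  next
    case False
    then show ?thesis using less.prems by (metis equivclp_refl)
  qed
qed

text \<open>
  This is for the nonself-chords, whose weights are irrelevant; hence it suffices to control the weights of
  the chords without endpoints in \<open>r\<close>.
\<close>

lemma weighted_permute:
  assumes "base_diagram (P @ (b @ r) # Q)" and "mset r = mset r'"
    and "\<And>c. \<not> (Ini c \<in> set r \<and> Ter c \<in> set r)"
  shows "\<exists>v. weighted w (P @ (b @ r) # Q) \<simeq> weighted v (P @ (b @ r') # Q) \<and>
    (\<forall>c. c \<notin> chord_of ` set r \<longrightarrow> v c = w c)"
  using assms
proof (induction r' arbitrary: b r w)
  case Nil
  then show ?case by (intro exI [of _ w]) simp
next
  case (Cons h t)
  have "h \<in> set r" using Cons.prems(2) by (metis list.set_intros(1) mset_eq_setD)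
  then obtain x y where r: "r = x @ h # y" by (meson split_list)
  have dist: "distinct (b @ r)" using Cons.prems(1) by (rule base_diagram_word(1))
  have n: "chord_of h \<notin> chord_of ` set x"
  proof
    assume "chord_of h \<in> chord_of ` set x"
    then obtain q where q: "q \<in> set x" "chord_of q = chord_of h" by (metis imageE)
    have "q \<noteq> h" using q dist r by auto
    then have "Ini (chord_of h) \<in> {q, h} \<and> Ter (chord_of h) \<in> {q, h}"
      using q(2) by (cases q; cases h) auto
    moreover have "{q, h} \<subseteq> set r" using q(1) r by auto
    ultimately have "Ini (chord_of h) \<in> set r \<and> Ter (chord_of h) \<in> set r" by blast
    then show False using Cons.prems(3) by blast
  qed
  have D: "base_diagram (P @ (b @ x @ h # y) # Q)" using Cons.prems(1) r by simp
  let ?v = "\<lambda>c. w c - slide_shift h x c"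
  have 1: "weighted w (P @ (b @ r) # Q) \<simeq> weighted ?v (P @ ((b @ [h]) @ x @ y) # Q)"
    using weighted_slide_back [OF D n, of w] r by simp
  have E: "base_diagram (P @ ((b @ [h]) @ x @ y) # Q)"
    using D base_diagram_mset [of "(b @ [h]) @ x @ y" "b @ x @ h # y" P Q] by simp
  from Cons.IH [OF E, of ?v] obtain v where
    2: "weighted ?v (P @ ((b @ [h]) @ x @ y) # Q) \<simeq> weighted v (P @ ((b @ [h]) @ t) # Q)"
    and 3: "\<forall>c. c \<notin> chord_of ` set (x @ y) \<longrightarrow> v c = ?v c"
    using Cons.prems(2,3) r by auto
  have "v c = w c" if "c \<notin> chord_of ` set r" for c
  proof -
    have "c \<notin> chord_of ` set (x @ y)" "c \<notin> chord_of ` set x" "c \<noteq> chord_of h"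
      using that r by auto
    then show ?thesis using 3 chord_sum_0 [of c x] by (simp add: slide_shift_def)
  qed
  moreover have "weighted w (P @ (b @ r) # Q) \<simeq> weighted v (P @ (b @ h # t) # Q)"
    using move_equiv_trans [OF 1 2] by simp
  ultimately show ?case by blast
qed

lemma weighted_nf_exists:
  assumes D: "base_diagram D"
  shows "\<exists>cs ds as bs v. weighted w D \<simeq> weighted v (nf cs ds as bs) \<and> base_diagram (nf cs ds as bs)"
proof -
  have "length D = 2" using D by (simp add: base_diagram_def gauss_diagram_def)
  then obtain u0 u1 where uv: "D = [u0, u1]"
    by (metis (no_types) Suc_length_conv length_0_conv numeral_2_eq_2)
  from weighted_isolate [of "[]" "[]" u0 "[u1]" w] D uv obtain cs r1 v1 where
    1: "weighted w D \<simeq> weighted v1 [blocks cs @ r1, u1]" "base_diagram [blocks cs @ r1, u1]"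
    and r1: "\<And>c. \<not> (Ini c \<in> set r1 \<and> Ter c \<in> set r1)" by auto
  from weighted_isolate [of "[blocks cs @ r1]" "[]" u1 "[]" v1] 1(2) obtain ds r2 v2 where
    2: "weighted v1 [blocks cs @ r1, u1] \<simeq> weighted v2 [blocks cs @ r1, blocks ds @ r2]"
    and E: "base_diagram [blocks cs @ r1, blocks ds @ r2]"
    and r2: "\<And>c. \<not> (Ini c \<in> set r2 \<and> Ter c \<in> set r2)" by auto
  define as where "as = map chord_of (filter (\<lambda>p. p = Ini (chord_of p)) r1)"
  define bs where "bs = map chord_of (filter (\<lambda>p. p = Ter (chord_of p)) r1)"
  have m1: "mset r1 = mset (map Ini as @ map Ter bs)"
    unfolding as_def bs_def
  proof (induction r1)
    case (Cons p r)
    then show ?case by (cases p) auto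
  qed simp
  have dist: "distinct (blocks cs @ r1 @ blocks ds @ r2)"
    using E by (auto simp: base_diagram_def gauss_diagram_def)
  have mate: "Ini c \<in> set (blocks cs @ r1 @ blocks ds @ r2)" "Ter c \<in> set (blocks cs @ r1 @ blocks ds @ r2)"
    if "Ini c \<in> set (blocks cs @ r1 @ blocks ds @ r2) \<or> Ter c \<in> set (blocks cs @ r1 @ blocks ds @ r2)" for c
  proof -
    have "c \<in> chords [blocks cs @ r1, blocks ds @ r2]"
      using that by (auto intro: in_chordsI simp: endpoints_def)
    from base_diagramD(5,6) [OF E this]
    show "Ini c \<in> set (blocks cs @ r1 @ blocks ds @ r2)" "Ter c \<in> set (blocks cs @ r1 @ blocks ds @ r2)"
      by (simp_all add: endpoints_def)
  qed
  have swap: "Ini c \<in> set r1 \<longleftrightarrow> Ter c \<in> set r2" "Ter c \<in> set r1 \<longleftrightarrow> Ini c \<in> set r2" for c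
  proof -
    have "set (blocks cs @ blocks ds) \<inter> (set r1 \<union> set r2) = {}" "set r1 \<inter> set r2 = {}"
      using dist unfolding distinct_append set_append by blast+
    then show "Ini c \<in> set r1 \<longleftrightarrow> Ter c \<in> set r2" "Ter c \<in> set r1 \<longleftrightarrow> Ini c \<in> set r2"
      using mate [of c] r1 [of c] r2 [of c] unfolding set_append set_blocks by blast+
  qed
  have "set r1 = Ini ` set as \<union> Ter ` set bs"
    using mset_eq_setD [OF m1] by simp
  then have setas: "set as = {c. Ini c \<in> set r1}" and setbs: "set bs = {c. Ter c \<in> set r1}"
    by auto
  have set2: "set r2 = set (map Ter as @ map Ini bs)"
  proof -
    have "Ini c \<in> set r2 \<longleftrightarrow> Ini c \<in> set (map Ter as @ map Ini bs)"
      "Ter c \<in> set r2 \<longleftrightarrow> Ter c \<in> set (map Ter as @ map Ini bs)" for c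
      using swap [of c] unfolding setas setbs set_append set_map by blast+
    then have "p \<in> set r2 \<longleftrightarrow> p \<in> set (map Ter as @ map Ini bs)" for p
      by (cases p) (simp_all only:)
    then show ?thesis by blast
  qed
  have "distinct (map Ini as @ map Ter bs)"
    using dist mset_eq_imp_distinct_iff [OF m1] by simp
  then have "distinct (map Ter as @ map Ini bs)"
    by (auto simp: distinct_map inj_on_def)
  then have m2: "mset r2 = mset (map Ter as @ map Ini bs)"
    using set_eq_iff_mset_eq_distinct [of r2 "map Ter as @ map Ini bs"] dist set2
    unfolding distinct_append by blast
  from weighted_permute [of "[]" "blocks cs" r1 "[blocks ds @ r2]" _ v2, OF _ m1 r1] E obtain v3 where
    3: "weighted v2 [blocks cs @ r1, blocks ds @ r2] \<simeq>
      weighted v3 [blocks cs @ map Ini as @ map Ter bs, blocks ds @ r2]" by auto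
  have F: "base_diagram [blocks cs @ map Ini as @ map Ter bs, blocks ds @ r2]"
    using E m1 base_diagram_mset [of "blocks cs @ map Ini as @ map Ter bs" "blocks cs @ r1" "[]" "[blocks ds @ r2]"]
    by simp
  from weighted_permute [of "[blocks cs @ map Ini as @ map Ter bs]" "blocks ds" r2 "[]" _ v3, OF _ m2 r2] F
  obtain v4 where 4: "weighted v3 [blocks cs @ map Ini as @ map Ter bs, blocks ds @ r2] \<simeq>
      weighted v4 (nf cs ds as bs)" by (auto simp: nf_def)
  have "base_diagram (nf cs ds as bs)"
    using F m2 base_diagram_mset [of "blocks ds @ map Ter as @ map Ini bs" "blocks ds @ r2"
        "[blocks cs @ map Ini as @ map Ter bs]" "[]"] by (simp add: nf_def)
  then show ?thesis
    using 1(1) 2 3 4 by (meson move_equiv_trans)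
qed

lemma weighted_permute_blocks:
  assumes "base_diagram (P @ (b @ blocks cs @ r) # Q)" and "mset cs = mset cs'"
  shows "weighted w (P @ (b @ blocks cs @ r) # Q) \<simeq> weighted w (P @ (b @ blocks cs' @ r) # Q)"
  using assms
proof (induction cs' arbitrary: b cs)
  case (Cons h t)
  have "h \<in> set cs" using Cons.prems(2) by (metis list.set_intros(1) mset_eq_setD)
  then obtain x y where cs: "cs = x @ h # y" by (meson split_list)
  have D: "base_diagram (P @ (b @ blocks x @ Ini h # Ter h # blocks y @ r) # Q)"
    using Cons.prems(1) cs by simp
  have n: "h \<notin> chord_of ` set (blocks x)"
    using base_diagram_word(1) [OF D] by (auto simp: set_blocks)
  have E: "base_diagram (P @ ((b @ [Ini h]) @ blocks x @ Ter h # blocks y @ r) # Q)"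
    using D base_diagram_mset [of "(b @ [Ini h]) @ blocks x @ Ter h # blocks y @ r"
        "b @ blocks x @ Ini h # Ter h # blocks y @ r" P Q] by simp
  have F: "base_diagram (P @ ((b @ [Ini h, Ter h]) @ blocks (x @ y) @ r) # Q)"
    using D base_diagram_mset [of "(b @ [Ini h, Ter h]) @ blocks (x @ y) @ r"
        "b @ blocks x @ Ini h # Ter h # blocks y @ r" P Q] by simp
  have s: "slide_shift p (blocks x) c = 0" for p c by (simp add: slide_shift_def)
  have "weighted w (P @ (b @ blocks cs @ r) # Q) \<simeq>
    weighted w (P @ ((b @ [Ini h]) @ blocks x @ Ter h # blocks y @ r) # Q)"
    using weighted_slide_back [OF D, of w] n by (simp add: s cs)
  also have "\<dots> \<simeq> weighted w (P @ ((b @ [Ini h, Ter h]) @ blocks (x @ y) @ r) # Q)"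
    using weighted_slide_back [OF E, of w] n by (simp add: s)
  also have "\<dots> \<simeq> weighted w (P @ ((b @ [Ini h, Ter h]) @ blocks t @ r) # Q)"
    using Cons.prems(2) cs by (intro Cons.IH [OF F]) simp
  finally show ?case by simp
qed auto

text \<open>
  Isolated self-chords pass each other without changing weights, and the weights that change when
  nonself-chords are permuted are irrelevant.
\<close>

lemma nf_permute:
  assumes D: "unit_diagram (nf cs ds as bs)"
    and m: "mset cs = mset cs'" "mset ds = mset ds'" "mset as = mset as'" "mset bs = mset bs'"
  shows "weighted w (nf cs ds as bs) \<simeq> weighted w (nf cs' ds' as' bs')" "unit_diagram (nf cs' ds' as' bs')"
proof -
  have B: "base_diagram (nf cs ds as bs)" and t: "sign_total as - sign_total bs = 1"
    using D by (simp_all add: unit_diagram_nf)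
  have st: "sign_total as = sign_total as'" "sign_total bs = sign_total bs'"
    using m(3,4) by (metis mset_map sum_mset_sum_list)+
  have ba: "base_diagram (nf cs1 ds1 as1 bs1)"
    if "mset cs1 = mset cs" "mset ds1 = mset ds" "mset as1 = mset as" "mset bs1 = mset bs" for cs1 ds1 as1 bs1
  proof -
    have "mset (cs1 @ ds1 @ as1 @ bs1) = mset (cs @ ds @ as @ bs)" using that by simp
    then show ?thesis
      using B mset_eq_imp_distinct_iff mset_eq_setD unfolding base_diagram_nf by metis
  qed
  show U: "unit_diagram (nf cs' ds' as' bs')"
    using ba [of cs' ds' as' bs'] m st t by (simp add: unit_diagram_nf)
  have dist: "distinct (cs @ ds @ as @ bs)" using B by (simp add: base_diagram_nf)
  have 1: "weighted w (nf cs ds as bs) \<simeq> weighted w (nf cs' ds as bs)"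
    using weighted_permute_blocks [of "[]" "[]" cs "map Ini as @ map Ter bs" "[blocks ds @ map Ter as @ map Ini bs]" cs' w]
      B m(1) by (simp add: nf_def)
  have B1: "base_diagram (nf cs' ds as bs)" using ba m by simp
  have 2: "weighted w (nf cs' ds as bs) \<simeq> weighted w (nf cs' ds' as bs)"
    using weighted_permute_blocks [of "[blocks cs' @ map Ini as @ map Ter bs]" "[]" ds "map Ter as @ map Ini bs" "[]" ds' w]
      B1 m(2) by (simp add: nf_def)
  have B2: "base_diagram (nf cs' ds' as bs)" using ba m by simp
  have "\<exists>v. weighted w ([] @ (blocks cs' @ (map Ini as @ map Ter bs)) # [blocks ds' @ map Ter as @ map Ini bs]) \<simeq>
    weighted v ([] @ (blocks cs' @ (map Ini as' @ map Ter bs')) # [blocks ds' @ map Ter as @ map Ini bs]) \<and>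
    (\<forall>c. c \<notin> chord_of ` set (map Ini as @ map Ter bs) \<longrightarrow> v c = w c)"
    using B2 m(3,4) dist by (intro weighted_permute) (auto simp: nf_def)
  then obtain v where 3: "weighted w (nf cs' ds' as bs) \<simeq>
      weighted v [blocks cs' @ map Ini as' @ map Ter bs', blocks ds' @ map Ter as @ map Ini bs]"
    and v: "\<forall>c. c \<notin> set as \<union> set bs \<longrightarrow> v c = w c" by (auto simp: nf_def image_Un image_image)
  have B3: "base_diagram [blocks cs' @ map Ini as' @ map Ter bs', blocks ds' @ map Ter as @ map Ini bs]"
    using B2 m base_diagram_mset [of "blocks cs' @ map Ini as' @ map Ter bs'" "blocks cs' @ map Ini as @ map Ter bs"
        "[]" "[blocks ds' @ map Ter as @ map Ini bs]"] by (simp add: nf_def)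
  have "\<exists>v'. weighted v ([blocks cs' @ map Ini as' @ map Ter bs'] @ (blocks ds' @ (map Ter as @ map Ini bs)) # []) \<simeq>
    weighted v' ([blocks cs' @ map Ini as' @ map Ter bs'] @ (blocks ds' @ (map Ter as' @ map Ini bs')) # []) \<and>
    (\<forall>c. c \<notin> chord_of ` set (map Ter as @ map Ini bs) \<longrightarrow> v' c = v c)"
    using B3 m(3,4) dist by (intro weighted_permute) auto
  then obtain v' where 4: "weighted v [blocks cs' @ map Ini as' @ map Ter bs', blocks ds' @ map Ter as @ map Ini bs] \<simeq>
      weighted v' (nf cs' ds' as' bs')"
    and v': "\<forall>c. c \<notin> set as \<union> set bs \<longrightarrow> v' c = v c" by (auto simp: nf_def image_Un image_image)
  have "weighted v' (nf cs' ds' as' bs') \<simeq> weighted w (nf cs' ds' as' bs')"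
  proof (rule weighted_nonself_free [OF U])
    fix c assume c: "(Ini c \<in> set (hd (nf cs' ds' as' bs'))) = (Ter c \<in> set (hd (nf cs' ds' as' bs')))"
    have d': "distinct (cs' @ ds' @ as' @ bs')" using U by (simp add: unit_diagram_nf base_diagram_nf)
    have "c \<notin> set as' \<union> set bs'"
      using c d' by (auto simp: nf_def set_blocks)
    then show "v' c = w c" using v v' m(3,4) by (metis mset_eq_setD)
  qed
  then show "weighted w (nf cs ds as bs) \<simeq> weighted w (nf cs' ds' as' bs')"
    using 1 2 3 4 by (meson move_equiv_trans)
qed

section \<open>Reduced normal forms\<close>

lemma nf_remove_first:
  assumes D: "unit_diagram (nf (c # cs) ds as bs)" and w: "- chord_sign c * w c \<in> {0, 1, -1}"
  shows "weighted w (nf (c # cs) ds as bs) \<simeq> weighted w (nf cs ds as bs)"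
proof -
  let ?r = "blocks cs @ map Ini as @ map Ter bs"
  have "sign_sum ?r = -1" using D by (simp add: unit_diagram_nf)
  then have "- chord_sign c * w c \<in> {0, 1, sign_sum ?r, sign_sum ?r + 1}"
    using w by auto
  with weighted_remove_block [of "[]" c ?r "[blocks ds @ map Ter as @ map Ini bs]" w] D show ?thesis
    by (simp only: nf_def blocks_simps append.simps)
qed

lemma nf_remove_second:
  assumes D: "unit_diagram (nf cs (c # ds) as bs)" and w: "- chord_sign c * w c \<in> {0, 1, 2}"
  shows "weighted w (nf cs (c # ds) as bs) \<simeq> weighted w (nf cs ds as bs)"
proof -
  let ?r = "blocks ds @ map Ter as @ map Ini bs"
  have "sign_sum ?r = 1" using D by (simp add: unit_diagram_nf)
  then have "- chord_sign c * w c \<in> {0, 1, sign_sum ?r, sign_sum ?r + 1}"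
    using w by auto
  with weighted_remove_block [of "[blocks cs @ map Ini as @ map Ter bs]" c ?r "[]" w] D show ?thesis
    by (simp only: nf_def blocks_simps append.simps)
qed

lemma weighted_cancel_isolated:
  assumes D: "base_diagram (P @ (Ini c # Ter c # Ini d # Ter d # r) # Q)"
    and s: "chord_sign d = - chord_sign c" and w: "w d = - w c"
  shows "weighted w (P @ (Ini c # Ter c # Ini d # Ter d # r) # Q) \<simeq>
    weighted (w(c := w c + 1, d := w d - 1)) (P @ r # Q)"
proof -
  let ?v = "w(c := w c + 1, d := w d - 1)"
  have cd: "c \<noteq> d" using s chord_sign_cases [of c] by auto
  have "weighted w (P @ ([Ini c] @ Ter c # Ini d # (Ter d # r)) # Q) \<simeq>
    weighted ?v (P @ ([Ini c] @ Ini d # Ter c # (Ter d # r)) # Q)"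
    using D cd s by (intro weighted_swap) auto
  also have "\<dots> \<simeq> weighted ?v (P @ r # Q)"
    using weighted_cancel_parallel [of P c d "[]" r Q ?v] cd s w D
      base_diagram_mset [of "Ini c # Ini d # Ter c # Ter d # r" "Ini c # Ter c # Ini d # Ter d # r" P Q] by simp
  finally show ?thesis by simp
qed

lemma nf_cancel_first:
  assumes D: "base_diagram (nf (c # d # cs) ds as bs)"
    and s: "chord_sign d = - chord_sign c" and w: "w d = - w c"
  shows "weighted w (nf (c # d # cs) ds as bs) \<simeq> weighted w (nf cs ds as bs)"
proof -
  have "weighted w (nf (c # d # cs) ds as bs) \<simeq> weighted (w(c := w c + 1, d := w d - 1)) (nf cs ds as bs)"
    using weighted_cancel_isolated [of "[]" c d "blocks cs @ map Ini as @ map Ter bs"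
        "[blocks ds @ map Ter as @ map Ini bs]" w] D s w by (simp add: nf_def)
  also have "\<dots> = weighted w (nf cs ds as bs)"
    by (rule weighted_cong) (use D in \<open>auto simp: chords_nf base_diagram_nf\<close>)
  finally show ?thesis .
qed

lemma nf_cancel_second:
  assumes D: "base_diagram (nf cs (c # d # ds) as bs)"
    and s: "chord_sign d = - chord_sign c" and w: "w d = - w c"
  shows "weighted w (nf cs (c # d # ds) as bs) \<simeq> weighted w (nf cs ds as bs)"
proof -
  have "weighted w (nf cs (c # d # ds) as bs) \<simeq> weighted (w(c := w c + 1, d := w d - 1)) (nf cs ds as bs)"
    using weighted_cancel_isolated [of "[blocks cs @ map Ini as @ map Ter bs]" c d "blocks ds @ map Ter as @ map Ini bs"
        "[]" w] D s w by (simp add: nf_def)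
  also have "\<dots> = weighted w (nf cs ds as bs)"
    by (rule weighted_cong) (use D in \<open>auto simp: chords_nf base_diagram_nf\<close>)
  finally show ?thesis .
qed

lemma delete_nf: "delete A (nf cs ds as bs) =
    nf (filter (\<lambda>c. c \<notin> A) cs) (filter (\<lambda>c. c \<notin> A) ds) (filter (\<lambda>c. c \<notin> A) as) (filter (\<lambda>c. c \<notin> A) bs)"
proof -
  have "filter (\<lambda>p. chord_of p \<notin> A) (blocks cs) = blocks (filter (\<lambda>c. c \<notin> A) cs)" for cs
    by (induction cs) auto
  moreover have "filter (\<lambda>p. chord_of p \<notin> A) (map Ini cs) = map Ini (filter (\<lambda>c. c \<notin> A) cs)"
    "filter (\<lambda>p. chord_of p \<notin> A) (map Ter cs) = map Ter (filter (\<lambda>c. c \<notin> A) cs)" for cs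
    by (induction cs) auto
  ultimately show ?thesis by (simp add: delete_def nf_def)
qed

lemma nf_self:
  assumes "base_diagram (nf cs ds as bs)"
    and "(Ini c \<in> set (hd (nf cs ds as bs))) = (Ter c \<in> set (hd (nf cs ds as bs)))"
  shows "c \<notin> set as \<union> set bs"
proof -
  have "distinct (cs @ ds @ as @ bs)" using assms(1) by (simp add: base_diagram_nf)
  then show ?thesis using assms(2) by (auto simp: nf_def set_blocks)
qed

text \<open>
  Once their weights have been set to \<open>0\<close>, the two chords are as required for R2.
\<close>

lemma nf_cancel_nonself:
  assumes D: "unit_diagram (nf cs ds as bs)"
    and a: "as = a # a' # as' \<and> bs = bs' \<or> bs = a # a' # bs' \<and> as = as'"
    and s: "chord_sign a' = - chord_sign a"
  shows "weighted w (nf cs ds as bs) \<simeq> weighted w (nf cs ds as' bs')"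
proof -
  let ?D = "nf cs ds as bs"
  let ?v = "w(a := 0, a' := 0)"
  have B: "base_diagram ?D" using D by (simp add: unit_diagram_nf)
  have ne: "a \<noteq> a'" using s chord_sign_cases [of a] by auto
  have "weighted w ?D \<simeq> weighted ?v ?D"
  proof (rule weighted_nonself_free [OF D])
    fix c assume "(Ini c \<in> set (hd ?D)) = (Ter c \<in> set (hd ?D))"
    then have "c \<notin> set as \<union> set bs" by (rule nf_self [OF B])
    then show "w c = ?v c" using a by auto
  qed
  also have "\<dots> \<simeq> weighted ?v (delete {a, a'} ?D)"
  proof (rule weighted_R2 [OF B])
    have "consecutive ?D [Ini a, Ini a'] \<and> consecutive ?D [Ter a, Ter a']"
      using a
    proof
      assume "as = a # a' # as' \<and> bs = bs'"
      then show ?thesis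
        using consecutive_infix [of "blocks cs" "[Ini a, Ini a']" "map Ini as' @ map Ter bs" ?D]
          consecutive_infix [of "blocks ds" "[Ter a, Ter a']" "map Ter as' @ map Ini bs" ?D]
        by (simp add: nf_def)
    next
      assume "bs = a # a' # bs' \<and> as = as'"
      then show ?thesis
        using consecutive_infix [of "blocks cs @ map Ini as" "[Ter a, Ter a']" "map Ter bs'" ?D]
          consecutive_infix [of "blocks ds @ map Ter as" "[Ini a, Ini a']" "map Ini bs'" ?D]
        by (simp add: nf_def)
    qed
    then show "adjacent ?D (Ini a) (Ini a')" "adjacent ?D (Ter a) (Ter a')"
      by (simp_all add: adjacent_def)
  qed (use s in auto)
  also have "delete {a, a'} ?D = nf cs ds as' bs'"
  proof -
    have d: "distinct (cs @ ds @ as @ bs)" using B by (simp add: base_diagram_nf)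
    have "filter (\<lambda>c. c \<notin> {a, a'}) cs = cs" "filter (\<lambda>c. c \<notin> {a, a'}) ds = ds"
      "filter (\<lambda>c. c \<notin> {a, a'}) as = as'" "filter (\<lambda>c. c \<notin> {a, a'}) bs = bs'"
      using a d by (auto simp: filter_id_conv)
    then show ?thesis by (simp only: delete_nf)
  qed
  also have "weighted ?v (nf cs ds as' bs') = weighted w (nf cs ds as' bs')"
    using a B by (intro weighted_cong) (auto simp: chords_nf base_diagram_nf)
  finally show ?thesis .
qed

text \<open>
  For isolated self-chords: opposite signs and equal indices.
\<close>

definition opposite :: "(chord \<Rightarrow> int) \<Rightarrow> chord \<Rightarrow> chord \<Rightarrow> bool" where
  "opposite w c d \<longleftrightarrow> chord_sign d = - chord_sign c \<and> w d = - w c"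

definition reduced :: "(chord \<Rightarrow> int) \<Rightarrow> chord list \<Rightarrow> chord list \<Rightarrow> chord list \<Rightarrow> chord list \<Rightarrow> bool" where
  "reduced w cs ds as bs \<longleftrightarrow>
    (\<forall>c \<in> set cs. - chord_sign c * w c \<notin> {0, 1, -1}) \<and>
    (\<forall>c \<in> set ds. - chord_sign c * w c \<notin> {0, 1, 2}) \<and>
    (\<forall>c \<in> set cs. \<forall>d \<in> set cs. \<not> opposite w c d) \<and> (\<forall>c \<in> set ds. \<forall>d \<in> set ds. \<not> opposite w c d) \<and>
    (\<forall>a \<in> set as. \<forall>b \<in> set as. chord_sign b \<noteq> - chord_sign a) \<and>
    (\<forall>a \<in> set bs. \<forall>b \<in> set bs. chord_sign b \<noteq> - chord_sign a)"

lemma mset_remove1: "c \<in> set cs \<Longrightarrow> mset cs = mset (c # remove1 c cs)"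
  by simp

lemma mset_remove2:
  "c \<in> set cs \<Longrightarrow> d \<in> set cs \<Longrightarrow> c \<noteq> d \<Longrightarrow> mset cs = mset (c # d # remove1 d (remove1 c cs))"
  using mset_remove1 [of c cs] mset_remove1 [of d "remove1 c cs"] by (metis in_set_remove1 mset.simps(2))

lemma nf_reduce:
  assumes "unit_diagram (nf cs ds as bs)"
  shows "\<exists>cs' ds' as' bs'. weighted w (nf cs ds as bs) \<simeq> weighted w (nf cs' ds' as' bs') \<and>
    unit_diagram (nf cs' ds' as' bs') \<and> reduced w cs' ds' as' bs'"
  using assms
proof (induction "length (cs @ ds @ as @ bs)" arbitrary: cs ds as bs rule: less_induct)
  case less
  note D = less.prems
  have smaller: ?case
    if "mset cs = mset cs1" "mset ds = mset ds1" "mset as = mset as1" "mset bs = mset bs1"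
      and "unit_diagram (nf cs1 ds1 as1 bs1) \<Longrightarrow>
        weighted w (nf cs1 ds1 as1 bs1) \<simeq> weighted w (nf cs2 ds2 as2 bs2) \<and> unit_diagram (nf cs2 ds2 as2 bs2)"
      and "length (cs2 @ ds2 @ as2 @ bs2) < length (cs1 @ ds1 @ as1 @ bs1)" for cs1 ds1 as1 bs1 cs2 ds2 as2 bs2
  proof -
    have "length (cs1 @ ds1 @ as1 @ bs1) = length (cs @ ds @ as @ bs)"
      using that(1-4) by (metis length_append size_mset)
    moreover note nf_permute(1) [OF D that(1-4), of w]
    moreover note that(5) [OF nf_permute(2) [OF D that(1-4)]]
    ultimately show ?thesis
      using less.hyps [of cs2 ds2 as2 bs2] that(6) by (metis move_equiv_trans)
  qed
  have unit: "unit_diagram (nf cs2 ds2 as2 bs2)"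
    if "unit_diagram (nf cs1 ds1 as1 bs1)" "distinct (cs1 @ ds1 @ as1 @ bs1) \<Longrightarrow> distinct (cs2 @ ds2 @ as2 @ bs2)"
      "set (cs2 @ ds2 @ as2 @ bs2) \<subseteq> set (cs1 @ ds1 @ as1 @ bs1)"
      "sign_total as2 - sign_total bs2 = sign_total as1 - sign_total bs1"
    for cs1 ds1 as1 bs1 cs2 ds2 as2 bs2
    using that unfolding unit_diagram_nf base_diagram_nf by auto
  have op: "c \<noteq> d" if "chord_sign d = - chord_sign c" for c d
    using that chord_sign_cases [of c] by auto
  show ?case
  proof (cases "reduced w cs ds as bs")
    case True
    then show ?thesis using D by (metis equivclp_refl)
  next
    case False
    then consider c where "c \<in> set cs" "- chord_sign c * w c \<in> {0, 1, -1}"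
      | c where "c \<in> set ds" "- chord_sign c * w c \<in> {0, 1, 2}"
      | c d where "c \<in> set cs" "d \<in> set cs" "opposite w c d"
      | c d where "c \<in> set ds" "d \<in> set ds" "opposite w c d"
      | c d where "c \<in> set as" "d \<in> set as" "chord_sign d = - chord_sign c"
      | c d where "c \<in> set bs" "d \<in> set bs" "chord_sign d = - chord_sign c"
      unfolding reduced_def by blast
    then show ?thesis
    proof cases
      case (1 c)
      let ?A = "nf (c # remove1 c cs) ds as bs" and ?B = "nf (remove1 c cs) ds as bs"
      show ?thesis
      proof (rule smaller [of "c # remove1 c cs" "ds" "as" "bs" "remove1 c cs" "ds" "as" "bs"])
        assume U: "unit_diagram ?A"
        have "weighted w ?A \<simeq> weighted w ?B"
          using U 1(2) by (rule nf_remove_first)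
        moreover have "unit_diagram ?B"
          by (rule unit [OF U]) (use 1 in \<open>auto simp: opposite_def dest: set_remove1_subset [THEN subsetD]\<close>)
        ultimately show "weighted w ?A \<simeq> weighted w ?B \<and> unit_diagram ?B" ..
      qed (use mset_remove1 [OF 1(1)] in simp_all)
    next
      case (2 c)
      let ?A = "nf cs (c # remove1 c ds) as bs" and ?B = "nf cs (remove1 c ds) as bs"
      show ?thesis
      proof (rule smaller [of "cs" "c # remove1 c ds" "as" "bs" "cs" "remove1 c ds" "as" "bs"])
        assume U: "unit_diagram ?A"
        have "weighted w ?A \<simeq> weighted w ?B"
          using U 2(2) by (rule nf_remove_second)
        moreover have "unit_diagram ?B"
          by (rule unit [OF U]) (use 2 in \<open>auto simp: opposite_def dest: set_remove1_subset [THEN subsetD]\<close>)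
        ultimately show "weighted w ?A \<simeq> weighted w ?B \<and> unit_diagram ?B" ..
      qed (use mset_remove1 [OF 2(1)] in simp_all)
    next
      case (3 c d)
      have ne: "c \<noteq> d" using op 3(3) by (simp add: opposite_def)
      let ?A = "nf (c # d # remove1 d (remove1 c cs)) ds as bs" and ?B = "nf (remove1 d (remove1 c cs)) ds as bs"
      show ?thesis
      proof (rule smaller [of "c # d # remove1 d (remove1 c cs)" "ds" "as" "bs" "remove1 d (remove1 c cs)" "ds" "as" "bs"])
        assume U: "unit_diagram ?A"
        then have "base_diagram ?A" by (simp add: unit_diagram_nf)
        have "weighted w ?A \<simeq> weighted w ?B"
          using \<open>base_diagram _\<close> 3(3) by (intro nf_cancel_first) (auto simp: opposite_def)
        moreover have "unit_diagram ?B"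
          by (rule unit [OF U]) (use ne 3 in \<open>auto simp: opposite_def dest: set_remove1_subset [THEN subsetD]\<close>)
        ultimately show "weighted w ?A \<simeq> weighted w ?B \<and> unit_diagram ?B" ..
      qed (use mset_remove2 [OF 3(1,2) ne] in simp_all)
    next
      case (4 c d)
      have ne: "c \<noteq> d" using op 4(3) by (simp add: opposite_def)
      let ?A = "nf cs (c # d # remove1 d (remove1 c ds)) as bs" and ?B = "nf cs (remove1 d (remove1 c ds)) as bs"
      show ?thesis
      proof (rule smaller [of "cs" "c # d # remove1 d (remove1 c ds)" "as" "bs" "cs" "remove1 d (remove1 c ds)" "as" "bs"])
        assume U: "unit_diagram ?A"
        then have "base_diagram ?A" by (simp add: unit_diagram_nf)
        have "weighted w ?A \<simeq> weighted w ?B"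
          using \<open>base_diagram _\<close> 4(3) by (intro nf_cancel_second) (auto simp: opposite_def)
        moreover have "unit_diagram ?B"
          by (rule unit [OF U]) (use ne 4 in \<open>auto simp: opposite_def dest: set_remove1_subset [THEN subsetD]\<close>)
        ultimately show "weighted w ?A \<simeq> weighted w ?B \<and> unit_diagram ?B" ..
      qed (use mset_remove2 [OF 4(1,2) ne] in simp_all)
    next
      case (5 c d)
      have ne: "c \<noteq> d" using op 5(3) by (simp add: opposite_def)
      let ?A = "nf cs ds (c # d # remove1 d (remove1 c as)) bs" and ?B = "nf cs ds (remove1 d (remove1 c as)) bs"
      show ?thesis
      proof (rule smaller [of "cs" "ds" "c # d # remove1 d (remove1 c as)" "bs" "cs" "ds" "remove1 d (remove1 c as)" "bs"])
        assume U: "unit_diagram ?A"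
        have "weighted w ?A \<simeq> weighted w ?B"
          using U 5(3) by (intro nf_cancel_nonself) auto
        moreover have "unit_diagram ?B"
          by (rule unit [OF U]) (use ne 5 in \<open>auto simp: opposite_def dest: set_remove1_subset [THEN subsetD]\<close>)
        ultimately show "weighted w ?A \<simeq> weighted w ?B \<and> unit_diagram ?B" ..
      qed (use mset_remove2 [OF 5(1,2) ne] in simp_all)
    next
      case (6 c d)
      have ne: "c \<noteq> d" using op 6(3) by (simp add: opposite_def)
      let ?A = "nf cs ds as (c # d # remove1 d (remove1 c bs))" and ?B = "nf cs ds as (remove1 d (remove1 c bs))"
      show ?thesis
      proof (rule smaller [of "cs" "ds" "as" "c # d # remove1 d (remove1 c bs)" "cs" "ds" "as" "remove1 d (remove1 c bs)"])
        assume U: "unit_diagram ?A"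
        have "weighted w ?A \<simeq> weighted w ?B"
          using U 6(3) by (intro nf_cancel_nonself) auto
        moreover have "unit_diagram ?B"
          by (rule unit [OF U]) (use ne 6 in \<open>auto simp: opposite_def dest: set_remove1_subset [THEN subsetD]\<close>)
        ultimately show "weighted w ?A \<simeq> weighted w ?B \<and> unit_diagram ?B" ..
      qed (use mset_remove2 [OF 6(1,2) ne] in simp_all)
    qed
  qed
qed

section \<open>Invariants of the normal form\<close>

lemma sign_sum_surround: "sign_sum (surround p bs) = endpoint_sign p"
  by (induction bs rule: rev_induct) (simp_all add: surround_def shell_sign)

lemma sign_sum_surround_word: "sign_sum (surround_word a w) = sign_sum w"
  by (induction w) (simp_all add: sign_sum_surround)

lemma circle_decorate:
  "base_diagram D \<Longrightarrow> 1 \<le> i \<Longrightarrow> i \<le> 2 \<Longrightarrow> circle (decorate a D) i = surround_word a (circle D i)"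
  by (auto simp: circle_def decorate_def base_diagram_def gauss_diagram_def)

text \<open>
  By induction on the number of shells: each of them contributes to the index of its own chord, and has itself
  one of the excluded indices.
\<close>

lemma decorate_invariants:
  assumes D: "base_diagram D" and i: "1 \<le> i" "i \<le> 2" and n: "n \<notin> {1, sign_sum (circle D i) + 1}"
    and "\<And>s. odd (label s) \<Longrightarrow> \<phi> s = 0"
  shows "offset_writhe \<phi> (decorate a D) i n =
      offset_writhe (\<lambda>c. \<phi> c - chord_sign c * (weight (a (Ini c)) + weight (a (Ter c)))) D i n \<and>
    (\<forall>j. 1 \<le> j \<longrightarrow> j \<le> 2 \<longrightarrow> linking (decorate a D) i j = linking D i j)"
  using assms(5)
proof (induction "\<Sum>p \<in> endpoints D. length (a p)" arbitrary: a \<phi>)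
  case 0
  then have a: "a p = []" if "p \<in> endpoints D" for p using that by simp
  have "weight (a (Ini c)) + weight (a (Ter c)) = 0" if "c \<in> self_chords D i" for c
  proof -
    have "Ini c \<in> endpoints D" "Ter c \<in> endpoints D"
      using that circle_endpoints [OF base_diagramD(1) [OF D] i] by (auto simp: self_chords_def)
    then show ?thesis using a by simp
  qed
  moreover have "decorate a D = D" using a by (rule decorate_Nil)
  ultimately show ?case
    by (auto intro!: offset_writhe_cong)
next
  case (Suc m)
  have "\<exists>p \<in> endpoints D. a p \<noteq> []"
  proof (rule ccontr)
    assume "\<not> ?thesis"
    then have "(\<Sum>p \<in> endpoints D. length (a p)) = 0" by (intro sum.neutral) auto
    then show False using Suc.hyps(2) by simp
  qed
  then obtain p where p: "p \<in> endpoints D" "a p \<noteq> []" by blast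
  then obtain bs b where bs: "a p = bs @ [b]" by (metis append_butlast_last_id)
  let ?a = "a(p := bs)" and ?s = "stack_shell p (length bs) b"
  let ?G = "decorate a D" and ?H = "decorate ?a D"
  let ?\<phi> = "\<lambda>c. \<phi> c - of_bool (c = chord_of p) * chord_sign ?s * chord_sign c"
  have G: "gauss_diagram 2 ?G" by (rule gauss_decorate [OF D])
  have sh: "shell ?G ?s p" using D p(1) bs by (rule shell_decorate)
  have "a(p := bs @ [b]) = a" using bs by (simp add: fun_eq_iff)
  then have del: "delete {?s} ?G = ?H" using delete_stack_shell [OF D, of p bs b a] by simp
  have T: "sign_sum (circle ?G i) = sign_sum (circle D i)"
    by (simp add: circle_decorate [OF D i] sign_sum_surround_word)
  have ev: "even (label (chord_of p))" using base_diagramD(2) [OF D p(1)] .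
  have "m = (\<Sum>q \<in> endpoints D. length (?a q))"
  proof -
    have "(\<Sum>q \<in> endpoints D. length (a q)) = length (a p) + (\<Sum>q \<in> endpoints D - {p}. length (a q))"
      using p(1) by (intro sum.remove) auto
    moreover have "(\<Sum>q \<in> endpoints D. length (?a q)) = length (?a p) + (\<Sum>q \<in> endpoints D - {p}. length (?a q))"
      using p(1) by (intro sum.remove) auto
    moreover have "(\<Sum>q \<in> endpoints D - {p}. length (?a q)) = (\<Sum>q \<in> endpoints D - {p}. length (a q))"
      by (intro sum.cong) auto
    ultimately show ?thesis using Suc.hyps(2) bs by simp
  qed
  moreover have "?\<phi> s = 0" if "odd (label s)" for s using that ev Suc.prems by auto
  ultimately have IH: "offset_writhe ?\<phi> ?H i n =
      offset_writhe (\<lambda>c. ?\<phi> c - chord_sign c * (weight (?a (Ini c)) + weight (?a (Ter c)))) D i n"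
    "\<forall>j. 1 \<le> j \<longrightarrow> j \<le> 2 \<longrightarrow> linking ?H i j = linking D i j"
    using Suc.hyps(1) [of ?a ?\<phi>] by blast+
  have "offset_writhe \<phi> ?G i n = offset_writhe ?\<phi> ?H i n"
    unfolding del [symmetric]
    by (rule offset_writhe_delete_shell [OF G i sh]) (use n T Suc.prems in auto)
  also have "\<dots> = offset_writhe (\<lambda>c. \<phi> c - chord_sign c * (weight (a (Ini c)) + weight (a (Ter c)))) D i n"
    unfolding IH(1)
  proof (rule offset_writhe_cong)
    fix c
    have ap: "weight (a p) = weight (?a p) + chord_sign ?s"
      by (simp add: bs)
    have aq: "weight (a q) = weight (?a q)" if "q \<noteq> p" for q
      using that by simp
    have "weight (a (Ini c)) + weight (a (Ter c)) =
      weight (?a (Ini c)) + weight (?a (Ter c)) + of_bool (c = chord_of p) * chord_sign ?s"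
    proof (cases "c = chord_of p")
      case True
      then consider "p = Ini c" | "p = Ter c" using chord_of_mem [of p] by blast
      then show ?thesis
      proof cases
        case 1
        then have "Ter c \<noteq> p" by simp
        note e = aq [OF this]
        have f: "weight (a (Ini c)) = weight (?a (Ini c)) + chord_sign ?s"
          using ap by (simp only: 1)
        have g: "of_bool (c = chord_of p) = (1::int)" using True by simp
        show ?thesis unfolding e f g by (simp only: mult_1 add_ac)
      next
        case 2
        then have "Ini c \<noteq> p" by simp
        note e = aq [OF this]
        have f: "weight (a (Ter c)) = weight (?a (Ter c)) + chord_sign ?s"
          using ap by (simp only: 2)
        have g: "of_bool (c = chord_of p) = (1::int)" using True by simp
        show ?thesis unfolding e f g by (simp only: mult_1 add_ac)
      qed
    next
      case False
      then have "Ini c \<noteq> p" "Ter c \<noteq> p" by auto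
      from aq [OF this(1)] aq [OF this(2)] False show ?thesis by simp
    qed
    then show "self_index D i c + (?\<phi> c - chord_sign c * (weight (?a (Ini c)) + weight (?a (Ter c)))) =
      self_index D i c + (\<phi> c - chord_sign c * (weight (a (Ini c)) + weight (a (Ter c))))"
      by (simp only:) (simp add: algebra_simps)
  qed simp
  finally have "offset_writhe \<phi> ?G i n =
    offset_writhe (\<lambda>c. \<phi> c - chord_sign c * (weight (a (Ini c)) + weight (a (Ter c)))) D i n" .
  moreover have "linking ?G i j = linking D i j" if "1 \<le> j" "j \<le> 2" for j
    using linking_delete_shell [OF G i that sh] IH(2) that unfolding del by simp
  ultimately show ?case by blast
qed

lemma blocks_split: "c \<in> set cs \<Longrightarrow> \<exists>x y. blocks cs = x @ Ini c # [] @ Ter c # y"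
proof -
  assume "c \<in> set cs"
  then obtain ds es where "cs = ds @ c # es" by (meson split_list)
  then have "blocks cs = blocks ds @ Ini c # [] @ Ter c # blocks es" by simp
  then show ?thesis by blast
qed

lemma open_arc_block:
  assumes "distinct (blocks cs @ r)" "c \<in> set cs"
  shows "open_arc (blocks cs @ r) (Ini c) (Ter c) = []"
proof -
  obtain x y where "blocks cs = x @ Ini c # [] @ Ter c # y" using blocks_split [OF assms(2)] by blast
  then have e: "blocks cs @ r = x @ Ini c # [] @ Ter c # (y @ r)" by simp
  show ?thesis using assms(1) unfolding e by (rule open_arc_unwrapped)
qed

lemma nf_self_chords:
  assumes "base_diagram (nf cs ds as bs)"
  shows "self_chords (nf cs ds as bs) 1 = set cs" "self_chords (nf cs ds as bs) 2 = set ds"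
    "c \<in> set cs \<Longrightarrow> self_index (nf cs ds as bs) 1 c = 0"
    "c \<in> set ds \<Longrightarrow> self_index (nf cs ds as bs) 2 c = 0"
    "linking (nf cs ds as bs) 1 2 = sign_total as" "linking (nf cs ds as bs) 2 1 = sign_total bs"
proof -
  have d: "distinct (cs @ ds @ as @ bs)" using assms by (simp add: base_diagram_nf)
  show "self_chords (nf cs ds as bs) 1 = set cs" "self_chords (nf cs ds as bs) 2 = set ds"
    using d by (auto simp: self_chords_def circle_def nf_def set_blocks)
  have w: "distinct (blocks cs @ map Ini as @ map Ter bs)" "distinct (blocks ds @ map Ter as @ map Ini bs)"
    using base_diagramD(1) [OF assms] by (auto simp: gauss_diagram_def nf_def)
  show "c \<in> set cs \<Longrightarrow> self_index (nf cs ds as bs) 1 c = 0"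
    "c \<in> set ds \<Longrightarrow> self_index (nf cs ds as bs) 2 c = 0"
    using open_arc_block [OF w(1)] open_arc_block [OF w(2)]
    by (simp_all add: self_index_def arc_sum_def circle_def nf_def)
  have "nonself_chords (nf cs ds as bs) 1 2 = set as" "nonself_chords (nf cs ds as bs) 2 1 = set bs"
    using d by (auto simp: nonself_chords_def circle_def nf_def set_blocks)
  then show "linking (nf cs ds as bs) 1 2 = sign_total as" "linking (nf cs ds as bs) 2 1 = sign_total bs"
    using d by (simp_all add: linking_def sum_list_distinct_conv_sum_set)
qed

text \<open>
  The writhe \<open>J\<^sub>n\<close> of a circle whose self-chords are the isolated chords in \<open>C\<close>.
\<close>

definition index_writhe :: "(chord \<Rightarrow> int) \<Rightarrow> chord set \<Rightarrow> int \<Rightarrow> int" where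
  "index_writhe w C n = (\<Sum>c | c \<in> C \<and> - chord_sign c * w c = n. chord_sign c)"

lemma invariants_nf:
  assumes D: "unit_diagram (nf cs ds as bs)"
  shows "invariants (weighted w (nf cs ds as bs)) = (sign_total as, sign_total bs,
    \<lambda>n. if n \<in> {0, 1, -1} then 0 else index_writhe w (set cs) n,
    \<lambda>n. if n \<in> {0, 1, 2} then 0 else index_writhe w (set ds) n)"
proof -
  let ?D = "nf cs ds as bs"
  have B: "base_diagram ?D" and t: "sign_total as - sign_total bs = 1"
    using D by (simp_all add: unit_diagram_nf)
  note nf = nf_self_chords [OF B]
  define a where "a = (\<lambda>p. case p of Ini c \<Rightarrow> stack_of (w c) | Ter c \<Rightarrow> [])"
  have w: "weight (a (Ini c)) + weight (a (Ter c)) = w c" for c by (simp add: a_def)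
  have dec: "weighted w ?D = decorate a ?D" by (simp add: weighted_def a_def)
  have T: "sign_sum (circle ?D 1) = -1" "sign_sum (circle ?D 2) = 1"
    using t by (simp_all add: circle_def nf_def)
  have inv: "offset_writhe (\<lambda>_. 0) (weighted w ?D) i n = offset_writhe (\<lambda>c. - chord_sign c * w c) ?D i n"
    "1 \<le> j \<Longrightarrow> j \<le> 2 \<Longrightarrow> linking (weighted w ?D) i j = linking ?D i j"
    if "1 \<le> i" "i \<le> 2" "n \<notin> {1, sign_sum (circle ?D i) + 1}" for i j n
    using decorate_invariants [OF B that, of "\<lambda>_. 0" a] unfolding dec w by simp_all
  have "linking (weighted w ?D) 1 2 = sign_total as" "linking (weighted w ?D) 2 1 = sign_total bs"
    using inv(2) [of 1 5 2] inv(2) [of 2 5 1] T nf(5,6) by simp_all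
  moreover have "self_writhe (weighted w ?D) 1 n = index_writhe w (set cs) n" if "n \<notin> {0, 1, -1}" for n
  proof -
    have "self_writhe (weighted w ?D) 1 n = offset_writhe (\<lambda>c. - chord_sign c * w c) ?D 1 n"
      unfolding self_writhe_offset using that T by (intro inv(1)) auto
    also have "\<dots> = index_writhe w (set cs) n"
      unfolding offset_writhe_def index_writhe_def nf(1) using nf(3) by (intro sum.cong) auto
    finally show ?thesis .
  qed
  moreover have "self_writhe (weighted w ?D) 2 n = index_writhe w (set ds) n" if "n \<notin> {0, 1, 2}" for n
  proof -
    have "self_writhe (weighted w ?D) 2 n = offset_writhe (\<lambda>c. - chord_sign c * w c) ?D 2 n"
      unfolding self_writhe_offset using that T by (intro inv(1)) auto
    also have "\<dots> = index_writhe w (set ds) n"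
      unfolding offset_writhe_def index_writhe_def nf(2) using nf(4) by (intro sum.cong) auto
    finally show ?thesis .
  qed
  ultimately show ?thesis
    using t unfolding invariants_def by (simp add: fun_eq_iff)
qed

section \<open>Comparison of reduced normal forms\<close>

lemma map_eq_reorder:
  assumes "mset (map f xs) = mset ys"
  shows "\<exists>xs'. mset xs' = mset xs \<and> map f xs' = ys"
  using assms
proof (induction ys arbitrary: xs)
  case (Cons y ys)
  have "y \<in> set (map f xs)" unfolding mset_eq_setD [OF Cons.prems] by simp
  then obtain x where x: "x \<in> set xs" "f x = y" by auto
  have m: "mset xs = add_mset x (mset (remove1 x xs))" using mset_remove1 [OF x(1)] by (simp only: mset.simps)
  have "mset (map f (remove1 x xs)) = mset ys"
  proof -
    have "mset (map f xs) = add_mset (f x) (mset (map f (remove1 x xs)))"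
      by (simp only: mset_map m image_mset_add_mset)
    then show ?thesis
      using Cons.prems by (simp only: x(2) mset.simps add_mset_add_mset_same_iff)
  qed
  then obtain xs' where xs': "mset xs' = mset (remove1 x xs)" "map f xs' = ys"
    using Cons.IH by blast
  have 1: "mset (x # xs') = mset xs" using xs'(1) m by (simp only: mset.simps)
  have 2: "map f (x # xs') = y # ys" using xs'(2) x(2) by simp
  show ?case by (rule exI [of _ "x # xs'"], rule conjI [OF 1 2])
qed simp

definition profile :: "(chord \<Rightarrow> int) \<Rightarrow> chord \<Rightarrow> int \<times> int" where
  "profile w c = (chord_sign c, - chord_sign c * w c)"

lemma profile_eq: "profile w c = profile v d \<longleftrightarrow> chord_sign c = chord_sign d \<and> w c = v d"
  using chord_sign_cases [of c] chord_sign_cases [of d] by (auto simp: profile_def)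

text \<open>
  In a reduced normal form all self-chords of the same circle and index have the same sign, hence the
  writhe at this index determines how many there are and which sign they have.
\<close>

lemma profile_count:
  assumes d: "distinct cs" and r: "\<And>c d. c \<in> set cs \<Longrightarrow> d \<in> set cs \<Longrightarrow> \<not> opposite w c d"
  shows "int (count (mset (map (profile w) cs)) (s, n)) =
    (if s = 1 \<or> s = -1 then max 0 (s * index_writhe w (set cs) n) else 0)"
proof -
  define A where "A s = {c \<in> set cs. chord_sign c = s \<and> - chord_sign c * w c = n}" for s
  have count: "count (mset (map (profile w) cs)) (s, n) = card (A s)" for s
  proof -
    have "mset (map (profile w) cs) = image_mset (profile w) (mset_set (set cs))"
      using d by (simp add: mset_set_set)
    then have "count (mset (map (profile w) cs)) (s, n) = card {c \<in> set cs. profile w c = (s, n)}"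
      by (simp add: count_image_mset' eq_commute [of "(s, n)"])
    then show ?thesis by (simp add: A_def profile_def)
  qed
  have fin: "finite (A s)" for s by (simp add: A_def)
  have "{c. c \<in> set cs \<and> - chord_sign c * w c = n} = A 1 \<union> A (-1)"
    using chord_sign_cases by (auto simp: A_def)
  moreover have "A 1 \<inter> A (-1) = {}" by (auto simp: A_def)
  ultimately have "index_writhe w (set cs) n = (\<Sum>c \<in> A 1. chord_sign c) + (\<Sum>c \<in> A (-1). chord_sign c)"
    using fin by (simp add: index_writhe_def sum.union_disjoint)
  also have "(\<Sum>c \<in> A 1. chord_sign c) = int (card (A 1))" by (simp add: A_def)
  also have "(\<Sum>c \<in> A (-1). chord_sign c) = - int (card (A (-1)))" by (simp add: A_def)
  finally have sum: "index_writhe w (set cs) n = int (card (A 1)) - int (card (A (-1)))" by simp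
  have "A 1 = {} \<or> A (-1) = {}"
  proof (rule ccontr)
    assume "\<not> ?thesis"
    then obtain c e where "c \<in> A 1" "e \<in> A (-1)" by blast
    then show False using r [of c e] by (auto simp: A_def opposite_def)
  qed
  moreover have "A s = {}" if "s \<noteq> 1" "s \<noteq> -1"
    using that chord_sign_cases by (auto simp: A_def)
  ultimately show ?thesis
    unfolding count using sum by auto
qed

lemma index_writhe_0:
  "(\<And>c. c \<in> C \<Longrightarrow> - chord_sign c * w c \<noteq> n) \<Longrightarrow> index_writhe w C n = 0"
  unfolding index_writhe_def by (rule sum.neutral) auto

lemma profile_reorder:
  assumes "distinct cs" "\<And>c d. c \<in> set cs \<Longrightarrow> d \<in> set cs \<Longrightarrow> \<not> opposite w c d"
    and "distinct cs'" "\<And>c d. c \<in> set cs' \<Longrightarrow> d \<in> set cs' \<Longrightarrow> \<not> opposite w' c d"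
    and "\<And>n. index_writhe w (set cs) n = index_writhe w' (set cs') n"
  obtains es where "mset es = mset cs" "map (profile w) es = map (profile w') cs'"
proof -
  have "count (mset (map (profile w) cs)) x = count (mset (map (profile w') cs')) x" for x
  proof (cases x)
    case (Pair s n)
    have "int (count (mset (map (profile w) cs)) (s, n)) = int (count (mset (map (profile w') cs')) (s, n))"
      using profile_count [OF assms(1,2), of s n] profile_count [OF assms(3,4), of s n] assms(5) by simp
    then show ?thesis using Pair by simp
  qed
  then have "mset (map (profile w) cs) = mset (map (profile w') cs')" by (rule multiset_eqI)
  from map_eq_reorder [OF this] show ?thesis using that by blast
qed

text \<open>
  Nonself-chords of the same type that do not cancel all have the same sign, so their linking number
  determines their signs.
\<close>

lemma sign_list_determined:
  assumes "\<And>a b. a \<in> set as \<Longrightarrow> b \<in> set as \<Longrightarrow> chord_sign b \<noteq> - chord_sign a"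
    and "\<And>a b. a \<in> set as' \<Longrightarrow> b \<in> set as' \<Longrightarrow> chord_sign b \<noteq> - chord_sign a"
    and "sign_total as = sign_total as'"
  shows "map chord_sign as = map chord_sign as'"
proof -
  have canon: "map chord_sign as = replicate (nat \<bar>sign_total as\<bar>) (sgn (sign_total as))"
    if h: "\<And>a b. a \<in> set as \<Longrightarrow> b \<in> set as \<Longrightarrow> chord_sign b \<noteq> - chord_sign a" for as
  proof (cases as)
    case (Cons a xs)
    have "chord_sign b = chord_sign a" if "b \<in> set as" for b
      using h [of a b] that Cons chord_sign_cases [of a] chord_sign_cases [of b] by auto
    then have m: "map chord_sign as = replicate (length as) (chord_sign a)"
      by (intro replicate_eqI) auto
    then have t: "sign_total as = int (length as) * chord_sign a"
      by (simp add: sum_list_replicate)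
    have "nat \<bar>sign_total as\<bar> = length as" "sgn (sign_total as) = chord_sign a"
      using chord_sign_cases [of a] Cons unfolding t by (auto simp: abs_mult sgn_mult)
    then show ?thesis using m by simp
  qed simp
  have "map chord_sign as = replicate (nat \<bar>sign_total as\<bar>) (sgn (sign_total as))"
    by (rule canon) (rule assms(1))
  also have "\<dots> = map chord_sign as'"
    unfolding assms(3) by (rule canon [symmetric]) (rule assms(2))
  finally show ?thesis .
qed

lemma nf_relabel:
  assumes D: "base_diagram (nf cs ds as bs)" and D': "base_diagram (nf cs' ds' as' bs')"
    and l: "length cs = length cs'" "length ds = length ds'" "length as = length as'" "length bs = length bs'"
    and p: "map (profile w) (cs @ ds @ as @ bs) = map (profile w') (cs' @ ds' @ as' @ bs')"
  shows "weighted w (nf cs ds as bs) \<simeq> weighted w' (nf cs' ds' as' bs')"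
proof -
  let ?L = "cs @ ds @ as @ bs" and ?L' = "cs' @ ds' @ as' @ bs'"
  have len: "length ?L = length ?L'" using l by simp
  have d: "distinct ?L" "distinct ?L'" using D D' by (simp_all add: base_diagram_nf)
  define f where "f c = the (map_of (zip ?L ?L') c)" for c
  have fn: "f (?L ! k) = ?L' ! k" if "k < length ?L" for k
    using that d(1) len map_of_zip_nth [of ?L ?L' k] by (simp add: f_def)
  have fL: "map f ?L = ?L'"
  proof (rule nth_equalityI)
    show "length (map f ?L) = length ?L'" by (simp only: length_map len)
    show "map f ?L ! i = ?L' ! i" if "i < length (map f ?L)" for i
      using that fn [of i] by (simp only: length_map nth_map)
  qed
  have inj: "inj_on f (set ?L)"
    using d(2) fL by (metis distinct_map)
  have maps: "map f cs = cs'" "map f ds = ds'" "map f as = as'" "map f bs = bs'"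
    using fL l by (auto simp: append_eq_append_conv)
  have prof: "profile w' (f c) = profile w c" if "c \<in> set ?L" for c
  proof -
    have "map (profile w') (map f ?L) = map (profile w) ?L" using p fL by simp
    then show ?thesis using that by (simp only: map_map comp_def map_eq_conv)
  qed
  have "map (map_endpoint f) (blocks xs) = blocks (map f xs)"
    "map (map_endpoint f) (map Ini xs) = map Ini (map f xs)"
    "map (map_endpoint f) (map Ter xs) = map Ter (map f xs)" for xs
    by (induction xs) auto
  then have nf: "map (map (map_endpoint f)) (nf cs ds as bs) = nf cs' ds' as' bs'"
    unfolding nf_def maps [symmetric] by (simp only: list.map map_append)
  have "weighted w (nf cs ds as bs) \<simeq> weighted w' (map (map (map_endpoint f)) (nf cs ds as bs))"
  proof (rule weighted_relabel [OF D])
    show "inj_on f (chords (nf cs ds as bs))" using inj by (simp only: chords_nf)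
    fix c assume "c \<in> chords (nf cs ds as bs)"
    then have c: "c \<in> set ?L" by (simp only: chords_nf)
    then have "f c \<in> set ?L'" unfolding fL [symmetric] set_map by (rule imageI)
    then show "even (label (f c))" using D' unfolding base_diagram_nf by blast
    show "chord_sign (f c) = chord_sign c" "w' (f c) = w c"
      using prof [OF c] by (simp_all add: profile_eq)
  qed
  then show ?thesis by (simp only: nf)
qed

text \<open>
  Equal invariants force the two lists of signs and weights to agree after a permutation, once the
  weights of the nonself-chords have been set to \<open>0\<close>; then a relabelling identifies the diagrams.
\<close>

lemma reduced_equiv:
  assumes D: "unit_diagram (nf cs ds as bs)" and D': "unit_diagram (nf cs' ds' as' bs')"
    and r: "reduced w cs ds as bs" and r': "reduced w' cs' ds' as' bs'"
    and inv: "invariants (weighted w (nf cs ds as bs)) = invariants (weighted w' (nf cs' ds' as' bs'))"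
  shows "weighted w (nf cs ds as bs) \<simeq> weighted w' (nf cs' ds' as' bs')"
proof -
  have dist: "distinct (cs @ ds @ as @ bs)" "distinct (cs' @ ds' @ as' @ bs')"
    using D D' by (simp_all add: unit_diagram_nf base_diagram_nf)
  note I = inv [unfolded invariants_nf [OF D] invariants_nf [OF D']]
  have ic: "index_writhe w (set cs) n = index_writhe w' (set cs') n" for n
  proof (cases "n \<in> {0, 1, -1}")
    case True
    then show ?thesis
      using r r' index_writhe_0 [of "set cs" w n] index_writhe_0 [of "set cs'" w' n]
      unfolding reduced_def by metis
  next
    case False
    then show ?thesis using I by (auto dest!: fun_cong [of _ _ n])
  qed
  have id: "index_writhe w (set ds) n = index_writhe w' (set ds') n" for n
  proof (cases "n \<in> {0, 1, 2}")
    case True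
    then show ?thesis
      using r r' index_writhe_0 [of "set ds" w n] index_writhe_0 [of "set ds'" w' n]
      unfolding reduced_def by metis
  next
    case False
    then show ?thesis using I by (auto dest!: fun_cong [of _ _ n])
  qed
  obtain xs where xs: "mset xs = mset cs" "map (profile w) xs = map (profile w') cs'"
    by (rule profile_reorder [of cs w cs' w']) (use r r' dist ic in \<open>auto simp: reduced_def\<close>)
  obtain ys where ys: "mset ys = mset ds" "map (profile w) ys = map (profile w') ds'"
    by (rule profile_reorder [of ds w ds' w']) (use r r' dist id in \<open>auto simp: reduced_def\<close>)
  have sa: "map chord_sign as = map chord_sign as'" and sb: "map chord_sign bs = map chord_sign bs'"
    using r r' I by (auto simp: reduced_def intro!: sign_list_determined)
  define v where "v c = (if c \<in> set as \<union> set bs then 0 else w c)" for c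
  define v' where "v' c = (if c \<in> set as' \<union> set bs' then 0 else w' c)" for c
  have X: "unit_diagram (nf xs ys as bs)"
    by (rule nf_permute(2) [OF D]) (use xs ys in auto)
  have "weighted w (nf cs ds as bs) \<simeq> weighted w (nf xs ys as bs)"
    by (rule nf_permute(1) [OF D]) (use xs ys in auto)
  also have "\<dots> \<simeq> weighted v (nf xs ys as bs)"
  proof (rule weighted_nonself_free [OF X])
    fix c assume "(Ini c \<in> set (hd (nf xs ys as bs))) = (Ter c \<in> set (hd (nf xs ys as bs)))"
    then have "c \<notin> set as \<union> set bs" using X by (intro nf_self) (simp_all add: unit_diagram_nf)
    then show "w c = v c" by (simp add: v_def)
  qed
  also have "\<dots> \<simeq> weighted v' (nf cs' ds' as' bs')"
  proof (rule nf_relabel)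
    show "base_diagram (nf xs ys as bs)" "base_diagram (nf cs' ds' as' bs')"
      using X D' by (simp_all add: unit_diagram_nf)
    show "length xs = length cs'" "length ys = length ds'" "length as = length as'" "length bs = length bs'"
      using xs(2) ys(2) sa sb by (metis length_map)+
    have dx: "distinct (xs @ ys @ as @ bs)" using X by (simp add: unit_diagram_nf base_diagram_nf)
    have "map (profile v) xs = map (profile w) xs" "map (profile v) ys = map (profile w) ys"
      using dx by (auto simp: profile_def v_def)
    moreover have "map (profile v') cs' = map (profile w') cs'" "map (profile v') ds' = map (profile w') ds'"
      using dist(2) by (auto simp: profile_def v'_def)
    moreover have z: "map (profile u) zs = map (\<lambda>s. (s, 0)) (map chord_sign zs)" if "\<And>c. c \<in> set zs \<Longrightarrow> u c = 0" for u zs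
      using that by (simp add: profile_def)
    have "map (profile v) as = map (profile v') as'" "map (profile v) bs = map (profile v') bs'"
      using z [of as v] z [of as' v'] z [of bs v] z [of bs' v'] sa sb by (auto simp: v_def v'_def)
    ultimately show "map (profile v) (xs @ ys @ as @ bs) = map (profile v') (cs' @ ds' @ as' @ bs')"
      using xs(2) ys(2) by simp
  qed
  also have "\<dots> \<simeq> weighted w' (nf cs' ds' as' bs')"
  proof (rule weighted_nonself_free [OF D'])
    fix c assume "(Ini c \<in> set (hd (nf cs' ds' as' bs'))) = (Ter c \<in> set (hd (nf cs' ds' as' bs')))"
    then have "c \<notin> set as' \<union> set bs'" using D' by (intro nf_self) (simp_all add: unit_diagram_nf)
    then show "v' c = w' c" by (simp add: v'_def)
  qed
  finally show ?thesis .
qed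

lemma equiv_invariants: "G \<simeq> H \<Longrightarrow> invariants H = invariants G"
  using equivclp_invariant [of move G H invariants] move_invariants by blast

text \<open>
  The labels are doubled first, to make room for the odd labels of the shells.
\<close>

lemma nf_exists:
  assumes G: "gauss_diagram 2 G" and lk: "linking G 1 2 - linking G 2 1 = 1"
  shows "\<exists>w cs ds as bs. G \<simeq> weighted w (nf cs ds as bs) \<and> unit_diagram (nf cs ds as bs) \<and> reduced w cs ds as bs"
proof -
  define f where "f c = Chord (2 * label c) (positive c)" for c
  let ?E = "map (map (map_endpoint f)) G"
  have inj: "inj f" by (rule injI) (auto simp: f_def intro: chord.expand)
  have E: "base_diagram ?E"
    using G by (intro base_diagram_relabel) (auto simp: f_def intro: inj_on_subset [OF inj])
  have "same_diagram G ?E"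
    unfolding same_diagram_def
  proof (intro exI conjI ballI)
    show "inj_on f (chords G)" by (rule inj_on_subset [OF inj]) simp
    show "chord_sign (f c) = chord_sign c" for c by (simp add: f_def chord_sign_def)
    show "list_all2 (\<lambda>v w. \<exists>k. w = rotate k (map (map_endpoint f) v)) G ?E"
      unfolding list_all2_map2 by (rule list.rel_refl_strong) (rule exI [of _ 0], simp)
  qed
  then have "G \<simeq> ?E" using G base_diagramD(1) [OF E] by (intro move_equiv_same_diagram)
  also have "?E = weighted (\<lambda>_. 0) ?E" by (rule weighted_0 [symmetric]) simp
  finally have 0: "G \<simeq> weighted (\<lambda>_. 0) ?E" .
  obtain cs ds as bs w where "weighted (\<lambda>_. 0) ?E \<simeq> weighted w (nf cs ds as bs)"
    and B: "base_diagram (nf cs ds as bs)"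
    using weighted_nf_exists [OF E] by metis
  then have 1: "G \<simeq> weighted w (nf cs ds as bs)" using 0 by (meson move_equiv_trans)
  have "sign_total as - sign_total bs = 1"
  proof -
    define a where "a = (\<lambda>p. case p of Ini c \<Rightarrow> stack_of (w c) | Ter c \<Rightarrow> [])"
    have "linking (weighted w (nf cs ds as bs)) 1 2 = linking G 1 2"
      "linking (weighted w (nf cs ds as bs)) 2 1 = linking G 2 1"
      using equiv_invariants [OF 1] unfolding invariants_def by (auto split: if_splits)
    moreover have "linking (weighted w (nf cs ds as bs)) i j = linking (nf cs ds as bs) i j"
      if "1 \<le> i" "i \<le> 2" "1 \<le> j" "j \<le> 2" for i j
    proof -
      have "\<exists>n. n \<notin> {1, sign_sum (circle (nf cs ds as bs) i) + 1}"
        by (rule ex_new_if_finite) (auto simp: infinite_UNIV_int)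
      then obtain n where n: "n \<notin> {1, sign_sum (circle (nf cs ds as bs) i) + 1}" ..
      show ?thesis
        using decorate_invariants [OF B that(1,2) n, of "\<lambda>_. 0" a] that(3,4) unfolding weighted_def a_def by simp
    qed
    ultimately show ?thesis using nf_self_chords(5,6) [OF B] lk by simp
  qed
  then have "unit_diagram (nf cs ds as bs)" using B by (simp add: unit_diagram_nf)
  from nf_reduce [OF this, of w] 1 show ?thesis by (meson move_equiv_trans)
qed

lemma invariants_complete:
  assumes G: "gauss_diagram 2 G" "linking G 1 2 - linking G 2 1 = 1"
    and H: "gauss_diagram 2 H" "linking H 1 2 - linking H 2 1 = 1"
    and inv: "invariants G = invariants H"
  shows "G \<simeq> H"
proof -
  obtain w cs ds as bs where 1: "G \<simeq> weighted w (nf cs ds as bs)"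
    and N: "unit_diagram (nf cs ds as bs)" "reduced w cs ds as bs"
    using nf_exists [OF G] by metis
  obtain w' cs' ds' as' bs' where 2: "H \<simeq> weighted w' (nf cs' ds' as' bs')"
    and N': "unit_diagram (nf cs' ds' as' bs')" "reduced w' cs' ds' as' bs'"
    using nf_exists [OF H] by metis
  have "invariants (weighted w (nf cs ds as bs)) = invariants (weighted w' (nf cs' ds' as' bs'))"
    using equiv_invariants [OF 1] equiv_invariants [OF 2] inv by simp
  from reduced_equiv [OF N(1) N'(1) N(2) N'(2) this]
  show ?thesis using 1 2 by (meson move_equiv_sym move_equiv_trans)
qed

section \<open>Links and their representatives\<close>

lemma reidemeister_move_equiv:
  assumes "(G, H) \<in> reidemeister_equiv 2"
  shows "G \<simeq> H"
proof -
  have "equivclp (reidemeister_step 2) G H" using assms by (simp add: reidemeister_equiv_def)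
  then show ?thesis
  proof (induction rule: equivclp_induct)
    case base
    show ?case by simp
  next
    case (step y z)
    from step(2) have "y \<simeq> z"
      by (metis move_def move_equivI move_equiv_sym)
    with step(3) show ?case by (rule move_equiv_trans)
  qed
qed

lemma virtual_link_rep:
  assumes "L \<in> virtual_links 2"
  shows "rep L \<in> L" "gauss_diagram 2 (rep L)" "\<And>G. G \<in> L \<Longrightarrow> G \<simeq> rep L"
proof -
  from assms obtain G where L: "gauss_diagram 2 G" "L = reidemeister_equiv 2 `` {G}"
    unfolding virtual_links_def quotient_def by blast
  have "G \<in> L" using L equiv_reidemeister_equiv [of 2] by (auto simp: equiv_def refl_on_def reidemeister_equiv_def)
  then show r: "rep L \<in> L" unfolding rep_def by (rule someI)
  then show "gauss_diagram 2 (rep L)" unfolding L(2) by (auto simp: reidemeister_equiv_def)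
  have G: "G \<simeq> H" if "H \<in> L" for H
    using that unfolding L(2) by (intro reidemeister_move_equiv) simp
  show "H \<simeq> rep L" if "H \<in> L" for H
    using G [OF that] G [OF r] by (meson move_equiv_sym move_equiv_trans)
qed

lemma S_equivalent_iff:
  assumes "L \<in> virtual_links 2" "L' \<in> virtual_links 2"
  shows "S_equivalent 2 L L' \<longleftrightarrow> rep L \<simeq> rep L'"
proof -
  have m: "(\<lambda>D E. reidemeister_step 2 D E \<or> shell_step 2 D E) = move"
    by (simp add: move_def fun_eq_iff)
  show ?thesis
    unfolding S_equivalent_def m
    using virtual_link_rep [OF assms(1)] virtual_link_rep [OF assms(2)]
    by (meson move_equiv_sym move_equiv_trans)
qed

section \<open>The linking class\<close>

text \<open>
  The value of a Laurent polynomial at \<open>t = 1\<close>.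
\<close>

definition augmentation :: "laurent \<Rightarrow> int" where
  "augmentation f = (\<Sum>n \<in> Poly_Mapping.keys f. Poly_Mapping.lookup f n)"

lemma augmentation_superset:
  "finite S \<Longrightarrow> Poly_Mapping.keys f \<subseteq> S \<Longrightarrow> augmentation f = (\<Sum>n \<in> S. Poly_Mapping.lookup f n)"
  unfolding augmentation_def by (rule sum.mono_neutral_left) (auto simp: in_keys_iff)

lemma augmentation_add: "augmentation (f + g) = augmentation f + augmentation g"
proof -
  let ?S = "Poly_Mapping.keys f \<union> Poly_Mapping.keys g"
  have "Poly_Mapping.keys (f + g) \<subseteq> ?S" by (rule Poly_Mapping.keys_add)
  then show ?thesis
    using augmentation_superset [of ?S f] augmentation_superset [of ?S g] augmentation_superset [of ?S "f + g"]
    by (simp add: lookup_add sum.distrib)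
qed

lemma augmentation_single [simp]: "augmentation (Poly_Mapping.single n a) = a"
  by (cases "a = 0") (simp_all add: augmentation_def)

lemma laurent_induct [case_names single add]:
  fixes f :: laurent
  assumes "\<And>n a. P (Poly_Mapping.single n a)" "\<And>f g. P f \<Longrightarrow> P g \<Longrightarrow> P (f + g)"
  shows "P f"
proof (induction f rule: update_induct)
  case const
  show ?case using assms(1) [of 0 0] by simp
next
  case (update f a b)
  have "Poly_Mapping.update a b f = f + Poly_Mapping.single a b"
    using update(1) by (intro poly_mapping_eqI)
      (auto simp: lookup_update lookup_add lookup_single when_def in_keys_iff)
  then show ?case using assms(1) [of a b] assms(2) update(3) by simp
qed

lemma augmentation_uminus: "augmentation (- f) = - augmentation f"
  using augmentation_add [of f "- f"] by (simp add: augmentation_def)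

lemma augmentation_diff: "augmentation (f - g) = augmentation f - augmentation g"
  using augmentation_add [of f "- g"] augmentation_uminus [of g] by simp

lemma augmentation_tpow_mult: "augmentation (tpow k * f) = augmentation f"
proof (induction f rule: laurent_induct)
  case (single n a)
  then show ?case by (simp add: tpow_def mult_single)
next
  case (add f g)
  then show ?case by (simp add: distrib_left augmentation_add)
qed

lemma tpow_add: "tpow (j + k) = tpow j * tpow k"
  by (simp add: tpow_def mult_single)

lemma tpow_0: "tpow 0 = 1"
  by (simp add: tpow_def)

lemma dvd_tpow: "(tpow 1 - 1) dvd (tpow k - 1)"
proof -
  have nat: "(tpow 1 - 1) dvd (tpow (int n) - 1)" for n
  proof (induction n)
    case 0
    then show ?case by (simp add: tpow_0)
  next
    case (Suc n)
    have "tpow (int (Suc n)) = tpow 1 * tpow (int n)"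
      using tpow_add [of 1 "int n"] by simp
    then have "tpow (int (Suc n)) - 1 = tpow 1 * (tpow (int n) - 1) + (tpow 1 - 1)"
      by (simp only: right_diff_distrib) simp
    then show ?case using Suc.IH by (simp only: dvd_add dvd_mult dvd_refl)
  qed
  show ?thesis
  proof (cases "k \<ge> 0")
    case True
    then show ?thesis using nat [of "nat k"] by simp
  next
    case False
    have "tpow k - 1 = - (tpow k * (tpow (- k) - 1))"
      using tpow_add [of k "- k"] by (simp add: algebra_simps tpow_0)
    then show ?thesis using nat [of "nat (- k)"] False by simp
  qed
qed

lemma dvd_augmentation: "(tpow 1 - 1) dvd (f - Poly_Mapping.single 0 (augmentation f))"
proof (induction f rule: laurent_induct)
  case (single n a)
  have "Poly_Mapping.single n a - Poly_Mapping.single 0 a = Poly_Mapping.single 0 a * (tpow n - 1)"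
    by (simp add: tpow_def mult_single right_diff_distrib)
  then show ?case using dvd_tpow [of n] by simp
next
  case (add f g)
  have "f + g - Poly_Mapping.single 0 (augmentation (f + g)) =
    (f - Poly_Mapping.single 0 (augmentation f)) + (g - Poly_Mapping.single 0 (augmentation g))"
    by (simp add: augmentation_add single_add)
  then show ?case using add by (simp only: dvd_add)
qed

text \<open>
  The quotient of the Laurent polynomials modulo \<open>t - 1\<close> is the ring of integers.
\<close>

lemma dvd_iff_augmentation: "(tpow 1 - 1) dvd f \<longleftrightarrow> augmentation f = 0"
proof
  assume "(tpow 1 - 1) dvd f"
  then obtain g where "f = tpow 1 * g - g" by (auto simp: dvd_def left_diff_distrib)
  then show "augmentation f = 0" by (simp add: augmentation_diff augmentation_tpow_mult)
next
  assume "augmentation f = 0"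
  then show "(tpow 1 - 1) dvd f" using dvd_augmentation [of f] by simp
qed

lemma lambda_coset_1: "lambda_coset (Suc 0) f = {g. augmentation g = augmentation f}"
  by (auto simp: lambda_coset_def dvd_iff_augmentation augmentation_diff)

lemma gamma_class_1: "gamma_class (Suc 0) f g =
    {({h. augmentation h = augmentation f}, {h. augmentation h = augmentation g})}"
  by (auto simp: gamma_class_def lambda_coset_1 augmentation_tpow_mult)

text \<open>
  Forgetting the index of a nonself-chord leaves its contribution to the linking number.
\<close>

lemma augmentation_linking_poly: "augmentation (linking_poly G \<gamma> i j) = linking G i j"
proof -
  let ?N = "nonself_chords G i j" and ?\<iota> = "nonself_index G \<gamma> i j"
  have zero: "nonself_writhe G \<gamma> i j n = 0" if "n \<notin> ?\<iota> ` ?N" for n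
    unfolding nonself_writhe_def using that by (intro sum.neutral) auto
  have fin: "finite (?\<iota> ` ?N)" by simp
  then have "finite {n. nonself_writhe G \<gamma> i j n \<noteq> 0}"
    by (rule finite_subset [rotated]) (use zero in blast)
  then have l: "Poly_Mapping.lookup (linking_poly G \<gamma> i j) = nonself_writhe G \<gamma> i j"
    unfolding linking_poly_def by (rule Abs_poly_mapping_inverse [OF CollectI])
  have "augmentation (linking_poly G \<gamma> i j) = (\<Sum>n \<in> ?\<iota> ` ?N. nonself_writhe G \<gamma> i j n)"
    unfolding l [symmetric]
  proof (rule augmentation_superset [OF fin], rule subsetI)
    show "n \<in> ?\<iota> ` ?N" if "n \<in> Poly_Mapping.keys (linking_poly G \<gamma> i j)" for n
      using that zero [of n] by (metis in_keys_iff l)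
  qed
  also have "\<dots> = (\<Sum>n \<in> ?\<iota> ` ?N. \<Sum>c \<in> {c \<in> ?N. ?\<iota> c = n}. chord_sign c)"
    by (simp add: nonself_writhe_def)
  also have "\<dots> = linking G i j"
    unfolding linking_def by (rule sum.group) auto
  finally show ?thesis .
qed

text \<open>
  The choice in the definition of the linking class is harmless: by \<open>gamma_class_1\<close> every
  representative and every base chord give the same class. A base chord exists because \<open>\<lambda> \<noteq> 0\<close>.
\<close>

lemma linking_class_1:
  assumes L: "L \<in> virtual_links 2" "lam L = 1"
  shows "linking_class L = {({h. augmentation h = Lk L 1 2}, {h. augmentation h = Lk L 2 1})}"
proof -
  note R = virtual_link_rep [OF L(1)]
  have lk: "linking G i j = Lk L i j" if "G \<in> L" "(i, j) = (1, 2) \<or> (i, j) = (2, 1)" for G i j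
    using equiv_invariants [OF R(3) [OF that(1)]] that(2)
    unfolding invariants_def Lk_def by (auto split: if_splits)
  let ?X = "\<lambda>X. \<exists>G \<in> L. \<exists>\<gamma>0 \<in> nonself_chords G 1 2 \<union> nonself_chords G 2 1.
    X = gamma_class (nat (lam L)) (linking_poly G \<gamma>0 1 2) (linking_poly G \<gamma>0 2 1)"
  have val: "X = {({h. augmentation h = Lk L 1 2}, {h. augmentation h = Lk L 2 1})}" if "?X X" for X
    using that L(2) lk by (auto simp: gamma_class_1 augmentation_linking_poly)
  have "nonself_chords (rep L) 1 2 \<union> nonself_chords (rep L) 2 1 \<noteq> {}"
  proof
    assume "nonself_chords (rep L) 1 2 \<union> nonself_chords (rep L) 2 1 = {}"
    then have "linking (rep L) 1 2 = 0" "linking (rep L) 2 1 = 0" by (simp_all add: linking_def)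
    then show False using L(2) by (simp add: lam_def Lk_def)
  qed
  then have "\<exists>X. ?X X" using R(1) by blast
  then have "?X (SOME X. ?X X)" by (rule someI_ex)
  then show ?thesis unfolding linking_class_def by (rule val)
qed

theorem theorem1p3:
  fixes L L' :: "diagram set"
  assumes "L \<in> virtual_links 2" and "L' \<in> virtual_links 2"
    and "lam L = 1" and "lam L' = 1"
  shows "S_equivalent 2 L L' \<longleftrightarrow>
    (\<forall>n. n \<noteq> 0 \<and> n \<noteq> 1 \<and> n \<noteq> - 1 \<longrightarrow> J L 1 n = J L' 1 n) \<and>
    (\<forall>n. n \<noteq> 0 \<and> n \<noteq> 1 \<and> n \<noteq> 2 \<longrightarrow> J L 2 n = J L' 2 n) \<and>
    linking_class L = linking_class L'"
proof -
  let ?G = "rep L" and ?H = "rep L'"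
  have G: "gauss_diagram 2 ?G" "linking ?G 1 2 - linking ?G 2 1 = 1"
    and H: "gauss_diagram 2 ?H" "linking ?H 1 2 - linking ?H 2 1 = 1"
    using virtual_link_rep(2) assms by (simp_all add: lam_def Lk_def)
  have 1: "S_equivalent 2 L L' \<longleftrightarrow> invariants ?G = invariants ?H"
    unfolding S_equivalent_iff [OF assms(1,2)]
    using equiv_invariants [of ?G ?H] invariants_complete [OF G H] by metis
  have 2: "invariants ?G = invariants ?H \<longleftrightarrow> linking ?G 1 2 = linking ?H 1 2 \<and> linking ?G 2 1 = linking ?H 2 1 \<and>
    (\<forall>n. n \<notin> {0, 1, -1} \<longrightarrow> self_writhe ?G 1 n = self_writhe ?H 1 n) \<and>
    (\<forall>n. n \<notin> {0, 1, 2} \<longrightarrow> self_writhe ?G 2 n = self_writhe ?H 2 n)"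
    using G(2) H(2) by (simp add: invariants_def fun_eq_iff)
  have 3: "linking ?G 1 2 = linking ?H 1 2 \<and> linking ?G 2 1 = linking ?H 2 1 \<longleftrightarrow>
    linking_class L = linking_class L'"
  proof -
    have "{h. augmentation h = a} = {h. augmentation h = b} \<longleftrightarrow> a = b" for a b
      by (metis (mono_tags, lifting) augmentation_single mem_Collect_eq)
    then show ?thesis
      using linking_class_1 assms by (simp add: Lk_def)
  qed
  show ?thesis
    using 3 unfolding 1 2 by (auto simp: J_def)
qed

end
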